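(* Let $0<\rho<1$, $l>0$, $T>0$, and let $\sigma\in C[0,T]$ with $0<m_\sigma\le\sigma(t)\le M_\sigma$ for all $t\in[0,T]$, where $m_\sigma,M_\sigma$ are constants. Set $\lambda_k=\frac{\pi k}{l}$ for $k\in\mathbb{N}$, and $$f_k(t)=\sqrt{\tfrac{2}{l}}\int_0^l f(x,t)\sin(\lambda_kx)\,dx,\qquad \phi_k=\sqrt{\tfrac{2}{l}}\int_0^l\phi(x)\sin(\lambda_kx)\,dx .$$ Assume that: (A1) $f\in C([0,T];W_2^4(0,l))$, $f_k(t)\ge0$ on $[0,T]$ for all $k\ge1$, and $f(0,t)=f(l,t)=f_{xx}(0,t)=f_{xx}(l,t)=0$ for all $t\in[0,T]$; (A2) $\phi\in W_2^4(0,l)$, $\phi_k\ge0$ for all $k\ge1$, $\phi(0)=\phi(l)=0$ and $\phi''(0)=\phi''(l)=0$. Assume further that the function $\psi:[0,T]\to\mathbb{R}$ and the data satisfy: (1) $\psi\in C^1[0,T]$ and $\psi(t)\ge\psi_0>0$ on $[0,T]$ for a constant $\psi_0$; (2) $\phi'(0)=\psi(0)$; (3) for all $t\in[0,T]$, $\displaystyle 0\le\frac{T^\rho}{\psi(t)}\left(f_x(0,t)-D_t^\rho\psi(t)\right)<\frac{T^\rho\pi^2}{l^2}(M_\sigma-m_\sigma)-\Gamma(\rho+1)$; (4) $\displaystyle \frac{T^{2\rho}}{\Gamma(\rho+1)}\left\|f_{xxxx}\right\|_{C([0,T];L_2(0,l))}+T^\rho\left\|\phi^{(4)}\right\|_{L_2(0,l)}<\frac{\sqrt6\,\psi_0\,\Gamma(\rho+1)}{l\,M_\sigma}$.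 Then the inverse problem of finding a pair $\{u(x,t);q(t)\}$ such that $$D_t^\rho u(x,t)-\sigma(t)u_{xx}(x,t)+q(t)u(x,t)=f(x,t),\quad (x,t)\in(0,l)\times(0,T],$$ $$u(x,0)=\phi(x),\ x\in[0,l],\qquad u(0,t)=u(l,t)=0,\quad u_x(x,t)\big|_{x=0}=\psi(t),\ t\in[0,T],$$ admits a unique solution $\{u(x,t);q(t)\}$.
   Context: $D_t^\rho$ is the Gerasimov–Caputo fractional derivative of order $\rho\in(0,1)$ in $t$: $D_t^\rho h(t)=\frac{1}{\Gamma(1-\rho)}\int_0^t\frac{h'(\eta)}{(t-\eta)^\rho}\,d\eta$, $t>0$, provided the right-hand side exists. A solution of the inverse problem is a pair $\{u(x,t);q(t)\}$ with $u\in C_x^1([0,T]\times[0,l])$, $D_t^\rho u,\ u_{xx}\in C_x^1((0,T]\times[0,l])$, $q\in C[0,T]$, satisfying the equation, the initial condition, the boundary conditions and the additional condition $u_x(0,t)=\psi(t)$. Here $C_x^1$ denotes the functions that are continuous on the indicated set together with their first derivative in $x$. $W_2^m(0,l)$ is the Sobolev space of functions with weak derivatives up to order $m$ in $L_2(0,l)$, and $\|g\|_{C([0,T];L_2(0,l))}=\max_{t\in[0,T]}\|g(\cdot,t)\|_{L_2(0,l)}$.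
   Formalization: For the solution u, D_t^ρ u is read as the t-derivative of the convolution of u − u(x,0) with t^(−ρ)/Γ(1−ρ), not through a pointwise u_t, since for merely continuous σ the solution may be nowhere differentiable in t; the formula with ψ' is kept for ψ. *)

theory Defs
  imports "HOL-Analysis.Analysis"
begin

section \<open>The fractional derivative\<close>

definition caputo :: "real \<Rightarrow> (real \<Rightarrow> real) \<Rightarrow> real \<Rightarrow> real" where
  "caputo \<rho> h t =
     1 / Gamma (1 - \<rho>) * integral {0..t} (\<lambda>\<eta>. deriv h \<eta> / (t - \<eta>) powr \<rho>)"

definition caputo_primitive :: "real \<Rightarrow> (real \<Rightarrow> real) \<Rightarrow> real \<Rightarrow> real" where
  "caputo_primitive \<rho> h t =
     1 / Gamma (1 - \<rho>) * integral {0..t} (\<lambda>\<eta>. (h \<eta> - h 0) / (t - \<eta>) powr \<rho>)"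

text \<open>
  For merely continuous coefficients the functions u(x, .) solving the equation are in general
  only Hoelder continuous in t and may have no derivative h' at any point.  For them the integral
  in \<^const>\<open>caputo\<close> is read with the generalised derivative h', as the convolution of
  h' with the kernel \<open>t powr - \<rho> / Gamma (1 - \<rho>)\<close>, that is, as the derivative in t
  of the convolution of \<open>h - h 0\<close> with this kernel.  By \<open>has_caputo_caputo\<close> below
  this extends \<^const>\<open>caputo\<close>: if h is differentiable on the open interval, the integral
  converges absolutely and depends continuously on \<open>t > 0\<close>, both agree.
\<close>

definition has_caputo :: "real \<Rightarrow> real \<Rightarrow> (real \<Rightarrow> real) \<Rightarrow> real \<Rightarrow> real \<Rightarrow> bool" where
  "has_caputo \<rho> T h D t \<longleftrightarrow>
     (\<forall>s\<in>{0..T}. (\<lambda>\<eta>. (h \<eta> - h 0) / (s - \<eta>) powr \<rho>) absolutely_integrable_on {0..s}) \<and>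
     (caputo_primitive \<rho> h has_real_derivative D) (at t within {0..T})"

lemma kernel_has_integral:
  fixes \<rho> a b :: real
  assumes "0 < \<rho>" "\<rho> < 1" "a \<le> b"
  shows "((\<lambda>s. 1 / (s - a) powr \<rho>) has_integral (b - a) powr (1 - \<rho>) / (1 - \<rho>)) {a..b}"
proof -
  have "((\<lambda>s. 1 / (s - a) powr \<rho>) has_integral
          (b - a) powr (1 - \<rho>) / (1 - \<rho>) - (a - a) powr (1 - \<rho>) / (1 - \<rho>)) {a..b}"
  proof (rule fundamental_theorem_of_calculus_interior)
    show "continuous_on {a..b} (\<lambda>x. (x - a) powr (1 - \<rho>) / (1 - \<rho>))"
      using assms by (intro continuous_intros continuous_on_powr') auto
    fix x assume x: "x \<in> {a<..<b}"
    have "((\<lambda>x. (x - a) powr (1 - \<rho>) / (1 - \<rho>)) has_real_derivative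
             ((1 - \<rho>) * (x - a) powr (1 - \<rho> - 1)) / (1 - \<rho>)) (at x)"
      using assms x by (auto intro!: derivative_eq_intros)
    moreover have "((1 - \<rho>) * (x - a) powr (1 - \<rho> - 1)) / (1 - \<rho>) = 1 / (x - a) powr \<rho>"
      using assms by (simp add: powr_minus_divide)
    ultimately show "((\<lambda>x. (x - a) powr (1 - \<rho>) / (1 - \<rho>))
        has_vector_derivative 1 / (x - a) powr \<rho>) (at x)"
      by (simp add: has_real_derivative_iff_has_vector_derivative)
  qed (use assms in auto)
  thus ?thesis by simp
qed

lemma kernel_has_integral':
  fixes \<rho> a b :: real
  assumes "0 < \<rho>" "\<rho> < 1" "a \<le> b"
  shows "((\<lambda>s. 1 / (b - s) powr \<rho>) has_integral (b - a) powr (1 - \<rho>) / (1 - \<rho>)) {a..b}"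
proof -
  have "((\<lambda>s. 1 / (- s + b) powr \<rho>) has_integral (b - a) powr (1 - \<rho>) / (1 - \<rho>)) {a..b}"
    using kernel_has_integral[of \<rho> "-b" "-a"] assms
    by (subst has_integral_reflect_real[symmetric]) (auto simp: add.commute)
  thus ?thesis by simp
qed

lemma sigma_finite_lebesgue: "sigma_finite_measure (lebesgue :: real measure)"
proof
  obtain A :: "real set set" where "countable A" "A \<subseteq> sets lborel" "\<Union>A = space lborel"
      "\<forall>a\<in>A. emeasure lborel a \<noteq> \<infinity>"
    using lborel.sigma_finite_countable by blast
  thus "\<exists>A. countable A \<and> A \<subseteq> sets lebesgue \<and> \<Union> A = space lebesgue \<and>
          (\<forall>a\<in>A. emeasure (lebesgue :: real measure) a \<noteq> \<infinity>)"
    by (intro exI[of _ A]) (auto simp: subset_iff)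
qed

context
  fixes \<rho> T :: real and h :: "real \<Rightarrow> real"
  assumes rho: "0 < \<rho>" "\<rho> < 1" and T: "0 < T"
  assumes cont: "continuous_on {0..T} h"
  assumes diff: "\<And>t. t \<in> {0<..<T} \<Longrightarrow> h differentiable (at t)"
  assumes int: "\<And>t. t \<in> {0<..T} \<Longrightarrow>
      (\<lambda>\<eta>. deriv h \<eta> / (t - \<eta>) powr \<rho>) absolutely_integrable_on {0..t}"
begin

lemma diff_vector:
  assumes "t \<in> {0<..<T}"
  shows "(h has_vector_derivative deriv h t) (at t)"
  using diff[OF assms] DERIV_deriv_iff_real_differentiable
  by (auto simp flip: has_real_derivative_iff_has_vector_derivative)

lemma kernel_abs: "0 \<le> s \<Longrightarrow> (\<lambda>\<eta>. 1 / (s - \<eta>) powr \<rho>) absolutely_integrable_on {0..s}"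
  using kernel_has_integral'[OF rho, of 0 s]
  by (intro nonnegative_absolutely_integrable_1) (auto simp: integrable_on_def)

lemma cont_abs:
  fixes f g :: "real \<Rightarrow> real"
  assumes g: "continuous_on {0..s} g" and f: "f absolutely_integrable_on {0..s}"
  shows "(\<lambda>x. g x * f x) absolutely_integrable_on {0..s}"
proof (rule absolutely_integrable_bounded_measurable_product_real[OF _ _ _ f])
  show "g \<in> borel_measurable (lebesgue_on {0..s})"
    by (rule continuous_imp_measurable_on_sets_lebesgue[OF g]) auto
  show "bounded (g ` {0..s})"
    by (intro compact_imp_bounded compact_continuous_image g) auto
qed auto

lemma deriv_abs:
  assumes s: "s \<in> {0..T}"
  shows "deriv h absolutely_integrable_on {0..s}"
proof -
  have "(\<lambda>x. (T - x) powr \<rho> * (deriv h x / (T - x) powr \<rho>)) absolutely_integrable_on {0..T}"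
    using rho T by (intro cont_abs int continuous_intros continuous_on_powr') auto
  hence "deriv h absolutely_integrable_on {0..T}"
    by (rule absolutely_integrable_spike[where S = "{T}"]) auto
  thus ?thesis
    using s by (auto intro: set_integrable_subset)
qed

lemma caputo_kernel_abs:
  assumes s: "s \<in> {0..T}"
  shows "(\<lambda>\<eta>. (h \<eta> - h 0) / (s - \<eta>) powr \<rho>) absolutely_integrable_on {0..s}"
proof -
  have "(\<lambda>\<eta>. (h \<eta> - h 0) * (1 / (s - \<eta>) powr \<rho>)) absolutely_integrable_on {0..s}"
    using s by (intro cont_abs kernel_abs continuous_intros continuous_on_subset[OF cont]) auto
  thus ?thesis by simp
qed

lemma smooth_abs:
  assumes s: "s \<in> {0..T}"
  shows "(\<lambda>\<eta>. (s - \<eta>) powr (1 - \<rho>) / (1 - \<rho>) * deriv h \<eta>) absolutely_integrable_on {0..s}"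
  using rho s by (intro cont_abs deriv_abs continuous_intros continuous_on_powr') auto

lemma by_parts:
  assumes s: "s \<in> {0..T}"
  shows "integral {0..s} (\<lambda>\<eta>. (h \<eta> - h 0) / (s - \<eta>) powr \<rho>) =
         integral {0..s} (\<lambda>\<eta>. (s - \<eta>) powr (1 - \<rho>) / (1 - \<rho>) * deriv h \<eta>)"
    (is "_ = ?I")
proof -
  have "((\<lambda>\<eta>. (- 1 / (s - \<eta>) powr \<rho>) * (h \<eta> - h 0)) has_integral - ?I) {0..s}"
  proof (rule integration_by_parts_interior[OF bounded_bilinear_mult])
    show "continuous_on {0..s} (\<lambda>\<eta>. (s - \<eta>) powr (1 - \<rho>) / (1 - \<rho>))"
      using rho by (intro continuous_intros continuous_on_powr') auto
    show "continuous_on {0..s} (\<lambda>\<eta>. h \<eta> - h 0)"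
      using s by (intro continuous_intros continuous_on_subset[OF cont]) auto
    fix x assume x: "x \<in> {0<..<s}"
    have "((\<lambda>\<eta>. (s - \<eta>) powr (1 - \<rho>) / (1 - \<rho>)) has_real_derivative
             (- (1 - \<rho>) * (s - x) powr (1 - \<rho> - 1)) / (1 - \<rho>)) (at x)"
      using rho x by (auto intro!: derivative_eq_intros simp: divide_simps) (simp add: algebra_simps)
    moreover have "(- (1 - \<rho>) * (s - x) powr (1 - \<rho> - 1)) / (1 - \<rho>) = - 1 / (s - x) powr \<rho>"
      proof -
      have "- (1 - \<rho>) / (1 - \<rho>) = -1" using rho by (simp add: divide_eq_minus_1_iff)
      moreover have "(s - x) powr (1 - \<rho> - 1) = 1 / (s - x) powr \<rho>"
        by (simp add: powr_minus_divide)
      ultimately show ?thesis by (metis divide_divide_eq_left' minus_divide_left mult.commute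
          mult.left_neutral mult_minus_left times_divide_eq_left)
    qed
    ultimately show "((\<lambda>\<eta>. (s - \<eta>) powr (1 - \<rho>) / (1 - \<rho>))
        has_vector_derivative - 1 / (s - x) powr \<rho>) (at x)"
      by (simp add: has_real_derivative_iff_has_vector_derivative)
    show "((\<lambda>\<eta>. h \<eta> - h 0) has_vector_derivative deriv h x) (at x)"
      using diff_vector[of x] x s by (auto intro!: derivative_eq_intros)
  next
    show "((\<lambda>x. (s - x) powr (1 - \<rho>) / (1 - \<rho>) * deriv h x) has_integral
        (s - s) powr (1 - \<rho>) / (1 - \<rho>) * (h s - h 0) -
        (s - 0) powr (1 - \<rho>) / (1 - \<rho>) * (h 0 - h 0) - - ?I) {0..s}"
      using integrable_integral[OF set_lebesgue_integral_eq_integral(1)[OF smooth_abs[OF s]]]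
      by (simp del: integral_mult_left integral_divide times_divide_eq_left)
  qed (use s in auto)
  from has_integral_neg[OF this] show ?thesis
    by (simp add: integral_unique)
qed

lemma fubini:
  assumes t: "t \<in> {0..T}"
  defines "G \<equiv> (\<lambda>s. integral {0..s} (\<lambda>\<eta>. deriv h \<eta> / (s - \<eta>) powr \<rho>))"
  shows "G absolutely_integrable_on {0..t}"
    and "integral {0..t} G =
           integral {0..t} (\<lambda>\<eta>. (t - \<eta>) powr (1 - \<rho>) / (1 - \<rho>) * deriv h \<eta>)"
proof -
  define d where "d = (\<lambda>\<eta>. indicator {0..t} \<eta> * deriv h \<eta>)"
  define K where "K = (\<lambda>\<eta> s. if \<eta> \<le> s \<and> s \<le> t then 1 / (s - \<eta>) powr \<rho> else (0::real))"
  define F where "F = (\<lambda>(\<eta>, s). d \<eta> * K \<eta> s)"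
  define k where "k = (\<lambda>\<eta>. (t - \<eta>) powr (1 - \<rho>) / (1 - \<rho>))"
  interpret sigma_finite_measure "lebesgue :: real measure"
    by (rule sigma_finite_lebesgue)
  interpret P: pair_sigma_finite "lebesgue :: real measure" "lebesgue :: real measure" ..
  have d_int: "integrable lebesgue d"
    using deriv_abs[OF t] by (simp add: set_integrable_def d_def)
  have id_meas: "(\<lambda>x::real. x) \<in> borel_measurable lebesgue"
    by (rule measurable_completion) simp
  have [measurable]: "d \<in> borel_measurable lebesgue"
    using d_int by (rule borel_measurable_integrable)
  have [measurable]: "fst \<in> borel_measurable (lebesgue \<Otimes>\<^sub>M lebesgue :: (real \<times> real) measure)"
    by (rule measurable_compose[OF measurable_fst id_meas])
  have [measurable]: "snd \<in> borel_measurable (lebesgue \<Otimes>\<^sub>M lebesgue :: (real \<times> real) measure)"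
    by (rule measurable_compose[OF measurable_snd id_meas])
  have F_meas: "F \<in> borel_measurable (lebesgue \<Otimes>\<^sub>M lebesgue)"
    unfolding F_def K_def case_prod_beta by measurable
  have K_int: "((K \<eta>) has_integral k \<eta>) UNIV" "integrable lebesgue (K \<eta>)"
      "integral\<^sup>L lebesgue (K \<eta>) = k \<eta>" if "\<eta> \<in> {0..t}" for \<eta>
  proof -
    have "((\<lambda>s. if s \<in> {\<eta>..t} then 1 / (s - \<eta>) powr \<rho> else 0) has_integral k \<eta>) UNIV"
      unfolding has_integral_restrict_UNIV k_def
      using that rho by (intro kernel_has_integral) auto
    thus *: "((K \<eta>) has_integral k \<eta>) UNIV" by (simp add: K_def)
    have "K \<eta> absolutely_integrable_on UNIV"
      using * by (intro nonnegative_absolutely_integrable_1) (auto simp: integrable_on_def K_def)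
    thus i: "integrable lebesgue (K \<eta>)" by (simp add: set_integrable_def)
    show "integral\<^sup>L lebesgue (K \<eta>) = k \<eta>"
      using has_integral_integral_lebesgue[OF i] * has_integral_unique by blast
  qed
  have F_int: "integrable lebesgue (\<lambda>s. F (\<eta>, s))" for \<eta>
    using K_int(2)[of \<eta>] by (cases "\<eta> \<in> {0..t}") (auto simp: F_def d_def)
  have F_val: "(\<integral>s. F (\<eta>, s) \<partial>lebesgue) = indicator {0..t} \<eta> * (k \<eta> * deriv h \<eta>)" for \<eta>
    using K_int(3)[of \<eta>] by (cases "\<eta> \<in> {0..t}") (auto simp: F_def d_def)
  have F_norm: "(\<integral>s. norm (F (\<eta>, s)) \<partial>lebesgue) = \<bar>indicator {0..t} \<eta> * (k \<eta> * deriv h \<eta>)\<bar>" for \<eta>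
  proof -
    have "norm (F (\<eta>, s)) = \<bar>d \<eta>\<bar> * K \<eta> s" for s
      by (auto simp: F_def K_def abs_mult)
    moreover have "0 \<le> k \<eta>" using rho by (simp add: k_def)
    ultimately show ?thesis
      using K_int(3)[of \<eta>] by (cases "\<eta> \<in> {0..t}") (auto simp: d_def abs_mult)
  qed
  have kd: "integrable lebesgue (\<lambda>\<eta>. indicator {0..t} \<eta> * (k \<eta> * deriv h \<eta>))"
    using smooth_abs[OF t] by (simp add: set_integrable_def k_def)
  have FI: "integrable (lebesgue \<Otimes>\<^sub>M lebesgue) F"
    by (rule P.Fubini_integrable[OF F_meas]) (use kd F_int F_norm in \<open>auto\<close>)
  hence FI': "integrable (lebesgue \<Otimes>\<^sub>M lebesgue) (case_prod (\<lambda>\<eta> s. d \<eta> * K \<eta> s))"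
    by (simp add: F_def)
  have G_val: "(\<integral>\<eta>. d \<eta> * K \<eta> s \<partial>lebesgue) = indicator {0..t} s * G s" for s
  proof (cases "s \<in> {0<..t}")
    case True
    have "(\<lambda>\<eta>. d \<eta> * K \<eta> s) = (\<lambda>\<eta>. indicator {0..s} \<eta> * (deriv h \<eta> / (s - \<eta>) powr \<rho>))"
      using True by (auto simp: d_def K_def indicator_def fun_eq_iff)
    thus ?thesis
      using set_lebesgue_integral_eq_integral(2)[OF int[of s]] True t
      by (simp add: set_lebesgue_integral_def G_def)
  next
    case False
    have "(\<lambda>\<eta>. d \<eta> * K \<eta> s) = (\<lambda>_. 0)"
      using False by (auto simp: d_def K_def indicator_def fun_eq_iff)
    moreover have "indicator {0..t} s * G s = 0"
      using False by (cases "s = 0") (auto simp: G_def)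
    ultimately show ?thesis by simp
  qed
  have "integrable lebesgue (\<lambda>s. \<integral>\<eta>. d \<eta> * K \<eta> s \<partial>lebesgue)"
    by (rule P.integrable_snd[OF FI'])
  thus *: "G absolutely_integrable_on {0..t}"
    by (simp add: G_val set_integrable_def)
  have "(\<integral>s. (\<integral>\<eta>. d \<eta> * K \<eta> s \<partial>lebesgue) \<partial>lebesgue) =
        (\<integral>\<eta>. (\<integral>s. d \<eta> * K \<eta> s \<partial>lebesgue) \<partial>lebesgue)"
    by (rule P.Fubini_integral[OF FI'])
  also have "\<dots> = (\<integral>\<eta>. indicator {0..t} \<eta> * (k \<eta> * deriv h \<eta>) \<partial>lebesgue)"
    using F_val by (simp add: F_def)
  finally show "integral {0..t} G =
      integral {0..t} (\<lambda>\<eta>. (t - \<eta>) powr (1 - \<rho>) / (1 - \<rho>) * deriv h \<eta>)"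
    unfolding G_val set_lebesgue_integral_eq_integral(2)[OF *, symmetric]
      set_lebesgue_integral_eq_integral(2)[OF smooth_abs[OF t], symmetric]
    by (simp add: set_lebesgue_integral_def k_def)
qed

proposition has_caputo_caputo:
  assumes cont': "continuous_on {0<..T} (caputo \<rho> h)"
  assumes t: "t \<in> {0<..T}"
  shows "has_caputo \<rho> T h (caputo \<rho> h t) t"
proof -
  define G where "G = (\<lambda>s. integral {0..s} (\<lambda>\<eta>. deriv h \<eta> / (s - \<eta>) powr \<rho>))"
  define \<delta> where "\<delta> = t / 2"
  have \<delta>: "0 < \<delta>" "\<delta> < t" "t \<le> T" using t by (auto simp: \<delta>_def)
  have G0: "Gamma (1 - \<rho>) > 0" using rho by (intro Gamma_real_pos) auto
  have "continuous_on {0<..T} (\<lambda>s. Gamma (1 - \<rho>) * caputo \<rho> h s)"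
    by (intro continuous_intros cont')
  hence "continuous_on {0<..T} G"
    using G0 by (simp add: caputo_def G_def)
  hence "((\<lambda>s. integral {\<delta>..s} G) has_real_derivative G t) (at t within {\<delta>..T})"
    using \<delta> by (intro integral_has_real_derivative) (auto elim: continuous_on_subset)
  hence "((\<lambda>s. 1 / Gamma (1 - \<rho>) * (integral {0..\<delta>} G + integral {\<delta>..s} G))
           has_real_derivative caputo \<rho> h t) (at t within {\<delta>..T})"
    using G0 by (auto intro!: derivative_eq_intros simp: caputo_def G_def)
  moreover have "1 / Gamma (1 - \<rho>) * (integral {0..\<delta>} G + integral {\<delta>..s} G) =
      caputo_primitive \<rho> h s" if s: "s \<in> {\<delta>..T}" for s
  proof -
    have s': "s \<in> {0..T}" using s \<delta> by auto
    have "G integrable_on {0..s}"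
      using set_lebesgue_integral_eq_integral(1)[OF fubini(1)[OF s']] by (simp add: G_def)
    hence "integral {0..\<delta>} G + integral {\<delta>..s} G = integral {0..s} G"
      using s \<delta> by (intro Henstock_Kurzweil_Integration.integral_combine) auto
    thus ?thesis
      using fubini(2)[OF s'] by_parts[OF s'] by (simp add: caputo_primitive_def G_def)
  qed
  ultimately have "(caputo_primitive \<rho> h has_real_derivative caputo \<rho> h t) (at t within {\<delta>..T})"
    using has_field_derivative_transform_within[OF _ zero_less_one] \<delta> by force
  moreover have "at t within {\<delta>..T} = at t within {0..T}"
    by (rule at_within_nhd[of t "{\<delta><..}"]) (use \<delta> in auto)
  ultimately show ?thesis
    using caputo_kernel_abs by (auto simp: has_caputo_def)
qed

end


section \<open>Sobolev spaces on the interval (0, l)\<close>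

definition test_function :: "real \<Rightarrow> (real \<Rightarrow> real) \<Rightarrow> bool" where
  "test_function l \<zeta> \<longleftrightarrow>
     (\<forall>k x. ((deriv ^^ k) \<zeta>) differentiable (at x)) \<and>
     (\<exists>a b. 0 < a \<and> b < l \<and> (\<forall>x. x \<notin> {a..b} \<longrightarrow> \<zeta> x = 0))"

definition L2 :: "real \<Rightarrow> (real \<Rightarrow> real) \<Rightarrow> bool" where
  "L2 l g \<longleftrightarrow> g \<in> borel_measurable (lebesgue_on {0<..<l}) \<and>
     integrable (lebesgue_on {0<..<l}) (\<lambda>x. (g x)\<^sup>2)"

definition L2_norm :: "real \<Rightarrow> (real \<Rightarrow> real) \<Rightarrow> real" where
  "L2_norm l g = sqrt (\<integral>x. (g x)\<^sup>2 \<partial>lebesgue_on {0<..<l})"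

definition weak_derivative :: "real \<Rightarrow> nat \<Rightarrow> (real \<Rightarrow> real) \<Rightarrow> (real \<Rightarrow> real) \<Rightarrow> bool" where
  "weak_derivative l j g v \<longleftrightarrow>
     (\<forall>\<zeta>. test_function l \<zeta> \<longrightarrow>
        (\<integral>x. g x * (deriv ^^ j) \<zeta> x \<partial>lebesgue_on {0<..<l}) =
        (- 1) ^ j * (\<integral>x. v x * \<zeta> x \<partial>lebesgue_on {0<..<l}))"

definition W2 :: "nat \<Rightarrow> real \<Rightarrow> (real \<Rightarrow> real) \<Rightarrow> bool" where
  "W2 m l g \<longleftrightarrow> L2 l g \<and> (\<forall>j\<in>{1..m}. \<exists>v. L2 l v \<and> weak_derivative l j g v)"

text \<open>The weak derivative, chosen up to equality almost everywhere.\<close>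

definition wderiv :: "real \<Rightarrow> nat \<Rightarrow> (real \<Rightarrow> real) \<Rightarrow> real \<Rightarrow> real" where
  "wderiv l j g = (if j = 0 then g else (SOME v. L2 l v \<and> weak_derivative l j g v))"

definition W2_norm :: "nat \<Rightarrow> real \<Rightarrow> (real \<Rightarrow> real) \<Rightarrow> real" where
  "W2_norm m l g = sqrt (\<Sum>j\<le>m. (L2_norm l (wderiv l j g))\<^sup>2)"

text \<open>
  Elements of the Sobolev space are identified with their continuous representatives on [0, l];
  these have classical derivatives of order less than m up to the boundary.
\<close>

definition W2_rep :: "nat \<Rightarrow> real \<Rightarrow> (real \<Rightarrow> real) \<Rightarrow> bool" where
  "W2_rep m l g \<longleftrightarrow> W2 m l g \<and> continuous_on {0..l} g"

definition C_W2 :: "nat \<Rightarrow> real \<Rightarrow> real \<Rightarrow> (real \<Rightarrow> real \<Rightarrow> real) \<Rightarrow> bool" where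
  "C_W2 m l T f \<longleftrightarrow>
     (\<forall>t\<in>{0..T}. W2_rep m l (\<lambda>x. f x t)) \<and>
     (\<forall>t\<in>{0..T}. ((\<lambda>s. W2_norm m l (\<lambda>x. f x s - f x t)) \<longlongrightarrow> 0) (at t within {0..T}))"

definition C_L2_norm :: "real \<Rightarrow> real \<Rightarrow> (real \<Rightarrow> real \<Rightarrow> real) \<Rightarrow> real" where
  "C_L2_norm l T g = (SUP t\<in>{0..T}. L2_norm l (\<lambda>x. g x t))"

text \<open>Classical derivatives on [0, l], one-sided at the end points.\<close>

primrec xderiv :: "real \<Rightarrow> nat \<Rightarrow> (real \<Rightarrow> real) \<Rightarrow> real \<Rightarrow> real" where
  "xderiv l 0 g = g"
| "xderiv l (Suc n) g = (\<lambda>x. vector_derivative (xderiv l n g) (at x within {0..l}))"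


section \<open>The inverse problem\<close>

definition sine_coeff :: "real \<Rightarrow> nat \<Rightarrow> (real \<Rightarrow> real) \<Rightarrow> real" where
  "sine_coeff l k g = sqrt (2 / l) * integral {0..l} (\<lambda>x. g x * sin (pi * real k / l * x))"

definition C1_on :: "real \<Rightarrow> (real \<Rightarrow> real) \<Rightarrow> bool" where
  "C1_on T g \<longleftrightarrow> (\<exists>g'. continuous_on {0..T} g' \<and>
     (\<forall>t\<in>{0..T}. (g has_real_derivative g' t) (at t within {0..T})))"

definition C1x :: "real set \<Rightarrow> real \<Rightarrow> (real \<Rightarrow> real \<Rightarrow> real) \<Rightarrow> bool" where
  "C1x J l v \<longleftrightarrow>
     continuous_on ({0..l} \<times> J) (\<lambda>(x, t). v x t) \<and>
     (\<exists>vx. continuous_on ({0..l} \<times> J) (\<lambda>(x, t). vx x t) \<and>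
        (\<forall>x\<in>{0..l}. \<forall>t\<in>J. ((\<lambda>y. v y t) has_real_derivative vx x t) (at x within {0..l})))"

definition inverse_solution ::
  "real \<Rightarrow> real \<Rightarrow> real \<Rightarrow> (real \<Rightarrow> real) \<Rightarrow> (real \<Rightarrow> real \<Rightarrow> real) \<Rightarrow> (real \<Rightarrow> real) \<Rightarrow> (real \<Rightarrow> real) \<Rightarrow>
   (real \<Rightarrow> real \<Rightarrow> real) \<Rightarrow> (real \<Rightarrow> real) \<Rightarrow> bool" where
  "inverse_solution \<rho> l T \<sigma> f \<phi> \<psi> u q \<longleftrightarrow>
     C1x {0..T} l u \<and> continuous_on {0..T} q \<and>
     (\<exists>Du ux uxx. C1x {0<..T} l Du \<and> C1x {0<..T} l uxx \<and>
        (\<forall>x\<in>{0..l}. \<forall>t\<in>{0<..T}.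
           has_caputo \<rho> T (u x) (Du x t) t \<and>
           ((\<lambda>y. u y t) has_real_derivative ux x t) (at x within {0..l}) \<and>
           ((\<lambda>y. ux y t) has_real_derivative uxx x t) (at x within {0..l})) \<and>
        (\<forall>x\<in>{0<..<l}. \<forall>t\<in>{0<..T}. Du x t - \<sigma> t * uxx x t + q t * u x t = f x t)) \<and>
     (\<forall>x\<in>{0..l}. u x 0 = \<phi> x) \<and>
     (\<forall>t\<in>{0..T}. u 0 t = 0 \<and> u l t = 0 \<and>
        ((\<lambda>x. u x t) has_real_derivative \<psi> t) (at 0 within {0..l}))"

end

theory Submission
  imports Defs
begin

text \<open>
  Expanding u in the functions sin (pi k x / l) turns the equation into the fractional equations
  \<open>D c\<^sub>k + (\<sigma> \<lambda>\<^sub>k\<^sup>2 + q) c\<^sub>k = F\<^sub>k\<close>, and differentiating it in x at x = 0 turns the additional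
  condition into the feedback law \<open>q = q\<^sub>0 - (\<sigma> / \<psi>) S\<close> with \<open>S = \<Sum>k. \<lambda>\<^sub>k\<^sup>3 c\<^sub>k\<close>.  If q is truncated to
  a bounded interval, the map given by the feedback law is a contraction for a norm with weight exp (- L t).
  The truncation is removed by an a priori bound which rests on the signs of the data: the \<open>c\<^sub>k\<close> are
  nonnegative by a comparison principle, the flux \<open>\<Sum>k. \<lambda>\<^sub>k c\<^sub>k\<close> is at most \<open>\<psi>\<close> by the same principle,
  and the Cauchy--Schwarz inequality \<open>S\<^sup>2 \<le> (\<Sum>k. \<lambda>\<^sub>k c\<^sub>k) (\<Sum>k. \<lambda>\<^sub>k\<^sup>5 c\<^sub>k)\<close> shows that the dissipation
  dominates the quadratic term \<open>\<sigma> S\<^sup>2 / \<psi>\<close>, whence \<open>D S \<le> \<Sum>k. \<lambda>\<^sub>k\<^sup>3 F\<^sub>k\<close>.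

  The comparison principle cannot be proved at a minimum, because solutions are in general only
  Hoelder continuous with exponent \<open>\<rho>\<close>.  It follows from the identity that expresses the kernel
  \<open>(t - s) powr (\<rho> - 1)\<close>, for \<open>s < b < t\<close>, as a superposition with nonnegative weights of the kernels
  \<open>(\<tau> - s) powr (\<rho> - 1)\<close> with \<open>s < \<tau> < b\<close>.
\<close>

section \<open>Fractional integrals\<close>

text \<open>\<open>frac_int\<close> is the Riemann-Liouville integral after the substitution
  \<open>s = t * (1 - r powr (1 / \<rho>))\<close>: the singular kernel becomes a constant weight on
  \<open>{0..1}\<close>, so that continuity in t and monotonicity need no singular integrals.
  Fractional equations are used in the integrated form \<open>c t = B + frac_int \<rho> g t\<close>,
  which makes sense for a merely continuous c.

  The system is quadratic, because q multiplies the modes, and the Lipschitz bound for S as a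
  function of q depends on a lower bound of q; this forces the truncation. Its removal is one-sided.
  Since S is nonnegative, the truncated fixed point satisfies \<open>q \<le> q\<^sub>0\<close>, so
  for large R the upper cut never acts, and the lower cut can only raise q. The a priori bound is
  therefore proved for all q with \<open>feedback q \<le> q\<close>, a condition that the truncated
  function meets before it is known to be a fixed point.

  The cubic weight in S is reached from the Sobolev data by Bessel's inequality for the fourth
  derivative, followed by Cauchy-Schwarz against the summable squares of
  \<open>1 / \<lambda>\<close>.\<close>

definition frac_int :: "real \<Rightarrow> (real \<Rightarrow> real) \<Rightarrow> real \<Rightarrow> real" where
  "frac_int \<rho> g t =
     t powr \<rho> / Gamma (\<rho> + 1) * integral {0..1} (\<lambda>r. g (t * (1 - r powr (1 / \<rho>))))"

section \<open>Continuity, linearity and monotonicity of the fractional integral\<close>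

lemma continuous_on_powr_pos_exponent:
  fixes f :: "'a::topological_space \<Rightarrow> real"
  assumes "continuous_on S f" "\<And>x. x \<in> S \<Longrightarrow> 0 \<le> f x" "0 < a"
  shows "continuous_on S (\<lambda>x. f x powr a)"
  by (rule continuous_on_powr'[OF assms(1) continuous_on_const]) (use assms in auto)

lemma Gamma_add_one: "0 < \<rho> \<Longrightarrow> Gamma (\<rho> + 1) = \<rho> * Gamma (\<rho>::real)"
  by (rule Gamma_plus1) (auto elim!: nonpos_Ints_cases)

lemma powr_inverse_le_one: "0 < (\<rho>::real) \<Longrightarrow> 0 \<le> r \<Longrightarrow> r \<le> 1 \<Longrightarrow> r powr (1 / \<rho>) \<le> 1"
  by (rule powr_le1) auto

lemma frac_int_point_mem:
  fixes \<rho> T :: real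
  assumes "0 < \<rho>" "r \<in> {0..1}" "t \<in> {0..T}"
  shows "t * (1 - r powr (1 / \<rho>)) \<in> {0..t}" "t * (1 - r powr (1 / \<rho>)) \<in> {0..T}"
proof -
  have "0 \<le> 1 - r powr (1 / \<rho>)" "1 - r powr (1 / \<rho>) \<le> 1"
    using powr_inverse_le_one[of \<rho> r] assms by auto
  with assms(3) show *: "t * (1 - r powr (1 / \<rho>)) \<in> {0..t}"
    by (auto intro: mult_left_le)
  with assms(3) show "t * (1 - r powr (1 / \<rho>)) \<in> {0..T}" by auto
qed

lemma continuous_on_frac_int_integrand:
  fixes \<rho> T :: real and g :: "real \<Rightarrow> real"
  assumes "0 < \<rho>" "continuous_on {0..T} g"
  shows "continuous_on ({0..T} \<times> {0..1}) (\<lambda>(t, r). g (t * (1 - r powr (1 / \<rho>))))"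
  unfolding case_prod_beta
proof (rule continuous_on_compose2[OF assms(2)])
  show "continuous_on ({0..T} \<times> {0..1}) (\<lambda>x. fst x * (1 - snd x powr (1 / \<rho>)))"
    using assms(1) by (intro continuous_intros continuous_on_powr_pos_exponent) auto
qed (use frac_int_point_mem(2)[OF assms(1)] in fastforce)

lemma continuous_on_frac_int_integrand1:
  fixes \<rho> T :: real and g :: "real \<Rightarrow> real"
  assumes "0 < \<rho>" "continuous_on {0..T} g" "t \<in> {0..T}"
  shows "continuous_on {0..1} (\<lambda>r. g (t * (1 - r powr (1 / \<rho>))))"
proof (rule continuous_on_compose2[OF assms(2)])
  show "continuous_on {0..1} (\<lambda>x. t * (1 - x powr (1 / \<rho>)))"
    using assms(1) by (intro continuous_intros continuous_on_powr_pos_exponent) auto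
qed (use frac_int_point_mem(2)[OF assms(1) _ assms(3)] in fastforce)

lemma frac_int_integrable:
  fixes \<rho> T :: real and g :: "real \<Rightarrow> real"
  assumes "0 < \<rho>" "continuous_on {0..T} g" "t \<in> {0..T}"
  shows "(\<lambda>r. g (t * (1 - r powr (1 / \<rho>)))) integrable_on {0..1}"
  by (rule integrable_continuous_interval[OF continuous_on_frac_int_integrand1[OF assms]])

lemma continuous_on_frac_int:
  assumes "0 < \<rho>" "continuous_on {0..T} g"
  shows "continuous_on {0..T} (frac_int \<rho> g)"
proof -
  have "continuous_on {0..T} (\<lambda>t. integral (cbox 0 1) (\<lambda>r. g (t * (1 - r powr (1 / \<rho>)))))"
    using continuous_on_frac_int_integrand[OF assms] by (intro integral_continuous_on_param) auto
  moreover have "continuous_on {0..T} (\<lambda>t. t powr \<rho> / Gamma (\<rho> + 1))"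
    using assms(1) by (intro continuous_intros continuous_on_powr_pos_exponent) (auto intro!: less_imp_neq[THEN not_sym] Gamma_real_pos)
  ultimately show ?thesis
    unfolding frac_int_def by (intro continuous_on_mult) (auto simp: cbox_interval)
qed

lemma frac_int_0 [simp]: "frac_int \<rho> g 0 = 0"
  by (simp add: frac_int_def)

lemma frac_int_cong:
  assumes "0 < \<rho>" "t \<in> {0..T}" "\<And>s. s \<in> {0..t} \<Longrightarrow> g s = h s"
  shows "frac_int \<rho> g t = frac_int \<rho> h t"
  using frac_int_point_mem(1)[OF assms(1) _ assms(2)] assms(3)
  unfolding frac_int_def by (intro arg_cong2[where f="(*)"] integral_cong refl) auto

lemma frac_int_add:
  assumes "0 < \<rho>" "continuous_on {0..T} g" "continuous_on {0..T} h" "t \<in> {0..T}"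
  shows "frac_int \<rho> (\<lambda>s. g s + h s) t = frac_int \<rho> g t + frac_int \<rho> h t"
  unfolding frac_int_def
  by (simp only: Henstock_Kurzweil_Integration.integral_add[OF frac_int_integrable[OF assms(1,2,4)]
        frac_int_integrable[OF assms(1,3,4)]] distrib_left)

lemma frac_int_cmult: "frac_int \<rho> (\<lambda>s. c * g s) t = c * frac_int \<rho> g t"
  unfolding frac_int_def by simp

lemma frac_int_diff:
  assumes "0 < \<rho>" "continuous_on {0..T} g" "continuous_on {0..T} h" "t \<in> {0..T}"
  shows "frac_int \<rho> (\<lambda>s. g s - h s) t = frac_int \<rho> g t - frac_int \<rho> h t"
  using frac_int_add[of \<rho> T g "\<lambda>s. (-1) * h s" t] frac_int_cmult[of \<rho> "-1" h t] assms
  by (simp add: continuous_on_minus)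

lemma frac_int_zero [simp]: "frac_int \<rho> (\<lambda>s. 0) t = 0"
  by (simp add: frac_int_def)

lemma frac_int_sum:
  assumes "0 < \<rho>" "\<And>i. i \<in> I \<Longrightarrow> continuous_on {0..T} (g i)" "t \<in> {0..T}"
  shows "frac_int \<rho> (\<lambda>s. \<Sum>i\<in>I. g i s) t = (\<Sum>i\<in>I. frac_int \<rho> (g i) t)"
  using assms(2)
proof (induction I rule: infinite_finite_induct)
  case (insert x F)
  then show ?case
    using frac_int_add[OF assms(1), of T "g x" "\<lambda>s. \<Sum>i\<in>F. g i s" t] assms(3)
    by (auto intro: continuous_on_sum)
qed auto

lemma frac_int_const: "0 < \<rho> \<Longrightarrow> frac_int \<rho> (\<lambda>s. c) t = c * t powr \<rho> / Gamma (\<rho> + 1)"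
  unfolding frac_int_def by simp

lemma frac_int_mono:
  assumes "0 < \<rho>" "continuous_on {0..T} g" "continuous_on {0..T} h" "t \<in> {0..T}"
    and "\<And>s. s \<in> {0..t} \<Longrightarrow> g s \<le> h s"
  shows "frac_int \<rho> g t \<le> frac_int \<rho> h t"
  unfolding frac_int_def using frac_int_point_mem(1)[OF assms(1) _ assms(4)] assms
  by (intro mult_left_mono integral_le frac_int_integrable[where T=T])
     (auto intro!: divide_nonneg_pos Gamma_real_pos)

lemma frac_int_abs_le:
  assumes "0 < \<rho>" "continuous_on {0..T} g" "continuous_on {0..T} h" "t \<in> {0..T}"
    and "\<And>s. s \<in> {0..t} \<Longrightarrow> \<bar>g s\<bar> \<le> h s"
  shows "\<bar>frac_int \<rho> g t\<bar> \<le> frac_int \<rho> h t"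
proof -
  have "frac_int \<rho> g t \<le> frac_int \<rho> h t"
    using assms(5) by (intro frac_int_mono[OF assms(1-4)]) force
  moreover have "frac_int \<rho> (\<lambda>s. (-1) * g s) t \<le> frac_int \<rho> h t"
    using assms by (intro frac_int_mono[where T=T] continuous_intros) (force intro: continuous_on_minus)+
  ultimately show ?thesis unfolding frac_int_cmult by auto
qed

text \<open>The substitution \<open>r = (1 - s / t) powr \<rho>\<close> turns the definition into the usual
  Riemann--Liouville integral.\<close>

lemma frac_int_has_integral:
  assumes rho: "0 < \<rho>" and t: "t \<ge> 0" and cont: "continuous_on {0..t} g"
  shows "((\<lambda>s. (t - s) powr (\<rho> - 1) * g s) has_integral Gamma \<rho> * frac_int \<rho> g t) {0..t}"
proof (cases "t = 0")
  case True
  then show ?thesis using has_integral_refl(2)[of _ "0::real"] by simp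
next
  case False
  with t have t: "t > 0" by simp
  define r where "r = (\<lambda>s. (1 - s / t) powr \<rho>)"
  define r' where "r' = (\<lambda>s. - (\<rho> / t) * (1 - s / t) powr (\<rho> - 1))"
  define G where "G = (\<lambda>r. g (t * (1 - r powr (1 / \<rho>))))"
  \<comment> \<open>\<open>r\<close> decreases from 1 to 0, so the first of the two oriented
    integrals runs over an empty interval and only the second remains. The point t, where
    \<open>r\<close> need not be differentiable, is the exceptional set of the substitution.\<close>
  have "((\<lambda>s. r' s *\<^sub>R G (r s)) has_integral (integral {r 0..r t} G - integral {r t..r 0} G)) {0..t}"
  proof (rule has_integral_substitution_general[where s = "{t}" and c = 0 and d = 1])
    show "r ` {0..t} \<subseteq> {0..1}"
      using t rho by (auto simp: r_def intro!: powr_le1)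
    show "continuous_on {0..1} G"
      unfolding G_def by (rule continuous_on_frac_int_integrand1[where T = t]) (use rho cont t in auto)
    show "continuous_on {0..t} r"
      unfolding r_def using rho t by (intro continuous_intros continuous_on_powr_pos_exponent) auto
    fix s assume "s \<in> {0..t} - {t}"
    hence "1 - s / t > 0" using t by (auto simp: field_simps)
    thus "(r has_real_derivative r' s) (at s within {0..t})"
      unfolding r_def r'_def using t
      by (auto intro!: derivative_eq_intros simp: powr_diff divide_simps)
  qed (use t in auto)
  moreover have "r 0 = 1" "r t = 0" using t rho by (auto simp: r_def)
  ultimately have "((\<lambda>s. r' s *\<^sub>R G (r s)) has_integral - integral {0..1} G) {0..t}"
    by simp
  from has_integral_mult_right[OF this, of "- (t powr \<rho> / \<rho>)"]
  have *: "((\<lambda>s. - (t powr \<rho> / \<rho>) * (r' s * G (r s))) has_integral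
      Gamma \<rho> * frac_int \<rho> g t) {0..t}"
    using rho Gamma_real_pos[OF rho, THEN less_imp_neq] by (simp add: frac_int_def G_def Gamma_add_one)
  show ?thesis
  proof (rule has_integral_eq[OF _ *])
    fix s assume s: "s \<in> {0..t}"
    have "1 - s / t \<ge> 0" using s t by (auto simp: field_simps)
    hence "r s powr (1 / \<rho>) = 1 - s / t" using rho by (simp add: r_def powr_powr)
    hence "G (r s) = g s" using t by (simp add: G_def)
    moreover have "t powr \<rho> / t * (1 - s / t) powr (\<rho> - 1) = (t - s) powr (\<rho> - 1)"
    proof -
      have "t powr \<rho> / t = t powr (\<rho> - 1)" using t by (simp add: powr_diff)
      hence "t powr \<rho> / t * (1 - s / t) powr (\<rho> - 1) = (t * (1 - s / t)) powr (\<rho> - 1)"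
        using t \<open>1 - s / t \<ge> 0\<close> by (simp add: powr_mult)
      thus ?thesis using t by (simp add: algebra_simps)
    qed
    moreover have "- (t powr \<rho> / \<rho>) * (r' s * G (r s)) = (t powr \<rho> / t * (1 - s / t) powr (\<rho> - 1)) * G (r s)"
      using rho unfolding r'_def by simp
    ultimately show "- (t powr \<rho> / \<rho>) * (r' s * G (r s)) = (t - s) powr (\<rho> - 1) * g s"
      by (simp only:)
  qed
qed

section \<open>Composition of kernels: Fubini on a triangle and Beta integrals\<close>

lemma frac_int_kernel_absolutely_integrable:
  fixes \<rho> t :: real and g :: "real \<Rightarrow> real"
  assumes rho: "0 < \<rho>" and t: "t \<ge> 0" and cont: "continuous_on {0..t} g"
  shows "(\<lambda>s. (t - s) powr (\<rho> - 1) * g s) absolutely_integrable_on {0..t}"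
proof -
  have "(\<lambda>s. (t - s) powr (\<rho> - 1) * 1) absolutely_integrable_on {0..t}"
    using frac_int_has_integral[OF rho t, of "\<lambda>_. 1"]
    by (intro nonnegative_absolutely_integrable_1) (auto simp: integrable_on_def)
  hence k: "(\<lambda>s. (t - s) powr (\<rho> - 1)) absolutely_integrable_on {0..t}" by simp
  have "(\<lambda>s. g s * (t - s) powr (\<rho> - 1)) absolutely_integrable_on {0..t}"
  proof (rule absolutely_integrable_bounded_measurable_product_real[OF _ _ _ k])
    show "g \<in> borel_measurable (lebesgue_on {0..t})"
      by (rule continuous_imp_measurable_on_sets_lebesgue[OF cont]) auto
    show "bounded (g ` {0..t})"
      by (intro compact_imp_bounded compact_continuous_image cont) auto
  qed auto
  thus ?thesis by (simp add: mult.commute)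
qed

text \<open>The kernel is integrated over the triangle \<open>0 \<le> s \<le> \<tau> \<le> t\<close>
  in both orders; with the weight k, the kernel started at s contributes \<open>C s\<close>. Two
  weights are used later, one for the composition of orders \<open>\<rho>\<close> and
  \<open>1 - \<rho>\<close> and one for the comparison principle. \<open>C\<close> is prescribed
  only for \<open>s < t\<close>, because at \<open>s = t\<close> the inner integral degenerates to 0
  while a continuous \<open>C\<close> need not vanish there.\<close>

lemma frac_int_fubini:
  fixes k C G :: "real \<Rightarrow> real"
  assumes rho: "0 < \<rho>" and t: "0 \<le> t" and contG: "continuous_on {0..t} G"
    and k [measurable]: "k \<in> borel_measurable borel" and k_nonneg: "\<And>\<tau>. \<tau> \<in> {0..t} \<Longrightarrow> 0 \<le> k \<tau>"
    and C: "\<And>s. s \<in> {0..<t} \<Longrightarrow> ((\<lambda>\<tau>. k \<tau> * (\<tau> - s) powr (\<rho> - 1)) has_integral C s) {s..t}"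
    and contC: "continuous_on {0..t} C"
  shows "((\<lambda>\<tau>. k \<tau> * frac_int \<rho> G \<tau>) has_integral integral {0..t} (\<lambda>s. C s * G s) / Gamma \<rho>) {0..t}"
proof -
  define g where "g = (\<lambda>s. indicator {0..t} s * G s)"
  define K where "K = (\<lambda>s \<tau>. if 0 \<le> s \<and> s \<le> \<tau> \<and> \<tau> \<le> t then k \<tau> * (\<tau> - s) powr (\<rho> - 1) else 0)"
  define F where "F = (\<lambda>(s, \<tau>). g s * K s \<tau>)"
  define C' where "C' = (\<lambda>s. indicator {0..<t} s * C s)"
  interpret sigma_finite_measure "lebesgue :: real measure"
    by (rule sigma_finite_lebesgue)
  interpret P: pair_sigma_finite "lebesgue :: real measure" "lebesgue :: real measure" ..
  have [measurable]: "g \<in> borel_measurable borel"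
    using borel_measurable_continuous_on_indicator[OF _ contG] by (simp add: g_def)
  have id_meas: "(\<lambda>x::real. x) \<in> borel_measurable lebesgue"
    by (rule measurable_completion) simp
  have [measurable]: "fst \<in> borel_measurable (lebesgue \<Otimes>\<^sub>M lebesgue :: (real \<times> real) measure)"
    by (rule measurable_compose[OF measurable_fst id_meas])
  have [measurable]: "snd \<in> borel_measurable (lebesgue \<Otimes>\<^sub>M lebesgue :: (real \<times> real) measure)"
    by (rule measurable_compose[OF measurable_snd id_meas])
  have F_meas: "F \<in> borel_measurable (lebesgue \<Otimes>\<^sub>M lebesgue)"
    unfolding F_def K_def case_prod_beta by measurable
  have K_nonneg: "0 \<le> K s \<tau>" for s \<tau>
    using k_nonneg[of \<tau>] by (auto simp: K_def)
  have K0: "K s = (\<lambda>_. 0)" if "s \<notin> {0..<t}" for s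
    using that by (auto simp: K_def fun_eq_iff)
  have K_int: "integrable lebesgue (K s)" "integral\<^sup>L lebesgue (K s) = C' s" for s
  proof -
    have "(K s has_integral C' s) UNIV"
    proof (cases "s \<in> {0..<t}")
      case True
      have "((\<lambda>\<tau>. if \<tau> \<in> {s..t} then k \<tau> * (\<tau> - s) powr (\<rho> - 1) else 0) has_integral C' s) UNIV"
        unfolding has_integral_restrict_UNIV using C[OF True] True by (simp add: C'_def)
      moreover have "(\<lambda>\<tau>. if \<tau> \<in> {s..t} then k \<tau> * (\<tau> - s) powr (\<rho> - 1) else 0) = K s"
        using True by (auto simp: K_def fun_eq_iff)
      ultimately show ?thesis by simp
    qed (auto simp: K0 C'_def)
    note * = this
    have "K s absolutely_integrable_on UNIV"
      using * K_nonneg by (intro nonnegative_absolutely_integrable_1) (auto simp: integrable_on_def)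
    thus i: "integrable lebesgue (K s)" by (simp add: set_integrable_def)
    show "integral\<^sup>L lebesgue (K s) = C' s"
      using has_integral_integral_lebesgue[OF i] * has_integral_unique by blast
  qed
  have CG: "(\<lambda>s. C s * G s) absolutely_integrable_on {0..t}"
    by (intro absolutely_integrable_continuous_real continuous_intros contC contG)
  hence CG': "(\<lambda>s. C s * G s) absolutely_integrable_on {0..<t}"
    by (rule absolutely_integrable_spike_set) (auto intro: negligible_subset[of "{t}"])
  have gC: "g s * C' s = indicator {0..<t} s *\<^sub>R (C s * G s)" for s
    by (auto simp: g_def C'_def indicator_def)
  have F_norm: "(\<integral>\<tau>. norm (F (s, \<tau>)) \<partial>lebesgue) = norm (g s * C' s)" for s
  proof -
    have "C' s \<ge> 0" unfolding K_int(2)[symmetric] by (intro Bochner_Integration.integral_nonneg K_nonneg)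
    thus ?thesis using K_int[of s] K_nonneg by (simp add: F_def abs_mult)
  qed
  have gC_int: "integrable lebesgue (\<lambda>s. g s * C' s)"
    using CG' unfolding gC set_integrable_def .
  have FI: "integrable (lebesgue \<Otimes>\<^sub>M lebesgue) (case_prod (\<lambda>s \<tau>. g s * K s \<tau>))"
    unfolding F_def[symmetric]
    by (rule P.Fubini_integrable[OF F_meas])
      (use F_norm gC_int K_int in \<open>auto simp: F_def\<close>)
  have J_val: "(\<integral>s. g s * K s \<tau> \<partial>lebesgue) = (if \<tau> \<in> {0..t} then k \<tau> * (Gamma \<rho> * frac_int \<rho> G \<tau>) else 0)" for \<tau>
  proof (cases "\<tau> \<in> {0..t}")
    case True
    have cont': "continuous_on {0..\<tau>} G"
      by (rule continuous_on_subset[OF contG]) (use True in auto)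
    have "(\<lambda>s. g s * K s \<tau>) = (\<lambda>s. k \<tau> * (indicator {0..\<tau>} s *\<^sub>R ((\<tau> - s) powr (\<rho> - 1) * G s)))"
      using True by (auto simp: g_def K_def indicator_def fun_eq_iff)
    thus ?thesis
      using set_lebesgue_integral_eq_integral(2)[OF frac_int_kernel_absolutely_integrable[OF rho _ cont']]
        frac_int_has_integral[OF rho _ cont'] True
      by (simp add: set_lebesgue_integral_def integral_unique)
  next
    case False
    hence "(\<lambda>s. g s * K s \<tau>) = (\<lambda>_. 0)"
      by (auto simp: g_def K_def indicator_def fun_eq_iff)
    thus ?thesis using False by auto
  qed
  have "integrable lebesgue (\<lambda>\<tau>. \<integral>s. g s * K s \<tau> \<partial>lebesgue)"
    by (rule P.integrable_snd[OF FI])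
  from has_integral_integral_lebesgue[OF this]
  have "((\<lambda>\<tau>. k \<tau> * (Gamma \<rho> * frac_int \<rho> G \<tau>)) has_integral
         (\<integral>\<tau>. (\<integral>s. g s * K s \<tau> \<partial>lebesgue) \<partial>lebesgue)) {0..t}"
    unfolding J_val has_integral_restrict_UNIV .
  also have "(\<integral>\<tau>. (\<integral>s. g s * K s \<tau> \<partial>lebesgue) \<partial>lebesgue) = (\<integral>s. (\<integral>\<tau>. g s * K s \<tau> \<partial>lebesgue) \<partial>lebesgue)"
    by (rule P.Fubini_integral[OF FI])
  also have "\<dots> = (\<integral>s. indicator {0..<t} s *\<^sub>R (C s * G s) \<partial>lebesgue)"
    by (simp only: integral_mult_right_zero K_int(2) gC)
  also have "\<dots> = integral {0..<t} (\<lambda>s. C s * G s)"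
    using set_lebesgue_integral_eq_integral(2)[OF CG'] by (simp add: set_lebesgue_integral_def)
  also have "\<dots> = integral {0..t} (\<lambda>s. C s * G s)"
    by (rule integral_spike_set) (auto intro: negligible_subset[of "{t}"])
  finally have "((\<lambda>\<tau>. k \<tau> * (Gamma \<rho> * frac_int \<rho> G \<tau>)) has_integral
      integral {0..t} (\<lambda>s. C s * G s)) {0..t}" .
  from has_integral_mult_right[OF this, of "1 / Gamma \<rho>"] show ?thesis
    using Gamma_real_pos[OF rho] by simp
qed

text \<open>Euler's Beta integral pulled back along a nondecreasing map y of \<open>{s..b}\<close>
  onto \<open>{0..1}\<close>. An affine y and a fractional linear y give the two kernels that
  follow.\<close>

lemma Beta_kernel_substitution:
  fixes \<rho> s b :: real and y y' :: "real \<Rightarrow> real"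
  assumes rho: "0 < \<rho>" "\<rho> < 1" and sb: "s \<le> b"
    and y: "y s = 0" "y b = 1"
    and deriv: "\<And>\<tau>. \<tau> \<in> {s..b} \<Longrightarrow> (y has_real_derivative y' \<tau>) (at \<tau>)"
    and y': "continuous_on {s..b} y'" "\<And>\<tau>. \<tau> \<in> {s..b} \<Longrightarrow> 0 \<le> y' \<tau>"
  shows "((\<lambda>\<tau>. y \<tau> powr (\<rho> - 1) * (1 - y \<tau>) powr (- \<rho>) * y' \<tau>) has_integral Gamma \<rho> * Gamma (1 - \<rho>)) {s..b}"
proof -
  define f where "f = (\<lambda>x. x powr (\<rho> - 1) * (1 - x) powr (- \<rho>) :: real)"
  have f: "(f has_integral Gamma \<rho> * Gamma (1 - \<rho>)) {0..1}"
    using has_integral_Beta_real[of \<rho> "1 - \<rho>"] rho by (simp add: f_def Beta_def)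
  have [measurable]: "f \<in> borel_measurable borel" unfolding f_def by measurable
  have fa: "f absolutely_integrable_on {0..1}"
    using f by (intro nonnegative_absolutely_integrable_1) (auto simp: integrable_on_def f_def)
  \<comment> \<open>\<open>f\<close> is Borel measurable, so integrability descends from the
    completed measure to \<open>lborel\<close>, where the substitution is carried out.\<close>
  have fi: "set_integrable lborel {0..1} f"
    using fa unfolding set_integrable_def
    by (subst (asm) integrable_completion) auto
  have fL: "(LBINT x:{0..1}. f x) = Gamma \<rho> * Gamma (1 - \<rho>)"
    using set_borel_integral_eq_integral(2)[OF fi] f by (simp add: integral_unique)
  have "set_integrable lborel {s..b} (\<lambda>x. f (y x) * y' x)"
    by (rule integral_substitution(1)) (use fi deriv y y' sb in \<open>auto\<close>)
  moreover have "(LBINT x. f x * indicator {y s..y b} x) = (LBINT x. f (y x) * y' x * indicator {s..b} x)"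
    by (rule integral_substitution(2)) (use fi deriv y y' sb in \<open>auto\<close>)
  ultimately show ?thesis
    using fL has_integral_set_lebesgue[of "{s..b}" "\<lambda>x. f (y x) * y' x"] 
      set_borel_integral_eq_integral[of "{s..b}" "\<lambda>x. f (y x) * y' x"] y
    by (auto simp: f_def set_lebesgue_integral_def mult_ac has_integral_integrable_integral)
qed

text \<open>Affine substitution. The value depends on neither s nor t, which is why fractional
  integrals of the orders \<open>\<rho>\<close> and \<open>1 - \<rho>\<close> compose to the
  ordinary integral.\<close>

lemma Beta_kernel_has_integral:
  fixes \<rho> :: real
  assumes rho: "0 < \<rho>" "\<rho> < 1" and st: "s < t"
  shows "((\<lambda>\<tau>. (t - \<tau>) powr (- \<rho>) * (\<tau> - s) powr (\<rho> - 1)) has_integral Gamma \<rho> * Gamma (1 - \<rho>)) {s..t}"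
proof (rule has_integral_eq)
  show "((\<lambda>\<tau>. ((\<tau> - s) / (t - s)) powr (\<rho> - 1) * (1 - (\<tau> - s) / (t - s)) powr (- \<rho>) * (1 / (t - s)))
      has_integral Gamma \<rho> * Gamma (1 - \<rho>)) {s..t}"
    by (rule Beta_kernel_substitution[OF rho]) (use st in \<open>auto intro!: derivative_eq_intros\<close>)
  fix \<tau> assume \<tau>: "\<tau> \<in> {s..t}"
  have 1: "1 - (\<tau> - s) / (t - s) = (t - \<tau>) / (t - s)" using st by (simp add: field_simps)
  have 2: "(t - s) powr (- \<rho>) * (t - s) powr (\<rho> - 1) * (t - s) = 1"
    using st by (simp add: powr_diff powr_minus field_simps)
  show "((\<tau> - s) / (t - s)) powr (\<rho> - 1) * (1 - (\<tau> - s) / (t - s)) powr (- \<rho>) * (1 / (t - s)) =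
      (t - \<tau>) powr (- \<rho>) * (\<tau> - s) powr (\<rho> - 1)"
    unfolding 1 using \<tau> st 2 by (simp add: powr_divide field_simps)
qed

text \<open>The fractional linear map that sends s, b, t to 0, 1 and infinity turns the Beta
  integral into this one. Divided by the constant on the right, it is the identity behind the
  comparison principle: the kernel at t is swept back onto the kernels at times before b, as in the
  balayage of potential theory.\<close>

lemma balayage_has_integral:
  fixes \<rho> :: real
  assumes rho: "0 < \<rho>" "\<rho> < 1" and st: "s < b" "b < t"
  shows "((\<lambda>\<tau>. (b - \<tau>) powr (- \<rho>) / (t - \<tau>) * (\<tau> - s) powr (\<rho> - 1)) has_integral
     Gamma \<rho> * Gamma (1 - \<rho>) * (t - b) powr (- \<rho>) * (t - s) powr (\<rho> - 1)) {s..b}"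
proof -
  define y where "y = (\<lambda>\<tau>. (\<tau> - s) * (t - b) / ((t - \<tau>) * (b - s)))"
  define y' where "y' = (\<lambda>\<tau>. (t - b) * (t - s) / ((b - s) * (t - \<tau>)\<^sup>2))"
  have "((\<lambda>\<tau>. y \<tau> powr (\<rho> - 1) * (1 - y \<tau>) powr (- \<rho>) * y' \<tau>) has_integral Gamma \<rho> * Gamma (1 - \<rho>)) {s..b}"
  proof (rule Beta_kernel_substitution[OF rho])
    show "y s = 0" "y b = 1" using st by (auto simp: y_def)
    show "continuous_on {s..b} y'" unfolding y'_def using st by (intro continuous_intros) auto
    fix \<tau> assume \<tau>: "\<tau> \<in> {s..b}"
    show "0 \<le> y' \<tau>" using st by (auto simp: y'_def)
    show "(y has_real_derivative y' \<tau>) (at \<tau>)"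
      unfolding y_def y'_def using st \<tau>
      by (auto intro!: derivative_eq_intros simp: divide_simps power2_eq_square) (simp add: algebra_simps)
  qed (use st in auto)
  from has_integral_mult_right[OF this, of "(t - b) powr (- \<rho>) * (t - s) powr (\<rho> - 1)"]
  have *: "((\<lambda>\<tau>. (t - b) powr (- \<rho>) * (t - s) powr (\<rho> - 1) * (y \<tau> powr (\<rho> - 1) * (1 - y \<tau>) powr (- \<rho>) * y' \<tau>))
    has_integral Gamma \<rho> * Gamma (1 - \<rho>) * (t - b) powr (- \<rho>) * (t - s) powr (\<rho> - 1)) {s..b}"
    by (simp add: mult_ac)
  show ?thesis
  proof (rule has_integral_eq[OF _ *])
    fix \<tau> assume \<tau>: "\<tau> \<in> {s..b}"
    define A B C D E where "A = t - b" and "B = t - s" and "C = b - s" and "D = t - \<tau>" and "E = \<tau> - s"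
    have pos: "A > 0" "B > 0" "C > 0" "D > 0" "E \<ge> 0" using st \<tau> by (auto simp: A_def B_def C_def D_def E_def)
    have y: "y \<tau> = E * A / (D * C)" "y' \<tau> = A * B / (C * D\<^sup>2)"
      by (simp_all add: y_def y'_def A_def B_def C_def D_def E_def)
    have y1: "1 - y \<tau> = (b - \<tau>) * B / (D * C)"
      unfolding y using pos by (simp add: field_simps) (simp add: A_def B_def C_def D_def E_def algebra_simps)
    have "b - \<tau> \<ge> 0" using \<tau> by auto
    have "y \<tau> powr (\<rho> - 1) = E powr (\<rho> - 1) * (A powr \<rho> / A) / ((D powr \<rho> / D) * (C powr \<rho> / C))"
      unfolding y using pos by (simp add: powr_divide powr_mult powr_diff)
    moreover have "(1 - y \<tau>) powr (- \<rho>) = (b - \<tau>) powr (- \<rho>) / B powr \<rho> * (D powr \<rho> * C powr \<rho>)"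
      unfolding y1 using pos \<open>b - \<tau> \<ge> 0\<close>
      by (simp add: powr_divide powr_mult powr_minus divide_simps)
    ultimately show "(t - b) powr (- \<rho>) * (t - s) powr (\<rho> - 1) * (y \<tau> powr (\<rho> - 1) * (1 - y \<tau>) powr (- \<rho>) * y' \<tau>) =
        (b - \<tau>) powr (- \<rho>) / (t - \<tau>) * (\<tau> - s) powr (\<rho> - 1)"
      using pos unfolding y(2) A_def[symmetric] B_def[symmetric] D_def[symmetric] E_def[symmetric]
      by (simp add: powr_diff[of B] powr_minus[of A] field_simps power2_eq_square)
  qed
qed

lemma frac_int_frac_int:
  fixes \<rho> :: real
  assumes rho: "0 < \<rho>" "\<rho> < 1" and t: "0 \<le> t" and cont: "continuous_on {0..t} g"
  shows "frac_int (1 - \<rho>) (frac_int \<rho> g) t = integral {0..t} g"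
proof -
  have "((\<lambda>\<tau>. (t - \<tau>) powr (- \<rho>) * frac_int \<rho> g \<tau>) has_integral
      integral {0..t} (\<lambda>s. Gamma \<rho> * Gamma (1 - \<rho>) * g s) / Gamma \<rho>) {0..t}"
    by (rule frac_int_fubini[OF rho(1) t cont]) (use rho in \<open>auto intro!: Beta_kernel_has_integral\<close>)
  moreover have "((\<lambda>\<tau>. (t - \<tau>) powr (1 - \<rho> - 1) * frac_int \<rho> g \<tau>) has_integral
      Gamma (1 - \<rho>) * frac_int (1 - \<rho>) (frac_int \<rho> g) t) {0..t}"
    using rho by (intro frac_int_has_integral t continuous_on_frac_int cont) auto
  ultimately have "Gamma (1 - \<rho>) * frac_int (1 - \<rho>) (frac_int \<rho> g) t =
      integral {0..t} (\<lambda>s. Gamma \<rho> * Gamma (1 - \<rho>) * g s) / Gamma \<rho>"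
    by (auto dest: has_integral_unique)
  thus ?thesis
    using Gamma_real_pos[of \<rho>, THEN less_imp_neq] Gamma_real_pos[of "1 - \<rho>", THEN less_imp_neq] rho by simp
qed

text \<open>The integral of complementary order reduces the hypothesis to vanishing ordinary
  integrals, which are then differentiated.\<close>

lemma frac_int_eq_0_imp:
  fixes \<rho> :: real
  assumes rho: "0 < \<rho>" "\<rho> < 1" and T: "0 < T" and cont: "continuous_on {0..T} g"
    and zero: "\<And>t. t \<in> {0..T} \<Longrightarrow> frac_int \<rho> g t = 0" and t: "t \<in> {0..T}"
  shows "g t = 0"
proof -
  have 0: "integral {0..s} g = 0" if "s \<in> {0..T}" for s
  proof -
    have "integral {0..s} g = frac_int (1 - \<rho>) (frac_int \<rho> g) s"
      using that by (subst frac_int_frac_int[OF rho]) (auto intro: continuous_on_subset[OF cont])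
    also have "\<dots> = frac_int (1 - \<rho>) (\<lambda>_. 0) s"
      by (rule frac_int_cong) (use that rho zero in auto)
    finally show ?thesis by simp
  qed
  have "((\<lambda>s. integral {0..s} g) has_real_derivative g t) (at t within {0..T})"
    by (rule integral_has_real_derivative[OF cont t])
  hence "((\<lambda>s. 0) has_real_derivative g t) (at t within {0..T})"
    by (rule has_field_derivative_transform_within[OF _ zero_less_one t]) (use 0 in auto)
  thus ?thesis
    using vector_derivative_within_cbox[of 0 T t] t T
    by (metis DERIV_const has_real_derivative_iff_has_vector_derivative vector_derivative_unique_within
        at_within_Icc_at trivial_limit_within islimpt_Icc)
qed

text \<open>With \<open>x = L * (t - s)\<close> the left side becomes a truncated Gamma integral,
  bounded by the full one. Hence \<open>frac_int\<close> has norm at most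
  \<open>1 / L powr \<rho>\<close> for the weight \<open>exp (L * t)\<close>; every later choice of
  L serves to make this factor small.\<close>

lemma frac_int_exp_le:
  fixes \<rho> :: real
  assumes rho: "0 < \<rho>" and L: "0 < L" and t: "0 \<le> t"
  shows "frac_int \<rho> (\<lambda>s. exp (L * s)) t \<le> exp (L * t) / L powr \<rho>"
proof -
  define f where "f = (\<lambda>x. x powr (\<rho> - 1) / exp x :: real)"
  have G: "(f has_integral Gamma \<rho>) {0..}"
    unfolding f_def by (rule Gamma_integral_real[OF rho])
  have fi: "f integrable_on {0..L * t}"
  proof -
    have "f absolutely_integrable_on {0..}"
      using G by (intro nonnegative_absolutely_integrable_1) (auto simp: integrable_on_def f_def)
    hence "f absolutely_integrable_on {0..L * t}"
      by (rule set_integrable_subset) auto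
    thus ?thesis by (rule set_lebesgue_integral_eq_integral(1))
  qed
  have le: "integral {0..L * t} f \<le> Gamma \<rho>"
    using integral_subset_le[of "{0..L * t}" "{0..}" f] fi G
    by (auto simp: f_def integrable_on_def integral_unique)
  have "(\<lambda>s. t - s / L) ` {0..L * t} = {0..t}"
  proof safe
    fix x assume "x \<in> {0..t}"
    thus "x \<in> (\<lambda>s. t - s / L) ` {0..L * t}" using L t
      by (intro image_eqI[of _ _ "L * (t - x)"]) (auto simp: field_simps)
  qed (use L t in \<open>auto simp: field_simps\<close>)
  with has_integral_affinity[of f "integral {0..L * t} f" 0 "L * t" "- L" "L * t"] fi L
  have "((\<lambda>s. f (L * t - L * s)) has_integral integral {0..L * t} f / L) {0..t}"
    by (simp add: cbox_interval has_integral_integral add.commute divide_simps)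
  from has_integral_mult_right[OF this, of "exp (L * t) * L powr (1 - \<rho>)"]
  have "((\<lambda>s. exp (L * t) * L powr (1 - \<rho>) * f (L * t - L * s)) has_integral
      exp (L * t) * L powr (1 - \<rho>) * (integral {0..L * t} f / L)) {0..t}" .
  moreover have "exp (L * t) * L powr (1 - \<rho>) * f (L * t - L * s) = (t - s) powr (\<rho> - 1) * exp (L * s)"
    if "s \<in> {0..t}" for s
  proof -
    have "(L * t - L * s) powr (\<rho> - 1) = L powr (\<rho> - 1) * (t - s) powr (\<rho> - 1)"
      using that L by (simp add: powr_mult right_diff_distrib[symmetric])
    moreover have "L powr (1 - \<rho>) * L powr (\<rho> - 1) = 1"
      using L by (simp add: powr_add[symmetric])
    ultimately have "L powr (1 - \<rho>) * (L * t - L * s) powr (\<rho> - 1) = (t - s) powr (\<rho> - 1)"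
      by (simp add: mult.assoc[symmetric])
    moreover have "exp (L * t) / exp (L * t - L * s) = exp (L * s)"
      by (simp add: exp_diff)
    moreover have "exp (L * t) * L powr (1 - \<rho>) * f (L * t - L * s) =
        (L powr (1 - \<rho>) * (L * t - L * s) powr (\<rho> - 1)) * (exp (L * t) / exp (L * t - L * s))"
      by (simp add: f_def)
    ultimately show ?thesis by (simp only:)
  qed
  ultimately have "((\<lambda>s. (t - s) powr (\<rho> - 1) * exp (L * s)) has_integral
      exp (L * t) * L powr (1 - \<rho>) * (integral {0..L * t} f / L)) {0..t}"
    by (rule has_integral_eq[rotated]) auto
  moreover have "((\<lambda>s. (t - s) powr (\<rho> - 1) * exp (L * s)) has_integral
      Gamma \<rho> * frac_int \<rho> (\<lambda>s. exp (L * s)) t) {0..t}"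
    by (intro frac_int_has_integral rho t continuous_intros)
  ultimately have "Gamma \<rho> * frac_int \<rho> (\<lambda>s. exp (L * s)) t =
      exp (L * t) / L powr \<rho> * integral {0..L * t} f"
    using L by (auto dest: has_integral_unique simp: powr_diff)
  also have "\<dots> \<le> exp (L * t) / L powr \<rho> * Gamma \<rho>"
    using le by (intro mult_left_mono) auto
  finally have "Gamma \<rho> * frac_int \<rho> (\<lambda>s. exp (L * s)) t \<le> Gamma \<rho> * (exp (L * t) / L powr \<rho>)"
    by (simp add: mult.commute)
  thus ?thesis using Gamma_real_pos[OF rho] by (rule mult_left_le_imp_le)
qed

lemma frac_int_weighted_le:
  fixes \<rho> :: real
  assumes rho: "0 < \<rho>" and L: "0 < L" and t: "t \<in> {0..T}" and cont: "continuous_on {0..T} g"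
    and le: "\<And>s. s \<in> {0..t} \<Longrightarrow> g s \<le> m * exp (L * s)" and m: "0 \<le> m"
  shows "frac_int \<rho> g t \<le> m / L powr \<rho> * exp (L * t)"
proof -
  have "frac_int \<rho> g t \<le> frac_int \<rho> (\<lambda>s. m * exp (L * s)) t"
    by (rule frac_int_mono[OF rho cont _ t]) (use le in \<open>auto intro!: continuous_intros\<close>)
  also have "\<dots> \<le> m * (exp (L * t) / L powr \<rho>)"
    unfolding frac_int_cmult using t m by (intro mult_left_mono frac_int_exp_le rho L) auto
  finally show ?thesis by simp
qed

lemma frac_int_weighted_abs_le:
  fixes \<rho> :: real
  assumes rho: "0 < \<rho>" and L: "0 < L" and t: "t \<in> {0..T}" and cont: "continuous_on {0..T} g"
    and le: "\<And>s. s \<in> {0..t} \<Longrightarrow> \<bar>g s\<bar> \<le> m * exp (L * s)" and m: "0 \<le> m"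
  shows "\<bar>frac_int \<rho> g t\<bar> \<le> m / L powr \<rho> * exp (L * t)"
proof -
  have "\<bar>frac_int \<rho> g t\<bar> \<le> frac_int \<rho> (\<lambda>s. \<bar>g s\<bar>) t"
    by (rule frac_int_abs_le[OF rho cont _ t]) (use cont in \<open>auto intro!: continuous_intros\<close>)
  also have "\<dots> \<le> m / L powr \<rho> * exp (L * t)"
    by (rule frac_int_weighted_le[OF rho L t]) (use cont le m in \<open>auto intro!: continuous_intros\<close>)
  finally show ?thesis .
qed

section \<open>The comparison principle for fractional equations\<close>

text \<open>The contribution of the times before b to the value at t is a weighted mean of
  the values of \<open>\<phi> + frac_int \<rho> G\<close> on \<open>{0..b}\<close> and of \<open>\<phi>\<close>.\<close>

lemma frac_int_lower_bound:
  fixes \<rho> :: real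
  assumes rho: "0 < \<rho>" "\<rho> < 1" and b: "0 \<le> b" "b < t" and cont: "continuous_on {0..t} G"
    and phi: "0 \<le> \<phi>" and past: "\<And>\<tau>. \<tau> \<in> {0..b} \<Longrightarrow> 0 \<le> \<phi> + frac_int \<rho> G \<tau>"
    and G: "\<And>s. s \<in> {b..t} \<Longrightarrow> \<eta> \<le> G s"
  shows "\<eta> * (t - b) powr \<rho> / Gamma (\<rho> + 1) \<le> \<phi> + frac_int \<rho> G t"
proof -
  define K where "K = (\<lambda>s. (t - s) powr (\<rho> - 1))"
  have G0: "Gamma \<rho> > 0" "Gamma (1 - \<rho>) > 0"
    using rho by (auto intro: Gamma_real_pos)
  have hi: "((\<lambda>s. K s * G s) has_integral Gamma \<rho> * frac_int \<rho> G t) {0..t}"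
    unfolding K_def by (rule frac_int_has_integral) (use rho b cont in auto)
  hence KG: "(\<lambda>s. K s * G s) integrable_on {0..t}" by (auto simp: integrable_on_def)
  have split: "Gamma \<rho> * frac_int \<rho> G t = integral {0..b} (\<lambda>s. K s * G s) + integral {b..t} (\<lambda>s. K s * G s)"
    using Henstock_Kurzweil_Integration.integral_combine[OF b(1) _ KG] b hi by (simp add: integral_unique)
  have K: "((\<lambda>s. \<eta> * K s) has_integral \<eta> * ((t - b) powr \<rho> / \<rho>)) {b..t}"
  proof -
    have "(\<lambda>s. 1 / (t - s) powr (1 - \<rho>)) = K"
      using powr_minus_divide[of _ "1 - \<rho>"] by (auto simp: K_def fun_eq_iff)
    thus ?thesis
      using kernel_has_integral'[of "1 - \<rho>" b t] rho b by (intro has_integral_mult_right) auto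
  qed
  have late: "\<eta> * ((t - b) powr \<rho> / \<rho>) \<le> integral {b..t} (\<lambda>s. K s * G s)"
  proof (rule has_integral_le[OF K integrable_integral])
    show "(\<lambda>s. K s * G s) integrable_on {b..t}"
      by (rule integrable_subinterval_real[OF KG]) (use b in auto)
    show "\<eta> * K s \<le> K s * G s" if "s \<in> {b..t}" for s
      using mult_right_mono[OF G[OF that], of "K s"] by (simp add: K_def mult.commute)
  qed
  have early: "- \<phi> * Gamma \<rho> \<le> integral {0..b} (\<lambda>s. K s * G s)"
  proof (cases "b = 0")
    case True
    then show ?thesis using phi G0 by simp
  next
    case False
    with b have b0: "0 < b" by simp
    \<comment> \<open>\<open>k\<close> is the weight of \<open>balayage_has_integral\<close> and
      \<open>c\<close> the constant in it, so that \<open>c * K s\<close> is the integral of k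
      against the kernel started at s. By Fubini the early part of the value at t becomes an
      integral of past values of \<open>frac_int \<rho> G\<close>.\<close>
    define k where "k = (\<lambda>\<tau>. (b - \<tau>) powr (- \<rho>) / (t - \<tau>))"
    define c where "c = Gamma \<rho> * Gamma (1 - \<rho>) * (t - b) powr (- \<rho>)"
    have c: "c > 0" using G0 b by (simp add: c_def)
    have *: "((\<lambda>\<tau>. k \<tau> * frac_int \<rho> G \<tau>) has_integral
        integral {0..b} (\<lambda>s. c * K s * G s) / Gamma \<rho>) {0..b}"
    proof (rule frac_int_fubini[OF rho(1) b(1)])
      show "continuous_on {0..b} G" by (rule continuous_on_subset[OF cont]) (use b in auto)
      show "k \<in> borel_measurable borel" unfolding k_def by measurable
      show "0 \<le> k \<tau>" if "\<tau> \<in> {0..b}" for \<tau> using that b by (auto simp: k_def)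
      show "((\<lambda>\<tau>. k \<tau> * (\<tau> - s) powr (\<rho> - 1)) has_integral c * K s) {s..b}" if "s \<in> {0..<b}" for s
        using balayage_has_integral[OF rho, of s b t] that b by (simp add: k_def c_def K_def)
      show "continuous_on {0..b} (\<lambda>s. c * K s)"
        unfolding K_def using b by (intro continuous_intros) auto
    qed
    have **: "((\<lambda>\<tau>. if \<tau> = 0 then 0 else k \<tau> * frac_int \<rho> G \<tau>) has_integral
        integral {0..b} (\<lambda>s. c * K s * G s) / Gamma \<rho>) {0..b}"
      by (rule has_integral_spike[OF negligible_sing[of 0] _ *]) auto
    \<comment> \<open>The identity for \<open>s = 0\<close> measures k against
      \<open>\<tau> powr (\<rho> - 1)\<close>. As
      \<open>t powr (1 - \<rho>) * \<tau> powr (\<rho> - 1) \<ge> 1\<close> for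
      \<open>0 < \<tau> \<le> t\<close>, the total mass of k is at most c; with
      \<open>\<phi>\<close> nonnegative, the constant \<open>- \<phi>\<close> therefore costs at
      most \<open>\<phi> * c\<close>.\<close>
    have "((\<lambda>\<tau>. k \<tau> * (\<tau> - 0) powr (\<rho> - 1)) has_integral c * K 0) {0..b}"
      using balayage_has_integral[OF rho b0 b(2)] by (simp add: k_def c_def K_def)
    from has_integral_mult_right[OF this, of "- \<phi> * t powr (1 - \<rho>)"]
    have "((\<lambda>\<tau>. - \<phi> * t powr (1 - \<rho>) * (k \<tau> * \<tau> powr (\<rho> - 1))) has_integral
        - \<phi> * t powr (1 - \<rho>) * (c * K 0)) {0..b}" by simp
    moreover have "t powr (1 - \<rho>) * K 0 = 1"
      using b b0 by (simp add: K_def powr_add[symmetric])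
    hence "- \<phi> * t powr (1 - \<rho>) * (c * K 0) = - \<phi> * c"
      by (simp add: mult_ac)
    ultimately have "((\<lambda>\<tau>. - \<phi> * t powr (1 - \<rho>) * (k \<tau> * \<tau> powr (\<rho> - 1))) has_integral
        - \<phi> * c) {0..b}" by (simp only:)
    hence "- \<phi> * c \<le> integral {0..b} (\<lambda>s. c * K s * G s) / Gamma \<rho>"
    proof (rule has_integral_le[OF _ **])
      fix \<tau> assume \<tau>: "\<tau> \<in> {0..b}"
      show "- \<phi> * t powr (1 - \<rho>) * (k \<tau> * \<tau> powr (\<rho> - 1)) \<le> (if \<tau> = 0 then 0 else k \<tau> * frac_int \<rho> G \<tau>)"
      proof (cases "\<tau> = 0")
        case False
        hence \<tau>0: "0 < \<tau>" using \<tau> by auto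
        have k: "k \<tau> \<ge> 0" using \<tau> b by (auto simp: k_def)
        have "t powr (\<rho> - 1) \<le> \<tau> powr (\<rho> - 1)"
          using \<tau>0 \<tau> b rho by (intro powr_mono2') auto
        hence "t powr (1 - \<rho>) * t powr (\<rho> - 1) \<le> t powr (1 - \<rho>) * \<tau> powr (\<rho> - 1)"
          by (intro mult_left_mono) auto
        hence "1 \<le> t powr (1 - \<rho>) * \<tau> powr (\<rho> - 1)"
          using b b0 by (simp add: powr_add[symmetric])
        hence "\<phi> * k \<tau> * 1 \<le> \<phi> * k \<tau> * (t powr (1 - \<rho>) * \<tau> powr (\<rho> - 1))"
          using phi k by (intro mult_left_mono) auto
        moreover have "k \<tau> * (- \<phi>) \<le> k \<tau> * frac_int \<rho> G \<tau>"
          using past[OF \<tau>] k by (intro mult_left_mono) auto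
        ultimately show ?thesis using False by (simp add: mult_ac)
      qed auto
    qed
    also have "\<dots> = c * (integral {0..b} (\<lambda>s. K s * G s) / Gamma \<rho>)"
      by (simp add: mult.assoc)
    finally have "c * (- \<phi>) \<le> c * (integral {0..b} (\<lambda>s. K s * G s) / Gamma \<rho>)" by (simp add: mult.commute)
    hence "- \<phi> \<le> integral {0..b} (\<lambda>s. K s * G s) / Gamma \<rho>"
      using c by (rule mult_left_le_imp_le)
    thus ?thesis using G0 by (simp add: pos_le_divide_eq)
  qed
  have "\<eta> * (t - b) powr \<rho> / Gamma (\<rho> + 1) = (\<eta> * ((t - b) powr \<rho> / \<rho>)) / Gamma \<rho>"
    using rho by (simp add: Gamma_add_one)
  also have "\<dots> \<le> (\<phi> * Gamma \<rho> + Gamma \<rho> * frac_int \<rho> G t) / Gamma \<rho>"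
    using split late early G0 by (intro divide_right_mono) auto
  also have "\<dots> = \<phi> + frac_int \<rho> G t" using G0 by (simp add: add_divide_distrib)
  finally show ?thesis .
qed

text \<open>At a first zero \<open>t1\<close> the past is positive and G stays above
  \<open>G t1 / 2\<close> on a short interval before \<open>t1\<close>, so
  \<open>frac_int_lower_bound\<close> makes the value at \<open>t1\<close> strictly positive. No
  derivative at \<open>t1\<close> is taken. The sign of G has to be known only at zeros of the
  function.\<close>

lemma frac_int_first_zero:
  fixes \<rho> :: real
  assumes rho: "0 < \<rho>" "\<rho> < 1" and cont: "continuous_on {0..T} G" and phi: "0 < \<phi>"
    and G: "\<And>t. t \<in> {0..T} \<Longrightarrow> \<phi> + frac_int \<rho> G t = 0 \<Longrightarrow> 0 < G t"
    and t: "t \<in> {0..T}"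
  shows "0 < \<phi> + frac_int \<rho> G t"
proof (rule ccontr)
  define u where "u = (\<lambda>t. \<phi> + frac_int \<rho> G t)"
  have u: "continuous_on {0..T} u"
    unfolding u_def by (intro continuous_intros continuous_on_frac_int rho cont)
  assume neg: "\<not> 0 < \<phi> + frac_int \<rho> G t"
  define S where "S = {0..T} \<inter> u -` {..0}"
  have "closed S" unfolding S_def by (intro continuous_closed_preimage[OF u]) auto
  moreover have "bounded S" unfolding S_def by (rule bounded_subset[of "{0..T}"]) auto
  ultimately have S: "compact S" by (simp add: compact_eq_bounded_closed)
  have "t \<in> S" using t neg by (auto simp: S_def u_def)
  obtain t1 where t1: "t1 \<in> S" "\<And>s. s \<in> S \<Longrightarrow> t1 \<le> s"
    using compact_attains_inf[OF S] \<open>t \<in> S\<close> by blast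
  have t1T: "t1 \<in> {0..T}" "u t1 \<le> 0" using t1(1) by (auto simp: S_def)
  have before: "0 < u s" if "0 \<le> s" "s < t1" for s
    using t1(2)[of s] that t1T by (force simp: S_def)
  have t1_pos: "0 < t1"
    using t1T phi by (cases "t1 = 0") (auto simp: u_def)
  have "u t1 = 0"
  proof (rule antisym[OF t1T(2)])
    have "(u \<longlongrightarrow> u t1) (at t1 within {0..T})"
      using u t1T unfolding continuous_on_def by auto
    hence "(u \<longlongrightarrow> u t1) (at t1 within {0..<t1})"
      by (rule tendsto_within_subset) (use t1T in auto)
    moreover have "\<forall>\<^sub>F s in at t1 within {0..<t1}. 0 \<le> u s"
      using before by (auto simp: eventually_at_filter less_imp_le intro!: always_eventually)
    moreover have "at t1 within {0..<t1} \<noteq> bot"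
      using t1_pos by (simp add: trivial_limit_within islimpt_Ico)
    ultimately show "0 \<le> u t1" by (rule tendsto_lowerbound)
  qed
  hence Gt1: "0 < G t1" using G[OF t1T(1)] by (simp add: u_def)
  obtain \<delta> where \<delta>: "\<delta> > 0" "\<And>s. s \<in> {0..T} \<Longrightarrow> \<bar>s - t1\<bar> < \<delta> \<Longrightarrow> \<bar>G s - G t1\<bar> < G t1 / 2"
    using cont t1T Gt1 unfolding continuous_on_iff dist_real_def by (metis half_gt_zero)
  define b where "b = max 0 (t1 - \<delta> / 2)"
  have b: "0 \<le> b" "b < t1" "\<And>s. s \<in> {b..t1} \<Longrightarrow> \<bar>s - t1\<bar> < \<delta>"
    using t1_pos \<delta> by (auto simp: b_def)
  have "G t1 / 2 * (t1 - b) powr \<rho> / Gamma (\<rho> + 1) \<le> \<phi> + frac_int \<rho> G t1"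
  proof (rule frac_int_lower_bound[OF rho b(1,2)])
    show "continuous_on {0..t1} G" by (rule continuous_on_subset[OF cont]) (use t1T in auto)
    show "0 \<le> \<phi> + frac_int \<rho> G \<tau>" if "\<tau> \<in> {0..b}" for \<tau>
      using before[of \<tau>] that b by (auto simp: u_def)
    show "G t1 / 2 \<le> G s" if s: "s \<in> {b..t1}" for s
    proof -
      have "s \<in> {0..T}" using s b(1) t1T by auto
      from \<delta>(2)[OF this b(3)[OF s]] show ?thesis by (simp only: abs_less_iff) linarith
    qed
  qed (use phi in auto)
  moreover have "G t1 / 2 * (t1 - b) powr \<rho> / Gamma (\<rho> + 1) > 0"
    using Gt1 b rho by (intro divide_pos_pos mult_pos_pos Gamma_real_pos) auto
  ultimately show False using \<open>u t1 = 0\<close> by (simp add: u_def)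
qed

text \<open>Banach's theorem is applied in the space of bounded continuous functions on the whole
  line: \<open>p\<close> retracts the line onto \<open>{0..T}\<close>, and \<open>E\<close> and the
  factor \<open>exp (- L * p t)\<close> move the exponential weight into the operator, so that the
  sup norm there is the weighted norm here.\<close>

lemma weighted_banach_fixpoint:
  fixes F :: "(real \<Rightarrow> real) \<Rightarrow> real \<Rightarrow> real"
  assumes T: "0 \<le> T"
    and cont: "\<And>u. continuous_on {0..T} u \<Longrightarrow> continuous_on {0..T} (F u)"
    and c: "0 \<le> c" "c < 1"
    and contr: "\<And>u v m t. continuous_on {0..T} u \<Longrightarrow> continuous_on {0..T} v \<Longrightarrow> 0 \<le> m \<Longrightarrow>
      (\<And>s. s \<in> {0..T} \<Longrightarrow> \<bar>u s - v s\<bar> \<le> m * exp (L * s)) \<Longrightarrow> t \<in> {0..T} \<Longrightarrow>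
      \<bar>F u t - F v t\<bar> \<le> c * m * exp (L * t)"
  obtains u where "continuous_on {0..T} u" "\<And>t. t \<in> {0..T} \<Longrightarrow> u t = F u t"
proof -
  define p where "p = (\<lambda>t. max 0 (min T t))"
  have p: "p t \<in> {0..T}" for t using T by (auto simp: p_def)
  have p_id: "t \<in> {0..T} \<Longrightarrow> p t = t" for t by (auto simp: p_def)
  have p_cont: "continuous_on A p" for A unfolding p_def by (intro continuous_intros)
  define E where "E = (\<lambda>h :: real \<Rightarrow>\<^sub>C real. \<lambda>s. exp (L * s) * apply_bcontfun h s)"
  define g where "g = (\<lambda>h t. exp (- L * p t) * F (E h) (p t))"
  have E_cont: "continuous_on {0..T} (E h)" for h
    unfolding E_def by (intro continuous_intros) auto
  have g_bc: "g h \<in> bcontfun" for h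
  proof -
    have 1: "continuous_on {0..T} (\<lambda>t. exp (- L * t) * F (E h) t)"
      by (intro continuous_intros cont E_cont)
    have "continuous_on UNIV (g h)"
      unfolding g_def using continuous_on_compose2[OF 1 p_cont, of UNIV] p by (simp add: image_subset_iff)
    moreover have "g h ` UNIV \<subseteq> (\<lambda>t. exp (- L * t) * F (E h) t) ` {0..T}"
      unfolding g_def using p by auto
    hence "bounded (range (g h))"
      using 1 by (meson bounded_subset compact_Icc compact_continuous_image compact_imp_bounded)
    ultimately show ?thesis by (simp add: bcontfun_def)
  qed
  define \<Phi> where "\<Phi> = (\<lambda>h. Bcontfun (g h))"
  have \<Phi>: "apply_bcontfun (\<Phi> h) = g h" for h
    unfolding \<Phi>_def using g_bc by (simp add: Bcontfun_inverse)
  have "dist (\<Phi> h1) (\<Phi> h2) \<le> c * dist h1 h2" for h1 h2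
  proof (rule dist_bound)
    fix t
    have "\<bar>E h1 s - E h2 s\<bar> \<le> dist h1 h2 * exp (L * s)" for s
    proof -
      have "\<bar>E h1 s - E h2 s\<bar> = exp (L * s) * \<bar>apply_bcontfun h1 s - apply_bcontfun h2 s\<bar>"
        unfolding E_def right_diff_distrib[symmetric] abs_mult by simp
      thus ?thesis using dist_bounded[of h1 s h2] by (simp add: dist_real_def mult.commute)
    qed
    from contr[OF E_cont E_cont zero_le_dist this p]
    have "\<bar>F (E h1) (p t) - F (E h2) (p t)\<bar> \<le> c * dist h1 h2 * exp (L * p t)" .
    hence "exp (- L * p t) * \<bar>F (E h1) (p t) - F (E h2) (p t)\<bar> \<le>
        exp (- L * p t) * (c * dist h1 h2 * exp (L * p t))"
      by (intro mult_left_mono) auto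
    thus "dist (apply_bcontfun (\<Phi> h1) t) (apply_bcontfun (\<Phi> h2) t) \<le> c * dist h1 h2"
      by (simp add: \<Phi> g_def dist_real_def right_diff_distrib[symmetric] abs_mult exp_minus field_simps)
  qed
  then obtain h where h: "\<Phi> h = h"
    using banach_fix_type[of c \<Phi>] c by blast
  show ?thesis
  proof
    show "continuous_on {0..T} (E h)" by (rule E_cont)
    fix t assume t: "t \<in> {0..T}"
    have "apply_bcontfun h t = exp (- L * t) * F (E h) t"
      using \<Phi>[of h] t unfolding h by (simp add: g_def p_id)
    thus "E h t = F (E h) t" unfolding E_def by (simp add: exp_minus)
  qed
qed

text \<open>The weighted difference of two fixed points attains its maximum, and the contraction
  estimate at that point forces the maximum to be 0.\<close>

lemma weighted_fixpoint_unique: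
  fixes F :: "(real \<Rightarrow> real) \<Rightarrow> real \<Rightarrow> real"
  assumes c: "c < 1"
    and contr: "\<And>u v m t. continuous_on {0..T} u \<Longrightarrow> continuous_on {0..T} v \<Longrightarrow> 0 \<le> m \<Longrightarrow>
      (\<And>s. s \<in> {0..T} \<Longrightarrow> \<bar>u s - v s\<bar> \<le> m * exp (L * s)) \<Longrightarrow> t \<in> {0..T} \<Longrightarrow>
      \<bar>F u t - F v t\<bar> \<le> c * m * exp (L * t)"
    and u: "continuous_on {0..T} u" "\<And>t. t \<in> {0..T} \<Longrightarrow> u t = F u t"
    and v: "continuous_on {0..T} v" "\<And>t. t \<in> {0..T} \<Longrightarrow> v t = F v t"
    and t: "t \<in> {0..T}"
  shows "u t = v t"
proof -
  define d where "d = (\<lambda>s. \<bar>u s - v s\<bar> * exp (- L * s))"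
  have "continuous_on {0..T} d" unfolding d_def by (intro continuous_intros u v)
  then obtain x where x: "x \<in> {0..T}" "\<And>s. s \<in> {0..T} \<Longrightarrow> d s \<le> d x"
    using continuous_attains_sup[of "{0..T}" d] t by auto
  have d: "\<bar>u s - v s\<bar> = d s * exp (L * s)" for s by (simp add: d_def exp_minus)
  have "\<bar>F u x - F v x\<bar> \<le> c * d x * exp (L * x)"
    by (rule contr[OF u(1) v(1) _ _ x(1)]) (use x in \<open>auto simp: d\<close>, auto simp: d_def)
  hence "d x * exp (L * x) \<le> c * d x * exp (L * x)"
    unfolding u(2)[OF x(1), symmetric] v(2)[OF x(1), symmetric] d .
  hence "d x \<le> c * d x" by (rule mult_right_le_imp_le) simp
  hence "(1 - c) * d x \<le> 0" by (simp add: algebra_simps)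
  hence "d x \<le> 0" using c by (simp add: mult_le_0_iff)
  hence "d t \<le> 0" using x(2)[OF t] by simp
  thus ?thesis by (simp add: d_def mult_le_0_iff)
qed

lemma continuous_on_bounded_real:
  fixes a :: "real \<Rightarrow> real"
  assumes "continuous_on {0..T} a"
  obtains A where "A > 0" "\<And>t. t \<in> {0..T} \<Longrightarrow> \<bar>a t\<bar> \<le> A"
proof -
  have "bounded (a ` {0..T})"
    by (intro compact_imp_bounded compact_continuous_image assms) auto
  thus ?thesis using that unfolding bounded_pos by (auto simp: image_iff)
qed

lemma fractional_linear_equation_exists:
  fixes \<rho> :: real
  assumes rho: "0 < \<rho>" and T: "0 \<le> T"
    and a: "continuous_on {0..T} a" and g: "continuous_on {0..T} g"
  obtains u where "continuous_on {0..T} u"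
    "\<And>t. t \<in> {0..T} \<Longrightarrow> u t = \<phi> + frac_int \<rho> (\<lambda>s. g s - a s * u s) t"
proof -
  obtain A where A: "A > 0" "\<And>t. t \<in> {0..T} \<Longrightarrow> \<bar>a t\<bar> \<le> A"
    using continuous_on_bounded_real[OF a] by blast
  \<comment> \<open>With this L the bound \<open>A / L powr \<rho>\<close> on the contraction factor
    is exactly 1/2.\<close>
  define L where "L = (2 * A) powr (1 / \<rho>)"
  have L: "L > 0" "L powr \<rho> = 2 * A" using A rho by (auto simp: L_def powr_powr)
  define F where "F = (\<lambda>u t. \<phi> + frac_int \<rho> (\<lambda>s. g s - a s * u s) t)"
  show ?thesis
  proof (rule weighted_banach_fixpoint[OF T, of F "1 / 2" L])
    show "continuous_on {0..T} (F u)" if "continuous_on {0..T} u" for u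
      unfolding F_def by (intro continuous_intros continuous_on_frac_int rho a g that)
    fix u v m t
    assume u: "continuous_on {0..T} u" and v: "continuous_on {0..T} v" and m: "(0::real) \<le> m"
      and le: "\<And>s. s \<in> {0..T} \<Longrightarrow> \<bar>u s - v s\<bar> \<le> m * exp (L * s)" and t: "t \<in> {0..T}"
    have "F u t - F v t = frac_int \<rho> (\<lambda>s. (g s - a s * u s) - (g s - a s * v s)) t"
      unfolding F_def by (subst frac_int_diff[OF rho _ _ t]) (auto intro!: continuous_intros a g u v)
    also have "\<bar>\<dots>\<bar> \<le> (A * m) / L powr \<rho> * exp (L * t)"
    proof (rule frac_int_weighted_abs_le[OF rho L(1) t])
      show "continuous_on {0..T} (\<lambda>s. g s - a s * u s - (g s - a s * v s))"
        by (intro continuous_intros a g u v)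
      fix s assume "s \<in> {0..t}"
      hence s: "s \<in> {0..T}" using t by auto
      have "\<bar>g s - a s * u s - (g s - a s * v s)\<bar> = \<bar>a s\<bar> * \<bar>u s - v s\<bar>"
        by (simp add: abs_mult[symmetric] algebra_simps abs_minus_commute)
      also have "\<dots> \<le> A * (m * exp (L * s))"
        by (intro mult_mono A(2) le s) (use A in auto)
      finally show "\<bar>g s - a s * u s - (g s - a s * v s)\<bar> \<le> A * m * exp (L * s)" by simp
    qed (use A m in auto)
    also have "\<dots> = 1 / 2 * m * exp (L * t)" using L A by simp
    finally show "\<bar>F u t - F v t\<bar> \<le> 1 / 2 * m * exp (L * t)" .
  qed (use that in \<open>auto simp: F_def\<close>)
qed

text \<open>u is perturbed by e times the positive solution v of
  \<open>v = 1 + frac_int \<rho> (1 + A * v)\<close>, where A dominates the absolute value of a. At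
  a zero of \<open>u + e * v\<close> the source is \<open>g + e + e * v * (a + A)\<close>, which is
  positive, so \<open>frac_int_first_zero\<close> applies; then e tends to 0. No sign of the
  coefficient a is assumed.\<close>

lemma fractional_comparison:
  fixes \<rho> :: real
  assumes rho: "0 < \<rho>" "\<rho> < 1" and a: "continuous_on {0..T} a" and g: "continuous_on {0..T} g"
    and u: "continuous_on {0..T} u"
      "\<And>t. t \<in> {0..T} \<Longrightarrow> u t = \<phi> + frac_int \<rho> (\<lambda>s. g s - a s * u s) t"
    and phi: "0 \<le> \<phi>" and g_nonneg: "\<And>t. t \<in> {0..T} \<Longrightarrow> 0 \<le> g t"
    and t: "t \<in> {0..T}"
  shows "0 \<le> u t"
proof -
  obtain A where A: "A > 0" "\<And>t. t \<in> {0..T} \<Longrightarrow> \<bar>a t\<bar> \<le> A"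
    using continuous_on_bounded_real[OF a] by blast
  have T: "0 \<le> T" using t by auto
  obtain v where v: "continuous_on {0..T} v"
    "\<And>t. t \<in> {0..T} \<Longrightarrow> v t = 1 + frac_int \<rho> (\<lambda>s. 1 - (- A) * v s) t"
    using fractional_linear_equation_exists[OF rho(1) T, of "\<lambda>_. - A" "\<lambda>_. 1" 1]
    by (auto intro: continuous_on_const)
  \<comment> \<open>At a zero of v its source term equals 1.\<close>
  have v_pos: "0 < v s" if "s \<in> {0..T}" for s
    unfolding v(2)[OF that] using rho that v(2)
    by (intro frac_int_first_zero[where T = T]) (auto intro!: continuous_intros v(1))
  have "0 < u t + e * v t" if e: "e > 0" for e
  proof -
    define G where "G = (\<lambda>s. (g s - a s * u s) + e * (1 - (- A) * v s))"
    have c1: "continuous_on {0..T} (\<lambda>s. g s - a s * u s)" by (intro continuous_intros a g u)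
    have c2: "continuous_on {0..T} (\<lambda>s. e * (1 - (- A) * v s))" by (intro continuous_intros v)
    have w: "u s + e * v s = (\<phi> + e) + frac_int \<rho> G s" if s: "s \<in> {0..T}" for s
      unfolding G_def frac_int_add[OF rho(1) c1 c2 s] frac_int_cmult
      using u(2)[OF s] v(2)[OF s] by (simp add: algebra_simps)
    have "0 < (\<phi> + e) + frac_int \<rho> G t"
    proof (rule frac_int_first_zero[OF rho _ _ _ t])
      show "continuous_on {0..T} G" unfolding G_def by (intro continuous_on_add c1 c2)
      show "0 < \<phi> + e" using phi e by simp
      fix s assume s: "s \<in> {0..T}" and "\<phi> + e + frac_int \<rho> G s = 0"
      hence us: "u s = - e * v s" using w[OF s] by simp
      have "G s = g s + e + e * (v s * (a s + A))" unfolding G_def us by (simp add: algebra_simps)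
      moreover have "0 \<le> v s * (a s + A)"
        using v_pos[OF s] A(2)[OF s] by (intro mult_nonneg_nonneg) (auto simp: abs_le_iff)
      ultimately show "0 < G s" using g_nonneg[OF s] e
        by (smt (verit) mult_nonneg_nonneg)
    qed
    thus ?thesis using w[OF t] by simp
  qed
  note * = this
  show ?thesis
  proof (rule field_le_epsilon)
    fix e :: real assume "e > 0"
    thus "0 \<le> u t + e" using *[of "e / v t"] v_pos[OF t] by simp
  qed
qed

section \<open>The mode equations\<close>

lemma uniformly_convergent_series_iff:
  fixes f :: "nat \<Rightarrow> 'a \<Rightarrow> real"
  shows "uniformly_convergent_on S (\<lambda>n x. \<Sum>k<n. f k x) \<longleftrightarrow>
    (\<forall>e>0. \<exists>N. \<forall>m\<ge>N. \<forall>n\<ge>m. \<forall>x\<in>S. \<bar>\<Sum>k=m..<n. f k x\<bar> < e)" (is "?A \<longleftrightarrow> ?B")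
proof -
  have diff: "(\<Sum>k<n. f k x) - (\<Sum>k<m. f k x) = (\<Sum>k=m..<n. f k x)" if "m \<le> n" for m n x
    using that by (simp add: lessThan_atLeast0 sum_diff_nat_ivl)
  have "uniformly_convergent_on S (\<lambda>n x. \<Sum>k<n. f k x) \<longleftrightarrow> uniformly_Cauchy_on S (\<lambda>n x. \<Sum>k<n. f k x)"
    by (rule uniformly_convergent_eq_Cauchy)
  also have "\<dots> \<longleftrightarrow> ?B"
  proof
    assume *: "uniformly_Cauchy_on S (\<lambda>n x. \<Sum>k<n. f k x)"
    show ?B
    proof safe
      fix e :: real assume "e > 0"
      with * obtain N where N: "\<And>x m n. x \<in> S \<Longrightarrow> m \<ge> N \<Longrightarrow> n \<ge> N \<Longrightarrow>
          dist (\<Sum>k<m. f k x) (\<Sum>k<n. f k x) < e"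
        unfolding uniformly_Cauchy_on_def by blast
      show "\<exists>N. \<forall>m\<ge>N. \<forall>n\<ge>m. \<forall>x\<in>S. \<bar>\<Sum>k=m..<n. f k x\<bar> < e"
      proof (intro exI[of _ N] allI impI ballI)
        fix m n x assume mn: "m \<ge> N" "n \<ge> m" "x \<in> S"
        show "\<bar>\<Sum>k=m..<n. f k x\<bar> < e"
          using N[of x n m] mn by (simp add: dist_real_def flip: diff)
      qed
    qed
  next
    assume B: ?B
    show "uniformly_Cauchy_on S (\<lambda>n x. \<Sum>k<n. f k x)"
      unfolding uniformly_Cauchy_on_def
    proof safe
      fix e :: real assume "e > 0"
      with B obtain N where N: "\<And>m n x. m \<ge> N \<Longrightarrow> n \<ge> m \<Longrightarrow> x \<in> S \<Longrightarrow> \<bar>\<Sum>k=m..<n. f k x\<bar> < e"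
        by blast
      have *: "dist (\<Sum>k<n. f k x) (\<Sum>k<m. f k x) < e" if "x \<in> S" "m \<ge> N" "n \<ge> m" for x m n
        using N[OF that(2,3,1)] unfolding dist_real_def diff[OF that(3)] .
      have "dist (\<Sum>k<m. f k x) (\<Sum>k<n. f k x) < e" if "x \<in> S" "m \<ge> N" "n \<ge> N" for x m n
        using *[of x m n] *[of x n m] that by (metis dist_commute linear)
      thus "\<exists>M. \<forall>x\<in>S. \<forall>m\<ge>M. \<forall>n\<ge>M. dist (\<Sum>k<m. f k x) (\<Sum>k<n. f k x) < e" by blast
    qed
  qed
  finally show ?thesis .
qed

lemma uniformly_convergent_series_comparison:
  fixes f g :: "nat \<Rightarrow> 'a \<Rightarrow> real"
  assumes g: "uniformly_convergent_on S (\<lambda>n x. \<Sum>k<n. g k x)"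
    and le: "\<And>k x. x \<in> S \<Longrightarrow> \<bar>f k x\<bar> \<le> g k x"
  shows "uniformly_convergent_on S (\<lambda>n x. \<Sum>k<n. f k x)"
  unfolding uniformly_convergent_series_iff
proof safe
  fix e :: real assume "e > 0"
  with g obtain N where N: "\<And>m n x. m \<ge> N \<Longrightarrow> n \<ge> m \<Longrightarrow> x \<in> S \<Longrightarrow> \<bar>\<Sum>k=m..<n. g k x\<bar> < e"
    unfolding uniformly_convergent_series_iff by blast
  have "\<bar>\<Sum>k=m..<n. f k x\<bar> < e" if "m \<ge> N" "n \<ge> m" "x \<in> S" for m n x
  proof -
    have "\<bar>\<Sum>k=m..<n. f k x\<bar> \<le> (\<Sum>k=m..<n. \<bar>f k x\<bar>)" by (rule sum_abs)
    also have "\<dots> \<le> (\<Sum>k=m..<n. g k x)" by (intro sum_mono le that)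
    also have "\<dots> < e" using N[OF that] by (simp add: abs_less_iff)
    finally show ?thesis .
  qed
  thus "\<exists>N. \<forall>m\<ge>N. \<forall>n\<ge>m. \<forall>x\<in>S. \<bar>\<Sum>k=m..<n. f k x\<bar> < e" by blast
qed

lemma uniformly_convergent_series_cmult:
  fixes f :: "nat \<Rightarrow> 'a \<Rightarrow> real"
  assumes "uniformly_convergent_on S (\<lambda>n x. \<Sum>k<n. f k x)"
  shows "uniformly_convergent_on S (\<lambda>n x. \<Sum>k<n. c * f k x)"
proof -
  obtain g where "uniform_limit S (\<lambda>n x. \<Sum>k<n. f k x) g sequentially"
    using assms unfolding uniformly_convergent_on_def by blast
  from bounded_linear.uniform_limit[OF bounded_linear_mult_right[of c] this]
  show ?thesis unfolding uniformly_convergent_on_def by (auto simp: sum_distrib_left)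
qed

lemma uniformly_convergent_series_add:
  fixes f g :: "nat \<Rightarrow> 'a \<Rightarrow> real"
  assumes "uniformly_convergent_on S (\<lambda>n x. \<Sum>k<n. f k x)"
    and "uniformly_convergent_on S (\<lambda>n x. \<Sum>k<n. g k x)"
  shows "uniformly_convergent_on S (\<lambda>n x. \<Sum>k<n. f k x + g k x)"
  using uniformly_convergent_add[OF assms] by (simp add: sum.distrib)

lemma uniformly_convergent_series_const:
  fixes f :: "nat \<Rightarrow> real"
  assumes "summable f"
  shows "uniformly_convergent_on S (\<lambda>n x. \<Sum>k<n. f k)"
proof -
  obtain c where "(\<lambda>n. \<Sum>k<n. f k) \<longlonglongrightarrow> c"
    using assms unfolding summable_def sums_def by blast
  hence "uniform_limit S (\<lambda>n x. \<Sum>k<n. f k) (\<lambda>_. c) sequentially"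
    unfolding uniform_limit_iff by (auto simp: tendsto_iff elim!: eventually_mono)
  thus ?thesis unfolding uniformly_convergent_on_def by blast
qed

lemma uniformly_convergent_series_limit:
  fixes f :: "nat \<Rightarrow> 'a \<Rightarrow> real"
  assumes "uniformly_convergent_on S (\<lambda>n x. \<Sum>k<n. f k x)"
  shows "uniform_limit S (\<lambda>n x. \<Sum>k<n. f k x) (\<lambda>x. \<Sum>k. f k x) sequentially"
    and "x \<in> S \<Longrightarrow> summable (\<lambda>k. f k x)"
proof -
  obtain g where g: "uniform_limit S (\<lambda>n x. \<Sum>k<n. f k x) g sequentially"
    using assms unfolding uniformly_convergent_on_def by blast
  have sums: "(\<lambda>k. f k x) sums g x" if "x \<in> S" for x
    using tendsto_uniform_limitI[OF g that] by (simp add: sums_def)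
  show "x \<in> S \<Longrightarrow> summable (\<lambda>k. f k x)" using sums by (auto simp: sums_iff)
  show "uniform_limit S (\<lambda>n x. \<Sum>k<n. f k x) (\<lambda>x. \<Sum>k. f k x) sequentially"
    using g sums by (subst uniform_limit_cong'[where g = "\<lambda>n x. \<Sum>k<n. f k x" and i = g]) (auto simp: sums_iff)
qed

lemma continuous_on_series:
  fixes f :: "nat \<Rightarrow> 'a::topological_space \<Rightarrow> real"
  assumes "uniformly_convergent_on S (\<lambda>n x. \<Sum>k<n. f k x)" "\<And>k. continuous_on S (f k)"
  shows "continuous_on S (\<lambda>x. \<Sum>k. f k x)"
  by (rule uniform_limit_theorem[OF _ uniformly_convergent_series_limit(1)[OF assms(1)]])
     (auto intro!: always_eventually continuous_on_sum assms(2))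

lemma frac_int_series:
  fixes \<rho> :: real and g :: "nat \<Rightarrow> real \<Rightarrow> real"
  assumes rho: "0 < \<rho>" and g: "\<And>k. continuous_on {0..T} (g k)"
    and conv: "uniformly_convergent_on {0..T} (\<lambda>n s. \<Sum>k<n. g k s)" and t: "t \<in> {0..T}"
  shows "(\<lambda>k. frac_int \<rho> (g k) t) sums frac_int \<rho> (\<lambda>s. \<Sum>k. g k s) t"
proof -
  define G where "G = (\<lambda>s. \<Sum>k. g k s)"
  have G: "continuous_on {0..T} G" unfolding G_def by (rule continuous_on_series[OF conv g])
  define C where "C = T powr \<rho> / Gamma (\<rho> + 1)"
  have C: "C \<ge> 0" using rho by (auto simp: C_def intro!: divide_nonneg_pos Gamma_real_pos)
  have "(\<lambda>n. \<Sum>k<n. frac_int \<rho> (g k) t) \<longlonglongrightarrow> frac_int \<rho> G t"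
  proof (rule tendstoI)
    fix e :: real assume e: "e > 0"
    hence e': "e / (C + 1) > 0" using C by simp
    from uniform_limitD[OF uniformly_convergent_series_limit(1)[OF conv] this]
    show "\<forall>\<^sub>F n in sequentially. dist (\<Sum>k<n. frac_int \<rho> (g k) t) (frac_int \<rho> G t) < e"
    proof eventually_elim
      case (elim n)
      have "(\<Sum>k<n. frac_int \<rho> (g k) t) - frac_int \<rho> G t = frac_int \<rho> (\<lambda>s. (\<Sum>k<n. g k s) - G s) t"
        using g G t by (subst frac_int_diff[OF rho]) (auto intro!: continuous_on_sum simp: frac_int_sum[OF rho g t])
      also have "\<bar>\<dots>\<bar> \<le> frac_int \<rho> (\<lambda>_. e / (C + 1)) t"
        using elim t by (intro frac_int_abs_le[OF rho, where T = T])
          (auto intro!: continuous_intros g G[unfolded G_def] simp: G_def dist_real_def less_imp_le)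
      also have "\<dots> \<le> e / (C + 1) * C"
        unfolding frac_int_const[OF rho] C_def using t e' rho
        by (simp only: times_divide_eq_right[symmetric], intro mult_left_mono divide_right_mono powr_mono2)
           (auto simp: C_def intro!: less_imp_le[OF Gamma_real_pos])
      also have "\<dots> < e" using C e by (simp add: field_simps)
      finally show ?case by (simp add: dist_real_def)
    qed
  qed
  thus ?thesis by (simp add: sums_def G_def)
qed

text \<open>The inequality is evaluated where \<open>z t * exp (- L * t)\<close> is maximal. Because
  \<open>R / L powr \<rho> \<le> 1 / 2\<close>, the linear term returns at most half of that maximum
  and is absorbed on the left, whence the factor 2.\<close>

lemma fractional_gronwall:
  fixes \<rho> :: real
  assumes rho: "0 < \<rho>" and L: "0 < L" "2 * R \<le> L powr \<rho>" and nonneg: "0 \<le> R" "0 \<le> A" "0 \<le> b"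
    and z: "continuous_on {0..T} z" "\<And>t. t \<in> {0..T} \<Longrightarrow> 0 \<le> z t"
    and h: "continuous_on {0..T} h" "\<And>t. t \<in> {0..T} \<Longrightarrow> h t \<le> b * exp (L * t) + R * z t"
    and le: "\<And>t. t \<in> {0..T} \<Longrightarrow> z t \<le> A + frac_int \<rho> h t"
    and t: "t \<in> {0..T}"
  shows "z t \<le> 2 * (A + b / L powr \<rho>) * exp (L * t)"
proof -
  define d where "d = (\<lambda>s. z s * exp (- L * s))"
  have "continuous_on {0..T} d" unfolding d_def by (intro continuous_intros z)
  then obtain x where x: "x \<in> {0..T}" "\<And>s. s \<in> {0..T} \<Longrightarrow> d s \<le> d x"
    using continuous_attains_sup[of "{0..T}" d] t by auto
  have d: "z s = d s * exp (L * s)" for s by (simp add: d_def exp_minus)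
  have dx: "0 \<le> d x" using z(2)[OF x(1)] by (simp add: d_def)
  have "frac_int \<rho> h x \<le> (b + R * d x) / L powr \<rho> * exp (L * x)"
  proof (rule frac_int_weighted_le[OF rho L(1) x(1) h(1)])
    fix s assume "s \<in> {0..x}"
    hence s: "s \<in> {0..T}" using x by auto
    have "R * z s \<le> R * (d x * exp (L * s))"
      unfolding d using x(2)[OF s] nonneg by (intro mult_left_mono mult_right_mono) auto
    thus "h s \<le> (b + R * d x) * exp (L * s)" using h(2)[OF s] by (simp add: algebra_simps)
  qed (use nonneg dx in auto)
  also have "(b + R * d x) / L powr \<rho> \<le> b / L powr \<rho> + d x / 2"
  proof -
    have "R * d x \<le> L powr \<rho> / 2 * d x" using L dx by (intro mult_right_mono) auto
    hence "R * d x / L powr \<rho> \<le> d x / 2" using L by (simp add: field_simps)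
    thus ?thesis by (simp add: add_divide_distrib)
  qed
  finally have "frac_int \<rho> h x \<le> (b / L powr \<rho> + d x / 2) * exp (L * x)" by simp
  moreover have "A \<le> A * exp (L * x)"
    using nonneg L x by (intro mult_le_cancel_left1[THEN iffD2]) auto
  ultimately have "d x * exp (L * x) \<le> (A + b / L powr \<rho> + d x / 2) * exp (L * x)"
    using le[OF x(1)] unfolding d by (simp add: distrib_right)
  hence "d x \<le> A + b / L powr \<rho> + d x / 2" by (rule mult_right_le_imp_le) simp
  hence "d t \<le> 2 * (A + b / L powr \<rho>)" using x(2)[OF t] by simp
  thus ?thesis unfolding d by (intro mult_right_mono) auto
qed

text \<open>The difference solves the homogeneous equation with initial value 0; comparison applies
  to it and to its negative.\<close>

lemma fractional_linear_equation_unique: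
  fixes \<rho> :: real
  assumes rho: "0 < \<rho>" "\<rho> < 1" and a: "continuous_on {0..T} a" and g: "continuous_on {0..T} g"
    and u: "continuous_on {0..T} u"
      "\<And>t. t \<in> {0..T} \<Longrightarrow> u t = \<phi> + frac_int \<rho> (\<lambda>s. g s - a s * u s) t"
    and v: "continuous_on {0..T} v"
      "\<And>t. t \<in> {0..T} \<Longrightarrow> v t = \<phi> + frac_int \<rho> (\<lambda>s. g s - a s * v s) t"
    and t: "t \<in> {0..T}"
  shows "u t = v t"
proof -
  have "0 \<le> w1 t - w2 t" if w: "w1 = u \<and> w2 = v \<or> w1 = v \<and> w2 = u" for w1 w2
  proof (rule fractional_comparison[OF rho a continuous_on_const _ _ _ _ t, of "\<lambda>t. w1 t - w2 t" 0 0])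
    show "continuous_on {0..T} (\<lambda>t. w1 t - w2 t)" using w u v by (auto intro: continuous_intros)
    fix t assume t: "t \<in> {0..T}"
    have "w1 t - w2 t = frac_int \<rho> (\<lambda>s. g s - a s * w1 s) t - frac_int \<rho> (\<lambda>s. g s - a s * w2 s) t"
      using w u(2)[OF t] v(2)[OF t] by auto
    also have "\<dots> = frac_int \<rho> (\<lambda>s. (g s - a s * w1 s) - (g s - a s * w2 s)) t"
      using w u v by (intro frac_int_diff[OF rho(1) _ _ t, symmetric]) (auto intro!: continuous_intros a g)
    finally show "w1 t - w2 t = 0 + frac_int \<rho> (\<lambda>s. 0 - a s * (w1 s - w2 s)) t"
      by (simp add: algebra_simps)
  qed auto
  from this[of u v] this[of v u] show ?thesis by simp
qed

text \<open>What the sine expansion supplies, with the variable x eliminated: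
  \<open>\<kappa>\<close> are the frequencies, \<open>F\<close> and \<open>B\<close> the
  coefficients of the source and of the initial value. The cubic weight is that of the sum S in the
  feedback law.\<close>

locale fractional_modes =
  fixes \<rho> T :: real and \<kappa> :: "nat \<Rightarrow> real" and \<sigma> :: "real \<Rightarrow> real"
    and F :: "nat \<Rightarrow> real \<Rightarrow> real" and B :: "nat \<Rightarrow> real"
  assumes rho: "0 < \<rho>" "\<rho> < 1" and T: "0 < T"
    and kappa: "0 < \<kappa> 0" "\<And>k. \<kappa> 0 \<le> \<kappa> k"
    and sigma: "continuous_on {0..T} \<sigma>" "\<And>t. t \<in> {0..T} \<Longrightarrow> 0 \<le> \<sigma> t"
    and F: "\<And>k. continuous_on {0..T} (F k)" "\<And>k t. t \<in> {0..T} \<Longrightarrow> 0 \<le> F k t"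
    and F_conv: "uniformly_convergent_on {0..T} (\<lambda>n t. \<Sum>k<n. \<kappa> k ^ 3 * F k t)"
    and B: "\<And>k. 0 \<le> B k" "summable (\<lambda>k. \<kappa> k ^ 3 * B k)"
begin

definition mode_solution :: "(real \<Rightarrow> real) \<Rightarrow> nat \<Rightarrow> (real \<Rightarrow> real) \<Rightarrow> bool" where
  "mode_solution q k c \<longleftrightarrow> continuous_on {0..T} c \<and>
     (\<forall>t\<in>{0..T}. c t = B k + frac_int \<rho> (\<lambda>s. F k s - (\<sigma> s * (\<kappa> k)\<^sup>2 + q s) * c s) t)"

definition mode :: "(real \<Rightarrow> real) \<Rightarrow> nat \<Rightarrow> real \<Rightarrow> real" where
  "mode q k = (SOME c. mode_solution q k c)"

definition mode_sum :: "(real \<Rightarrow> real) \<Rightarrow> real \<Rightarrow> real" where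
  "mode_sum q t = (\<Sum>k. \<kappa> k ^ 3 * mode q k t)"

lemma kappa_pos: "0 < \<kappa> k"
  using kappa(1) kappa(2)[of k] by simp

lemma kappa_power_le: "j \<le> 3 \<Longrightarrow> \<kappa> k ^ j \<le> \<kappa> k ^ 3 / \<kappa> 0 ^ (3 - j)"
proof -
  assume j: "j \<le> 3"
  have "\<kappa> k ^ j * \<kappa> 0 ^ (3 - j) \<le> \<kappa> k ^ j * \<kappa> k ^ (3 - j)"
    using kappa kappa_pos by (intro mult_left_mono power_mono) (auto intro: less_imp_le)
  also have "\<dots> = \<kappa> k ^ 3" using j by (simp flip: power_add)
  finally show ?thesis using kappa(1) by (simp add: pos_le_divide_eq)
qed

lemma coeff_cont:
  "continuous_on {0..T} q \<Longrightarrow> continuous_on {0..T} (\<lambda>s. \<sigma> s * (\<kappa> k)\<^sup>2 + q s)"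
  by (intro continuous_intros sigma)

lemma mode_solution_mode:
  assumes "continuous_on {0..T} q"
  shows "mode_solution q k (mode q k)"
proof -
  obtain c where "continuous_on {0..T} c"
    "\<And>t. t \<in> {0..T} \<Longrightarrow> c t = B k + frac_int \<rho> (\<lambda>s. F k s - (\<sigma> s * (\<kappa> k)\<^sup>2 + q s) * c s) t"
    using fractional_linear_equation_exists[OF rho(1) less_imp_le[OF T] coeff_cont[OF assms, of k] F(1)[of k],
          where \<phi> = "B k"] by blast
  hence "\<exists>c. mode_solution q k c" by (auto simp: mode_solution_def)
  thus ?thesis unfolding mode_def by (rule someI_ex)
qed

lemma mode_cont: "continuous_on {0..T} q \<Longrightarrow> continuous_on {0..T} (mode q k)"
  using mode_solution_mode by (auto simp: mode_solution_def)

lemma mode_eq: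
  "continuous_on {0..T} q \<Longrightarrow> t \<in> {0..T} \<Longrightarrow>
     mode q k t = B k + frac_int \<rho> (\<lambda>s. F k s - (\<sigma> s * (\<kappa> k)\<^sup>2 + q s) * mode q k s) t"
  using mode_solution_mode by (auto simp: mode_solution_def)

lemma mode_rhs_cont: "continuous_on {0..T} q \<Longrightarrow>
    continuous_on {0..T} (\<lambda>s. F k s - (\<sigma> s * (\<kappa> k)\<^sup>2 + q s) * mode q k s)"
  by (intro continuous_intros F sigma mode_cont)

lemma mode_nonneg: "continuous_on {0..T} q \<Longrightarrow> t \<in> {0..T} \<Longrightarrow> 0 \<le> mode q k t"
  by (rule fractional_comparison[OF rho coeff_cont F(1) mode_cont mode_eq B(1) F(2)])

lemma mode_solution_unique:
  assumes "continuous_on {0..T} q" "mode_solution q k c" "t \<in> {0..T}"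
  shows "c t = mode q k t"
  by (rule fractional_linear_equation_unique[OF rho coeff_cont[OF assms(1)] F(1) _ _ mode_cont mode_eq assms(3)])
     (use assms in \<open>auto simp: mode_solution_def\<close>)

text \<open>In the weighted sum of the mode equations the dissipation has a good sign and is
  dropped, and \<open>- R \<le> q\<close> leaves a growth rate of at most R, so Gronwall applies.
  Only a lower bound of q enters. The index set is arbitrary so that tails are covered as well as
  initial sums.\<close>

lemma mode_sum_bound:
  assumes q: "continuous_on {0..T} q" "\<And>t. t \<in> {0..T} \<Longrightarrow> - R \<le> q t"
    and L: "0 < L" "2 * R \<le> L powr \<rho>" and R: "0 \<le> R"
    and b: "0 \<le> b" "\<And>t. t \<in> {0..T} \<Longrightarrow> (\<Sum>k\<in>I. \<kappa> k ^ 3 * F k t) \<le> b"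
    and t: "t \<in> {0..T}"
  shows "(\<Sum>k\<in>I. \<kappa> k ^ 3 * mode q k t) \<le> 2 * ((\<Sum>k\<in>I. \<kappa> k ^ 3 * B k) + b / L powr \<rho>) * exp (L * t)"
proof (rule fractional_gronwall[OF rho(1) L R _ b(1) _ _ _ _ _ t])
  define h where "h = (\<lambda>s. \<Sum>k\<in>I. \<kappa> k ^ 3 * (F k s - (\<sigma> s * (\<kappa> k)\<^sup>2 + q s) * mode q k s))"
  show "continuous_on {0..T} h"
    unfolding h_def by (intro continuous_intros mode_rhs_cont q)
  show "continuous_on {0..T} (\<lambda>t. \<Sum>k\<in>I. \<kappa> k ^ 3 * mode q k t)"
    by (intro continuous_intros mode_cont q)
  show "0 \<le> (\<Sum>k\<in>I. \<kappa> k ^ 3 * B k)"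
    by (intro sum_nonneg mult_nonneg_nonneg B less_imp_le[OF zero_less_power] kappa_pos)
  fix t assume t: "t \<in> {0..T}"
  show "0 \<le> (\<Sum>k\<in>I. \<kappa> k ^ 3 * mode q k t)"
    by (intro sum_nonneg mult_nonneg_nonneg mode_nonneg q t less_imp_le[OF zero_less_power] kappa_pos)
  have "(\<Sum>k\<in>I. \<kappa> k ^ 3 * mode q k t) =
      (\<Sum>k\<in>I. \<kappa> k ^ 3 * B k + frac_int \<rho> (\<lambda>s. \<kappa> k ^ 3 * (F k s - (\<sigma> s * (\<kappa> k)\<^sup>2 + q s) * mode q k s)) t)"
    unfolding frac_int_cmult by (subst mode_eq[OF q(1) t]) (simp add: distrib_left)
  also have "\<dots> = (\<Sum>k\<in>I. \<kappa> k ^ 3 * B k) + frac_int \<rho> h t"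
    unfolding h_def sum.distrib
    by (subst frac_int_sum[OF rho(1) _ t]) (auto intro!: continuous_intros mode_rhs_cont q)
  finally show "(\<Sum>k\<in>I. \<kappa> k ^ 3 * mode q k t) \<le> (\<Sum>k\<in>I. \<kappa> k ^ 3 * B k) + frac_int \<rho> h t" by simp
  have "h t \<le> (\<Sum>k\<in>I. \<kappa> k ^ 3 * F k t + R * (\<kappa> k ^ 3 * mode q k t))"
    unfolding h_def
  proof (intro sum_mono)
    fix k
    have "0 \<le> \<sigma> t * (\<kappa> k)\<^sup>2 + (q t + R)" using sigma(2)[OF t] q(2)[OF t] by simp
    hence "0 \<le> \<kappa> k ^ 3 * ((\<sigma> t * (\<kappa> k)\<^sup>2 + (q t + R)) * mode q k t)"
      by (intro mult_nonneg_nonneg mode_nonneg q t less_imp_le[OF zero_less_power] kappa_pos)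
    thus "\<kappa> k ^ 3 * (F k t - (\<sigma> t * (\<kappa> k)\<^sup>2 + q t) * mode q k t) \<le>
        \<kappa> k ^ 3 * F k t + R * (\<kappa> k ^ 3 * mode q k t)"
      by (simp add: algebra_simps)
  qed
  also have "\<dots> \<le> b + R * (\<Sum>k\<in>I. \<kappa> k ^ 3 * mode q k t)"
    using b(2)[OF t] by (simp add: sum.distrib sum_distrib_left)
  also have "b \<le> b * exp (L * t)"
    using b L t by (intro mult_le_cancel_left1[THEN iffD2]) auto
  finally show "h t \<le> b * exp (L * t) + R * (\<Sum>k\<in>I. \<kappa> k ^ 3 * mode q k t)" by simp
qed

lemma weight_exists:
  assumes "0 \<le> x"
  obtains L where "0 < L" "x \<le> L powr \<rho>"
proof
  show "0 < (x + 1) powr (1 / \<rho>)" "x \<le> ((x + 1) powr (1 / \<rho>)) powr \<rho>"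
    using assms rho by (auto simp: powr_powr)
qed

text \<open>\<open>mode_sum_bound\<close>, applied to index sets \<open>{m..<n}\<close>, bounds the
  tails of the mode series by the tails of the series for \<open>B\<close> and \<open>F\<close>,
  uniformly in t.\<close>

lemma mode_conv:
  assumes q: "continuous_on {0..T} q"
  shows "uniformly_convergent_on {0..T} (\<lambda>n t. \<Sum>k<n. \<kappa> k ^ 3 * mode q k t)"
  unfolding uniformly_convergent_series_iff
proof safe
  fix e :: real assume e: "e > 0"
  obtain R where R: "R > 0" "\<And>t. t \<in> {0..T} \<Longrightarrow> \<bar>q t\<bar> \<le> R"
    using continuous_on_bounded_real[OF q] by blast
  \<comment> \<open>The summand 1 ensures \<open>L powr \<rho> \<ge> 1\<close>, so that
    \<open>d / L powr \<rho> \<le> d\<close> below. The tail is then at most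
    \<open>4 * d * exp (L * T)\<close>, which is smaller than e by the choice of d.\<close>
  obtain L where L: "0 < L" "2 * R + 1 \<le> L powr \<rho>"
    using weight_exists[of "2 * R + 1"] R by auto
  define d where "d = e / (6 * exp (L * T))"
  have d: "d > 0" using e by (simp add: d_def)
  obtain N1 where N1: "\<And>m n t. m \<ge> N1 \<Longrightarrow> n \<ge> m \<Longrightarrow> t \<in> {0..T} \<Longrightarrow> \<bar>\<Sum>k=m..<n. \<kappa> k ^ 3 * F k t\<bar> < d"
    using F_conv[unfolded uniformly_convergent_series_iff, rule_format, OF d] by blast
  obtain N2 where N2: "\<And>m n t. m \<ge> N2 \<Longrightarrow> n \<ge> m \<Longrightarrow> t \<in> {0..T} \<Longrightarrow> \<bar>\<Sum>k=m..<n. \<kappa> k ^ 3 * B k\<bar> < d"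
    using uniformly_convergent_series_const[OF B(2), of "{0..T}", unfolded uniformly_convergent_series_iff,
        rule_format, OF d] by blast
  show "\<exists>N. \<forall>m\<ge>N. \<forall>n\<ge>m. \<forall>t\<in>{0..T}. \<bar>\<Sum>k=m..<n. \<kappa> k ^ 3 * mode q k t\<bar> < e"
  proof (intro exI[of _ "max N1 N2"] allI impI ballI)
    fix m n t assume mn: "max N1 N2 \<le> m" "m \<le> n" and t: "t \<in> {0..T}"
    have "(\<Sum>k=m..<n. \<kappa> k ^ 3 * mode q k t) \<le>
        2 * ((\<Sum>k=m..<n. \<kappa> k ^ 3 * B k) + d / L powr \<rho>) * exp (L * t)"
    proof (rule mode_sum_bound[OF q _ _ _ _ _ _ t])
      show "(\<Sum>k=m..<n. \<kappa> k ^ 3 * F k t) \<le> d" if "t \<in> {0..T}" for t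
        using N1[of m n t] mn that by (simp add: abs_less_iff)
      show "- R \<le> q t" if "t \<in> {0..T}" for t using R(2)[OF that] by (simp add: abs_le_iff)
    qed (use L R d in auto)
    also have "\<dots> \<le> 2 * (d + d) * exp (L * T)"
    proof (intro mult_mono add_mono)
      show "(\<Sum>k=m..<n. \<kappa> k ^ 3 * B k) \<le> d"
        using N2[of m n t] mn t by (simp add: abs_less_iff)
      have "d * 1 \<le> d * L powr \<rho>" using d L R by (intro mult_left_mono) auto
      thus "d / L powr \<rho> \<le> d" using L by (simp add: pos_divide_le_eq)
      show "0 \<le> (\<Sum>k=m..<n. \<kappa> k ^ 3 * B k) + d / L powr \<rho>"
        using d by (intro add_nonneg_nonneg sum_nonneg mult_nonneg_nonneg B less_imp_le[OF zero_less_power] kappa_pos) auto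
    qed (use L t d in auto)
    also have "\<dots> < e" using e by (simp add: d_def)
    finally have "(\<Sum>k=m..<n. \<kappa> k ^ 3 * mode q k t) < e" .
    moreover have "0 \<le> (\<Sum>k=m..<n. \<kappa> k ^ 3 * mode q k t)"
      by (intro sum_nonneg mult_nonneg_nonneg mode_nonneg q t less_imp_le[OF zero_less_power] kappa_pos)
    ultimately show "\<bar>\<Sum>k=m..<n. \<kappa> k ^ 3 * mode q k t\<bar> < e" by simp
  qed
qed

lemma mode_sum_cont: "continuous_on {0..T} q \<Longrightarrow> continuous_on {0..T} (mode_sum q)"
  unfolding mode_sum_def
  by (rule continuous_on_series[OF mode_conv]) (auto intro!: continuous_intros mode_cont)

lemma mode_summable: "continuous_on {0..T} q \<Longrightarrow> t \<in> {0..T} \<Longrightarrow> summable (\<lambda>k. \<kappa> k ^ 3 * mode q k t)"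
  by (rule uniformly_convergent_series_limit(2)[OF mode_conv])

lemma mode_partial_sum_le:
  "continuous_on {0..T} q \<Longrightarrow> t \<in> {0..T} \<Longrightarrow> (\<Sum>k<n. \<kappa> k ^ 3 * mode q k t) \<le> mode_sum q t"
  unfolding mode_sum_def
  by (intro sum_le_suminf mode_summable) (auto intro!: mult_nonneg_nonneg mode_nonneg less_imp_le[OF kappa_pos])

lemma F_sum_cont: "continuous_on {0..T} (\<lambda>t. \<Sum>k. \<kappa> k ^ 3 * F k t)"
  by (rule continuous_on_series[OF F_conv]) (auto intro!: continuous_intros F)

lemma F_partial_sum_le:
  "t \<in> {0..T} \<Longrightarrow> (\<Sum>k<n. \<kappa> k ^ 3 * F k t) \<le> (\<Sum>k. \<kappa> k ^ 3 * F k t)"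
  by (intro sum_le_suminf uniformly_convergent_series_limit(2)[OF F_conv])
     (auto intro!: mult_nonneg_nonneg F less_imp_le[OF kappa_pos])

lemma F_sum_bound:
  obtains b where "0 < b" "\<And>n t. t \<in> {0..T} \<Longrightarrow> (\<Sum>k<n. \<kappa> k ^ 3 * F k t) \<le> b"
proof -
  obtain b where b: "b > 0" "\<And>t. t \<in> {0..T} \<Longrightarrow> \<bar>\<Sum>k. \<kappa> k ^ 3 * F k t\<bar> \<le> b"
    using continuous_on_bounded_real[OF F_sum_cont] by blast
  show ?thesis
    using that[OF b(1)] F_partial_sum_le b(2) by (meson abs_le_D1 order_trans)
qed

text \<open>The order of the quantifiers is the point: Z depends on the lower bound
  \<open>- R\<close> only and is fixed before q. The contraction constant for truncated coefficients
  is built from it.\<close>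

lemma mode_partial_sum_bound:
  assumes "0 \<le> R"
  obtains Z where "0 < Z" "\<And>q n t. continuous_on {0..T} q \<Longrightarrow> (\<And>t. t \<in> {0..T} \<Longrightarrow> - R \<le> q t) \<Longrightarrow>
    t \<in> {0..T} \<Longrightarrow> (\<Sum>k<n. \<kappa> k ^ 3 * mode q k t) \<le> Z"
proof -
  obtain b where b: "0 < b" "\<And>n t. t \<in> {0..T} \<Longrightarrow> (\<Sum>k<n. \<kappa> k ^ 3 * F k t) \<le> b"
    using F_sum_bound by blast
  obtain L where L: "0 < L" "2 * R \<le> L powr \<rho>"
    using weight_exists[of "2 * R"] assms by auto
  define Z where "Z = 2 * ((\<Sum>k. \<kappa> k ^ 3 * B k) + b / L powr \<rho>) * exp (L * T)"
  have B0: "0 \<le> \<kappa> k ^ 3 * B k" for k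
    by (intro mult_nonneg_nonneg B less_imp_le[OF zero_less_power] kappa_pos)
  have "0 \<le> (\<Sum>k. \<kappa> k ^ 3 * B k)" by (intro suminf_nonneg B(2) B0)
  hence Z: "Z > 0" unfolding Z_def using b L by (intro mult_pos_pos add_nonneg_pos) auto
  have "(\<Sum>k<n. \<kappa> k ^ 3 * mode q k t) \<le> Z"
    if q: "continuous_on {0..T} q" "\<And>t. t \<in> {0..T} \<Longrightarrow> - R \<le> q t" and t: "t \<in> {0..T}" for q n t
  proof -
    have "(\<Sum>k<n. \<kappa> k ^ 3 * mode q k t) \<le> 2 * ((\<Sum>k<n. \<kappa> k ^ 3 * B k) + b / L powr \<rho>) * exp (L * t)"
      by (rule mode_sum_bound[OF q L assms _ _ t]) (use b in auto)
    also have "\<dots> \<le> Z" unfolding Z_def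
      using L t b B0 by (intro mult_mono add_mono sum_le_suminf B(2)) (auto intro!: add_nonneg_nonneg sum_nonneg suminf_nonneg B(2))
    finally show ?thesis .
  qed
  thus ?thesis using that[OF Z] by blast
qed

text \<open>The difference of two modes is dominated by a solution \<open>w k\<close> of the equation with
  the constant coefficient \<open>- R\<close>; the domination is kept modewise, since only the sum over k of
  the modes, and not the sum of their suprema over t, is under control.\<close>

lemma mode_sum_lipschitz:
  assumes R: "0 \<le> R" and L: "0 < L" "2 * R \<le> L powr \<rho>" and Z: "0 < Z"
    "\<And>q n t. continuous_on {0..T} q \<Longrightarrow> (\<And>t. t \<in> {0..T} \<Longrightarrow> - R \<le> q t) \<Longrightarrow>
      t \<in> {0..T} \<Longrightarrow> (\<Sum>k<n. \<kappa> k ^ 3 * mode q k t) \<le> Z"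
    and p: "continuous_on {0..T} p" "\<And>t. t \<in> {0..T} \<Longrightarrow> - R \<le> p t"
    and q: "continuous_on {0..T} q" "\<And>t. t \<in> {0..T} \<Longrightarrow> - R \<le> q t"
    and m: "0 \<le> m" "\<And>t. t \<in> {0..T} \<Longrightarrow> \<bar>p t - q t\<bar> \<le> m * exp (L * t)"
    and t: "t \<in> {0..T}"
  shows "\<bar>mode_sum p t - mode_sum q t\<bar> \<le> 2 * Z * m / L powr \<rho> * exp (L * t)"
proof -
  define d where "d = (\<lambda>s. \<bar>p s - q s\<bar>)"
  have d: "continuous_on {0..T} d" unfolding d_def by (intro continuous_intros p q)
  have d_nonneg: "0 \<le> d s" for s by (simp add: d_def)
  \<comment> \<open>The majorant solves the equation with source
    \<open>\<bar>p - q\<bar> * mode q k\<close>, growth rate R and initial value 0.\<close>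
  define wsol where "wsol = (\<lambda>k w. continuous_on {0..T} w \<and>
    (\<forall>t\<in>{0..T}. w t = 0 + frac_int \<rho> (\<lambda>s. d s * mode q k s - (- R) * w s) t))"
  have "\<exists>w. wsol k w" for k
    unfolding wsol_def
    by (rule fractional_linear_equation_exists[OF rho(1) less_imp_le[OF T], of "\<lambda>_. - R" "\<lambda>s. d s * mode q k s" 0])
       (use q in \<open>auto intro!: continuous_intros d mode_cont\<close>)
  then obtain w where "\<And>k. wsol k (w k)" by metis
  hence w_cont: "continuous_on {0..T} (w k)"
    and w_eq: "t \<in> {0..T} \<Longrightarrow> w k t = 0 + frac_int \<rho> (\<lambda>s. d s * mode q k s - (- R) * w k s) t" for k t
    by (auto simp: wsol_def)
  have w_nonneg: "0 \<le> w k t" if t: "t \<in> {0..T}" for k t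
    by (rule fractional_comparison[OF rho _ _ w_cont w_eq _ _ t])
       (use d_nonneg in \<open>auto intro!: continuous_intros d mode_cont q mult_nonneg_nonneg mode_nonneg\<close>)
  \<comment> \<open>The factor e is 1 or -1, so one argument yields both halves of an absolute value
    bound.\<close>
  have diff_le: "e * (mode p k t - mode q k t) \<le> w k t" if e: "\<bar>e\<bar> = 1" and t: "t \<in> {0..T}" for e k t
  proof -
    \<comment> \<open>The source left over when \<open>w k - e * (mode p k - mode q k)\<close> is
      written as a solution of the equation with the coefficient of p. The first summand is
      nonnegative since \<open>\<bar>e * (p - q)\<bar> = d\<close>, the second since
      \<open>- R \<le> p\<close>.\<close>
    define g where "g = (\<lambda>s. (d s + e * (p s - q s)) * mode q k s + (R + (\<sigma> s * (\<kappa> k)\<^sup>2 + p s)) * w k s)"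
    have "0 \<le> w k t - e * (mode p k t - mode q k t)"
    proof (rule fractional_comparison[OF rho coeff_cont[OF p(1)] _ _ _ order.refl _ t])
      show "continuous_on {0..T} g"
        unfolding g_def by (intro continuous_intros d p q mode_cont w_cont sigma)
      show "continuous_on {0..T} (\<lambda>t. w k t - e * (mode p k t - mode q k t))"
        by (intro continuous_intros w_cont mode_cont p q)
      fix s assume s: "s \<in> {0..T}"
      show "0 \<le> g s" unfolding g_def
      proof (rule add_nonneg_nonneg[OF mult_nonneg_nonneg[OF _ mode_nonneg[OF q(1) s]]
            mult_nonneg_nonneg[OF _ w_nonneg[OF s]]])
        have "\<bar>e * (p s - q s)\<bar> = d s" using e by (simp add: d_def abs_mult)
        thus "0 \<le> d s + e * (p s - q s)" by linarith
        show "0 \<le> R + (\<sigma> s * (\<kappa> k)\<^sup>2 + p s)"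
          using mult_nonneg_nonneg[OF sigma(2)[OF s] zero_le_power2[of "\<kappa> k"]] p(2)[OF s] by linarith
      qed
      let ?u = "\<lambda>s. d s * mode q k s - (- R) * w k s"
      let ?p = "\<lambda>s. F k s - (\<sigma> s * (\<kappa> k)\<^sup>2 + p s) * mode p k s"
      let ?q = "\<lambda>s. F k s - (\<sigma> s * (\<kappa> k)\<^sup>2 + q s) * mode q k s"
      have u_cont: "continuous_on {0..T} ?u" by (intro continuous_intros d mode_cont q w_cont)
      have "w k s - e * (mode p k s - mode q k s) =
          frac_int \<rho> ?u s - e * (frac_int \<rho> ?p s - frac_int \<rho> ?q s)"
        using w_eq[OF s, of k] mode_eq[OF p(1) s, of k] mode_eq[OF q(1) s, of k] by simp
      also have "\<dots> = frac_int \<rho> (\<lambda>s. ?u s - e * (?p s - ?q s)) s"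
        unfolding frac_int_diff[OF rho(1) mode_rhs_cont[OF p(1)] mode_rhs_cont[OF q(1)] s, symmetric]
          frac_int_cmult[symmetric]
        by (rule frac_int_diff[OF rho(1) u_cont _ s, symmetric])
           (intro continuous_on_mult continuous_on_const continuous_on_diff[OF mode_rhs_cont[OF p(1)] mode_rhs_cont[OF q(1)]])
      also have "(\<lambda>s. ?u s - e * (?p s - ?q s)) =
          (\<lambda>s. g s - (\<sigma> s * (\<kappa> k)\<^sup>2 + p s) * (w k s - e * (mode p k s - mode q k s)))"
        by (simp add: g_def algebra_simps)
      finally show "w k s - e * (mode p k s - mode q k s) = 0 + frac_int \<rho>
          (\<lambda>s. g s - (\<sigma> s * (\<kappa> k)\<^sup>2 + p s) * (w k s - e * (mode p k s - mode q k s))) s" by simp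
    qed
    thus ?thesis by simp
  qed
  have w_sum: "(\<Sum>k<n. \<kappa> k ^ 3 * w k t) \<le> 2 * (0 + Z * m / L powr \<rho>) * exp (L * t)" for n
  proof (rule fractional_gronwall[OF rho(1) L R order.refl _ _ _ _ _ _ t])
    define h where "h = (\<lambda>s. \<Sum>k<n. \<kappa> k ^ 3 * (d s * mode q k s - (- R) * w k s))"
    show "continuous_on {0..T} h" unfolding h_def by (intro continuous_intros d mode_cont q w_cont)
    show "continuous_on {0..T} (\<lambda>t. \<Sum>k<n. \<kappa> k ^ 3 * w k t)" by (intro continuous_intros w_cont)
    show "0 \<le> Z * m" using Z m by simp
    fix t assume t: "t \<in> {0..T}"
    show "0 \<le> (\<Sum>k<n. \<kappa> k ^ 3 * w k t)"
      by (intro sum_nonneg mult_nonneg_nonneg w_nonneg t less_imp_le[OF zero_less_power] kappa_pos)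
    have "(\<Sum>k<n. \<kappa> k ^ 3 * w k t) =
        (\<Sum>k<n. frac_int \<rho> (\<lambda>s. \<kappa> k ^ 3 * (d s * mode q k s - (- R) * w k s)) t)"
      unfolding frac_int_cmult by (subst w_eq[OF t]) simp
    also have "\<dots> = frac_int \<rho> h t"
      unfolding h_def by (subst frac_int_sum[OF rho(1) _ t]) (auto intro!: continuous_intros d mode_cont q w_cont)
    finally show "(\<Sum>k<n. \<kappa> k ^ 3 * w k t) \<le> 0 + frac_int \<rho> h t" by simp
    have "h t = d t * (\<Sum>k<n. \<kappa> k ^ 3 * mode q k t) + R * (\<Sum>k<n. \<kappa> k ^ 3 * w k t)"
      unfolding h_def by (simp add: sum_distrib_left sum.distrib[symmetric] algebra_simps)
    also have "d t * (\<Sum>k<n. \<kappa> k ^ 3 * mode q k t) \<le> (m * exp (L * t)) * Z"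
      using m(2)[OF t] Z(2)[OF q t] m(1) unfolding d_def
      by (intro mult_mono) (auto intro!: sum_nonneg mult_nonneg_nonneg mode_nonneg q t less_imp_le[OF kappa_pos])
    finally show "h t \<le> Z * m * exp (L * t) + R * (\<Sum>k<n. \<kappa> k ^ 3 * w k t)" by (simp add: mult_ac)
  qed
  have "\<bar>(\<Sum>k<n. \<kappa> k ^ 3 * mode p k t) - (\<Sum>k<n. \<kappa> k ^ 3 * mode q k t)\<bar> \<le> 2 * Z * m / L powr \<rho> * exp (L * t)" for n
  proof -
    have "\<bar>(\<Sum>k<n. \<kappa> k ^ 3 * mode p k t) - (\<Sum>k<n. \<kappa> k ^ 3 * mode q k t)\<bar> =
        \<bar>\<Sum>k<n. \<kappa> k ^ 3 * (mode p k t - mode q k t)\<bar>"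
      by (simp add: sum_subtractf right_diff_distrib)
    also have "\<dots> \<le> (\<Sum>k<n. \<bar>\<kappa> k ^ 3 * (mode p k t - mode q k t)\<bar>)" by (rule sum_abs)
    also have "\<dots> \<le> (\<Sum>k<n. \<kappa> k ^ 3 * w k t)"
    proof (intro sum_mono)
      fix k
      have "\<bar>mode p k t - mode q k t\<bar> \<le> w k t"
        using diff_le[of 1 t k] diff_le[of "-1" t k] t by simp
      thus "\<bar>\<kappa> k ^ 3 * (mode p k t - mode q k t)\<bar> \<le> \<kappa> k ^ 3 * w k t"
        using kappa_pos[of k] by (simp add: abs_mult)
    qed
    finally show ?thesis using w_sum[of n] by simp
  qed
  moreover have "(\<lambda>n. \<bar>(\<Sum>k<n. \<kappa> k ^ 3 * mode p k t) - (\<Sum>k<n. \<kappa> k ^ 3 * mode q k t)\<bar>)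
      \<longlonglongrightarrow> \<bar>mode_sum p t - mode_sum q t\<bar>"
    unfolding mode_sum_def by (intro tendsto_intros summable_LIMSEQ mode_summable p q t)
  ultimately show ?thesis by (intro LIMSEQ_le_const2) auto
qed

end

section \<open>The feedback fixed point\<close>

text \<open>\<open>D\<psi>\<close> stands for the Caputo derivative of \<open>\<psi>\<close> and is
  required only through the integrated relation. \<open>psi_0\<close> is the compatibility of the
  initial flux with \<open>\<psi>\<close>, and \<open>q0_nonneg\<close> makes the part
  \<open>q\<^sub>0\<close> of the feedback law nonnegative.\<close>

locale fractional_inverse_modes = fractional_modes +
  fixes \<psi> D\<psi> :: "real \<Rightarrow> real"
  assumes psi: "continuous_on {0..T} \<psi>" "\<And>t. t \<in> {0..T} \<Longrightarrow> 0 < \<psi> t"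
    and Dpsi: "continuous_on {0..T} D\<psi>" "\<And>t. t \<in> {0..T} \<Longrightarrow> \<psi> t = \<psi> 0 + frac_int \<rho> D\<psi> t"
    and psi_0: "\<psi> 0 = (\<Sum>k. \<kappa> k * B k)"
    and q0_nonneg: "\<And>t. t \<in> {0..T} \<Longrightarrow> D\<psi> t \<le> (\<Sum>k. \<kappa> k * F k t)"
begin

definition q\<^sub>0 :: "real \<Rightarrow> real" where
  "q\<^sub>0 t = ((\<Sum>k. \<kappa> k * F k t) - D\<psi> t) / \<psi> t"

text \<open>Multiplying the k-th equation by \<open>\<kappa> k\<close>, summing and replacing the
  flux by \<open>\<psi>\<close> gives \<open>D\<psi> = (\<Sum>k. \<kappa> k * F k) - \<sigma> *
  mode_sum q - q * \<psi>\<close>; this is its solution for the factor q of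
  \<open>\<psi>\<close>.\<close>

definition feedback :: "(real \<Rightarrow> real) \<Rightarrow> real \<Rightarrow> real" where
  "feedback q t = q\<^sub>0 t - \<sigma> t / \<psi> t * mode_sum q t"

definition clip :: "real \<Rightarrow> (real \<Rightarrow> real) \<Rightarrow> real \<Rightarrow> real" where
  "clip R q t = max (- R) (min R (q t))"

lemma psi_nz: "t \<in> {0..T} \<Longrightarrow> \<psi> t \<noteq> 0"
  using psi(2)[of t] by simp

lemma clip_cont: "continuous_on {0..T} q \<Longrightarrow> continuous_on {0..T} (clip R q)"
  unfolding clip_def by (intro continuous_intros)

lemma clip_ge: "- R \<le> clip R q t"
  by (simp add: clip_def)

lemma kappa_le_cube: "\<kappa> k \<le> \<kappa> k ^ 3 * (1 / (\<kappa> 0)\<^sup>2)"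
  using kappa_power_le[of 1 k] by simp

lemma first_power_conv:
  assumes "uniformly_convergent_on {0..T} (\<lambda>n t. \<Sum>k<n. \<kappa> k ^ 3 * c k t)" "\<And>k t. t \<in> {0..T} \<Longrightarrow> 0 \<le> c k t"
  shows "uniformly_convergent_on {0..T} (\<lambda>n t. \<Sum>k<n. \<kappa> k * c k t)"
proof (rule uniformly_convergent_series_comparison[OF uniformly_convergent_series_cmult[OF assms(1), of "1 / (\<kappa> 0)\<^sup>2"]])
  fix k t assume t: "t \<in> {0..T}"
  show "\<bar>\<kappa> k * c k t\<bar> \<le> 1 / (\<kappa> 0)\<^sup>2 * (\<kappa> k ^ 3 * c k t)"
    using mult_right_mono[OF kappa_le_cube[of k] assms(2)[OF t, of k]] kappa_pos[of k] assms(2)[OF t, of k]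
    by (simp add: abs_mult mult_ac)
qed

lemma source_flux_cont: "continuous_on {0..T} (\<lambda>t. \<Sum>k. \<kappa> k * F k t)"
  by (rule continuous_on_series[OF first_power_conv[OF F_conv F(2)]]) (auto intro!: continuous_intros F)

lemma q0_cont: "continuous_on {0..T} q\<^sub>0"
  unfolding q\<^sub>0_def by (intro continuous_intros source_flux_cont psi(1) Dpsi(1)) (use psi_nz in auto)

lemma ratio_bound:
  obtains C where "C > 0" "\<And>t. t \<in> {0..T} \<Longrightarrow> \<bar>\<sigma> t / \<psi> t\<bar> \<le> C"
proof -
  have "continuous_on {0..T} (\<lambda>t. \<sigma> t / \<psi> t)"
    by (intro continuous_intros sigma(1) psi(1)) (use psi_nz in auto)
  thus ?thesis using continuous_on_bounded_real that by blast
qed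

lemma feedback_cont: "continuous_on {0..T} q \<Longrightarrow> continuous_on {0..T} (feedback q)"
  unfolding feedback_def
  by (intro continuous_intros q0_cont sigma(1) psi(1) mode_sum_cont) (use psi_nz in auto)+

lemma feedback_contraction:
  assumes R: "0 \<le> R"
  obtains L where "\<And>u v m t. continuous_on {0..T} u \<Longrightarrow> continuous_on {0..T} v \<Longrightarrow> 0 \<le> m \<Longrightarrow>
      (\<And>s. s \<in> {0..T} \<Longrightarrow> \<bar>u s - v s\<bar> \<le> m * exp (L * s)) \<Longrightarrow> t \<in> {0..T} \<Longrightarrow>
      \<bar>feedback (clip R u) t - feedback (clip R v) t\<bar> \<le> 1 / 2 * m * exp (L * t)"
proof -
  obtain Z where Z: "0 < Z" "\<And>q n t. continuous_on {0..T} q \<Longrightarrow> (\<And>t. t \<in> {0..T} \<Longrightarrow> - R \<le> q t) \<Longrightarrow>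
    t \<in> {0..T} \<Longrightarrow> (\<Sum>k<n. \<kappa> k ^ 3 * mode q k t) \<le> Z"
    using mode_partial_sum_bound[OF R] by blast
  obtain C where C: "C > 0" "\<And>t. t \<in> {0..T} \<Longrightarrow> \<bar>\<sigma> t / \<psi> t\<bar> \<le> C"
    using ratio_bound by blast
  \<comment> \<open>The summand \<open>2 * R\<close> is demanded by the Lipschitz bound;
    \<open>4 * C * Z\<close> turns its factor, multiplied by the bound C of
    \<open>\<sigma> / \<psi>\<close>, namely \<open>2 * C * Z / L powr \<rho>\<close>, into at most
    1/2.\<close>
  obtain L where L: "0 < L" "2 * R + 4 * C * Z \<le> L powr \<rho>"
    using weight_exists[of "2 * R + 4 * C * Z"] R C Z by auto
  have L': "2 * R \<le> L powr \<rho>" "4 * C * Z \<le> L powr \<rho>"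
    using L R mult_pos_pos[OF C(1) Z(1)] by linarith+
  show ?thesis
  proof (rule that[of L])
    fix u v m t
    assume u: "continuous_on {0..T} u" and v: "continuous_on {0..T} v" and m: "(0::real) \<le> m"
      and le: "\<And>s. s \<in> {0..T} \<Longrightarrow> \<bar>u s - v s\<bar> \<le> m * exp (L * s)" and t: "t \<in> {0..T}"
    have "\<bar>clip R u s - clip R v s\<bar> \<le> m * exp (L * s)" if "s \<in> {0..T}" for s
      using le[OF that] by (auto simp: clip_def)
    hence *: "\<bar>mode_sum (clip R u) t - mode_sum (clip R v) t\<bar> \<le> 2 * Z * m / L powr \<rho> * exp (L * t)"
      by (intro mode_sum_lipschitz[OF R L(1) L'(1) Z] clip_cont u v clip_ge m t)
    have "\<bar>feedback (clip R u) t - feedback (clip R v) t\<bar> =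
        \<bar>\<sigma> t / \<psi> t\<bar> * \<bar>mode_sum (clip R u) t - mode_sum (clip R v) t\<bar>"
      unfolding feedback_def abs_mult[symmetric] by (simp add: algebra_simps abs_minus_commute)
    also have "\<dots> \<le> C * (2 * Z * m / L powr \<rho> * exp (L * t))"
      using C by (intro mult_mono C(2) t *) auto
    also have "\<dots> = (4 * C * Z) / L powr \<rho> * (1 / 2 * m * exp (L * t))" by simp
    also have "\<dots> \<le> 1 * (1 / 2 * m * exp (L * t))"
      using L L'(2) m by (intro mult_right_mono) auto
    finally show "\<bar>feedback (clip R u) t - feedback (clip R v) t\<bar> \<le> 1 / 2 * m * exp (L * t)" by simp
  qed
qed

lemma clipped_fixpoint_exists:
  assumes "0 \<le> R"
  obtains q where "continuous_on {0..T} q" "\<And>t. t \<in> {0..T} \<Longrightarrow> q t = feedback (clip R q) t"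
proof -
  obtain L where L: "\<And>u v m t. continuous_on {0..T} u \<Longrightarrow> continuous_on {0..T} v \<Longrightarrow> 0 \<le> m \<Longrightarrow>
      (\<And>s. s \<in> {0..T} \<Longrightarrow> \<bar>u s - v s\<bar> \<le> m * exp (L * s)) \<Longrightarrow> t \<in> {0..T} \<Longrightarrow>
      \<bar>feedback (clip R u) t - feedback (clip R v) t\<bar> \<le> 1 / 2 * m * exp (L * t)"
    using feedback_contraction[OF assms] by blast
  show ?thesis
    by (rule weighted_banach_fixpoint[of T "\<lambda>q. feedback (clip R q)" "1 / 2" L])
       (use T that L in \<open>auto intro!: feedback_cont clip_cont\<close>)
qed

lemma mode_cong:
  assumes "continuous_on {0..T} q" "\<And>t. t \<in> {0..T} \<Longrightarrow> p t = q t" "t \<in> {0..T}"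
  shows "mode p k t = mode q k t"
proof (rule mode_solution_unique[OF assms(1) _ assms(3)])
  have p: "continuous_on {0..T} p" using assms(1,2) continuous_on_cong[of "{0..T}" "{0..T}" p q] by simp
  show "mode_solution q k (mode p k)"
    unfolding mode_solution_def
  proof (intro conjI ballI mode_cont p)
    fix t assume t: "t \<in> {0..T}"
    show "mode p k t = B k + frac_int \<rho> (\<lambda>s. F k s - (\<sigma> s * (\<kappa> k)\<^sup>2 + q s) * mode p k s) t"
      unfolding mode_eq[OF p t] using t assms(2)
      by (intro arg_cong2[where f = "(+)"] refl frac_int_cong[OF rho(1) t]) auto
  qed
qed

lemma feedback_cong:
  assumes "continuous_on {0..T} q" "\<And>t. t \<in> {0..T} \<Longrightarrow> p t = q t" "t \<in> {0..T}"
  shows "feedback p t = feedback q t"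
  using mode_cong[OF assms] by (simp add: feedback_def mode_sum_def)

text \<open>Two fixed points are bounded, hence both unaffected by truncation at a common large R,
  and the truncated map is a contraction.\<close>

lemma fixpoint_unique:
  assumes p: "continuous_on {0..T} p" "\<And>t. t \<in> {0..T} \<Longrightarrow> p t = feedback p t"
    and q: "continuous_on {0..T} q" "\<And>t. t \<in> {0..T} \<Longrightarrow> q t = feedback q t"
    and t: "t \<in> {0..T}"
  shows "p t = q t"
proof -
  obtain R1 where R1: "R1 > 0" "\<And>t. t \<in> {0..T} \<Longrightarrow> \<bar>p t\<bar> \<le> R1"
    using continuous_on_bounded_real[OF p(1)] by blast
  obtain R2 where R2: "R2 > 0" "\<And>t. t \<in> {0..T} \<Longrightarrow> \<bar>q t\<bar> \<le> R2"
    using continuous_on_bounded_real[OF q(1)] by blast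
  define R where "R = max R1 R2"
  have R0: "0 \<le> R" using R1(1) by (simp add: R_def)
  have clip: "clip R p t = p t" "clip R q t = q t" if "t \<in> {0..T}" for t
    using R1(2)[OF that] R2(2)[OF that] by (auto simp: R_def clip_def)
  obtain L where L: "\<And>u v m t. continuous_on {0..T} u \<Longrightarrow> continuous_on {0..T} v \<Longrightarrow> 0 \<le> m \<Longrightarrow>
      (\<And>s. s \<in> {0..T} \<Longrightarrow> \<bar>u s - v s\<bar> \<le> m * exp (L * s)) \<Longrightarrow> t \<in> {0..T} \<Longrightarrow>
      \<bar>feedback (clip R u) t - feedback (clip R v) t\<bar> \<le> 1 / 2 * m * exp (L * t)"
    using feedback_contraction[OF R0] by blast
  show ?thesis
  proof (rule weighted_fixpoint_unique[where c = "1 / 2" and L = L and F = "\<lambda>q. feedback (clip R q)"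
        and u = p and v = q and T = T])
    show "p t = feedback (clip R p) t" if "t \<in> {0..T}" for t
      using p(2)[OF that] feedback_cong[OF p(1) clip(1) that] by simp
    show "q t = feedback (clip R q) t" if "t \<in> {0..T}" for t
      using q(2)[OF that] feedback_cong[OF q(1) clip(2) that] by simp
  qed (use L p q t in auto)
qed

text \<open>The x-derivative at x = 0 of the sine series with coefficients
  \<open>mode q k t\<close>.\<close>

definition mode_flux :: "(real \<Rightarrow> real) \<Rightarrow> real \<Rightarrow> real" where
  "mode_flux q t = (\<Sum>k. \<kappa> k * mode q k t)"

lemma flux_conv:
  "continuous_on {0..T} q \<Longrightarrow> uniformly_convergent_on {0..T} (\<lambda>n t. \<Sum>k<n. \<kappa> k * mode q k t)"
  by (intro first_power_conv mode_conv mode_nonneg)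

lemma mode_flux_cont: "continuous_on {0..T} q \<Longrightarrow> continuous_on {0..T} (mode_flux q)"
  unfolding mode_flux_def
  by (rule continuous_on_series[OF flux_conv]) (auto intro!: continuous_intros mode_cont)

text \<open>The dissipative term \<open>\<sigma> * \<kappa>^2\<close> raises the weight
  \<open>\<kappa>\<close> of the flux to \<open>\<kappa>^3\<close>; the cubic convergence of the
  modes is what permits the flux equation to be summed term by term.\<close>

lemma mode_rhs_conv:
  assumes q: "continuous_on {0..T} q"
  shows "uniformly_convergent_on {0..T}
    (\<lambda>n s. \<Sum>k<n. \<bar>\<kappa> k * (F k s - (\<sigma> s * (\<kappa> k)\<^sup>2 + q s) * mode q k s)\<bar>)"
proof -
  obtain R where R: "R > 0" "\<And>t. t \<in> {0..T} \<Longrightarrow> \<bar>q t\<bar> \<le> R"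
    using continuous_on_bounded_real[OF q] by blast
  obtain M where M: "M > 0" "\<And>t. t \<in> {0..T} \<Longrightarrow> \<bar>\<sigma> t\<bar> \<le> M"
    using continuous_on_bounded_real[OF sigma(1)] by blast
  show ?thesis
  proof (rule uniformly_convergent_series_comparison)
    show "uniformly_convergent_on {0..T} (\<lambda>n s. \<Sum>k<n. \<kappa> k * F k s +
        (M * (\<kappa> k ^ 3 * mode q k s) + R * (\<kappa> k * mode q k s)))"
      by (intro uniformly_convergent_series_add uniformly_convergent_series_cmult first_power_conv F_conv F mode_conv
          mode_nonneg q)
    fix k s assume s: "s \<in> {0..T}"
    have "\<bar>\<kappa> k * (F k s - (\<sigma> s * (\<kappa> k)\<^sup>2 + q s) * mode q k s)\<bar> \<le>
        \<bar>\<kappa> k * F k s\<bar> + (\<bar>\<sigma> s * (\<kappa> k ^ 3 * mode q k s)\<bar> + \<bar>q s * (\<kappa> k * mode q k s)\<bar>)"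
      by (simp add: algebra_simps power2_eq_square power3_eq_cube)
    also have "\<dots> \<le> \<kappa> k * F k s + (M * (\<kappa> k ^ 3 * mode q k s) + R * (\<kappa> k * mode q k s))"
      using M(2)[OF s] R(2)[OF s] F(2)[OF s, of k] mode_nonneg[OF q s, of k] kappa_pos[of k]
      by (auto simp: abs_mult intro!: add_mono mult_right_mono)
    finally show "\<bar>\<bar>\<kappa> k * (F k s - (\<sigma> s * (\<kappa> k)\<^sup>2 + q s) * mode q k s)\<bar>\<bar> \<le>
        \<kappa> k * F k s + (M * (\<kappa> k ^ 3 * mode q k s) + R * (\<kappa> k * mode q k s))" by simp
  qed
qed

lemma mode_flux_eq:
  assumes q: "continuous_on {0..T} q" and t: "t \<in> {0..T}"
  shows "mode_flux q t = \<psi> 0 + frac_int \<rho> (\<lambda>s. (\<Sum>k. \<kappa> k * F k s) - \<sigma> s * mode_sum q s - q s * mode_flux q s) t"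
proof -
  define g where "g = (\<lambda>k s. \<kappa> k * (F k s - (\<sigma> s * (\<kappa> k)\<^sup>2 + q s) * mode q k s))"
  have g_cont: "continuous_on {0..T} (g k)" for k
    unfolding g_def by (intro continuous_intros mode_rhs_cont q)
  have conv: "uniformly_convergent_on {0..T} (\<lambda>n s. \<Sum>k<n. g k s)"
    by (rule uniformly_convergent_series_comparison[OF mode_rhs_conv[OF q]]) (simp add: g_def)
  have "(\<lambda>k. \<kappa> k * B k) sums \<psi> 0"
  proof -
    have "summable (\<lambda>k. \<kappa> k * B k)"
    proof (rule summable_comparison_test'[OF summable_mult[OF B(2), of "1 / (\<kappa> 0)\<^sup>2"], of 0])
      fix k
      show "norm (\<kappa> k * B k) \<le> 1 / (\<kappa> 0)\<^sup>2 * (\<kappa> k ^ 3 * B k)"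
        using mult_right_mono[OF kappa_le_cube[of k] B(1)[of k]] kappa_pos[of k] B(1)[of k]
        by (simp add: abs_mult mult_ac)
    qed
    thus ?thesis unfolding psi_0 by (rule summable_sums)
  qed
  from sums_add[OF this frac_int_series[OF rho(1) g_cont conv t]]
  have "(\<lambda>k. \<kappa> k * B k + frac_int \<rho> (g k) t) sums (\<psi> 0 + frac_int \<rho> (\<lambda>s. \<Sum>k. g k s) t)" .
  moreover have "\<kappa> k * B k + frac_int \<rho> (g k) t = \<kappa> k * mode q k t" for k
    unfolding g_def frac_int_cmult by (subst mode_eq[OF q t]) (simp add: distrib_left)
  ultimately have "mode_flux q t = \<psi> 0 + frac_int \<rho> (\<lambda>s. \<Sum>k. g k s) t"
    by (simp add: mode_flux_def sums_iff)
  also have "frac_int \<rho> (\<lambda>s. \<Sum>k. g k s) t =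
      frac_int \<rho> (\<lambda>s. (\<Sum>k. \<kappa> k * F k s) - \<sigma> s * mode_sum q s - q s * mode_flux q s) t"
  proof (rule frac_int_cong[OF rho(1) t])
    fix s assume "s \<in> {0..t}"
    hence s: "s \<in> {0..T}" using t by auto
    have "(\<lambda>k. \<kappa> k * F k s - \<sigma> s * (\<kappa> k ^ 3 * mode q k s) - q s * (\<kappa> k * mode q k s)) sums
        ((\<Sum>k. \<kappa> k * F k s) - \<sigma> s * mode_sum q s - q s * mode_flux q s)"
      unfolding mode_sum_def mode_flux_def
      by (intro sums_diff sums_mult summable_sums mode_summable q s
            uniformly_convergent_series_limit(2)[OF flux_conv[OF q]]
            uniformly_convergent_series_limit(2)[OF first_power_conv[OF F_conv F(2)]])
    moreover have "g k s = \<kappa> k * F k s - \<sigma> s * (\<kappa> k ^ 3 * mode q k s) - q s * (\<kappa> k * mode q k s)" for k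
      by (simp add: g_def algebra_simps power2_eq_square power3_eq_cube)
    ultimately show "(\<Sum>k. g k s) = (\<Sum>k. \<kappa> k * F k s) - \<sigma> s * mode_sum q s - q s * mode_flux q s"
      by (simp add: sums_iff)
  qed
  finally show ?thesis .
qed

text \<open>Holds for every q, fixed point or not: \<open>\<psi>\<close> satisfies the flux equation
  with \<open>feedback q\<close> in place of q.\<close>

lemma Dpsi_eq:
  "t \<in> {0..T} \<Longrightarrow> D\<psi> t = (\<Sum>k. \<kappa> k * F k t) - \<sigma> t * mode_sum q t - feedback q t * \<psi> t"
  using psi(2)[of t] by (simp add: feedback_def q\<^sub>0_def field_simps)

text \<open>\<open>\<psi> - mode_flux q\<close> starts at 0 and solves the linear equation with
  coefficient q and source \<open>(q - feedback q) * \<psi>\<close>, which is nonnegative; the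
  comparison principle applies. An inequality for q suffices, so the lemma is available for the
  truncated function.\<close>

lemma flux_le_psi:
  assumes q: "continuous_on {0..T} q" and le: "\<And>t. t \<in> {0..T} \<Longrightarrow> feedback q t \<le> q t" and t: "t \<in> {0..T}"
  shows "mode_flux q t \<le> \<psi> t"
proof -
  have "0 \<le> \<psi> t - mode_flux q t"
  proof (rule fractional_comparison[OF rho q _ _ _ order.refl _ t])
    show "continuous_on {0..T} (\<lambda>t. (q t - feedback q t) * \<psi> t)"
      by (intro continuous_intros q feedback_cont psi)
    show "continuous_on {0..T} (\<lambda>t. \<psi> t - mode_flux q t)"
      by (intro continuous_intros psi mode_flux_cont q)
    fix t assume t: "t \<in> {0..T}"
    show "0 \<le> (q t - feedback q t) * \<psi> t"
      using le[OF t] psi(2)[OF t] by (intro mult_nonneg_nonneg) auto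
    let ?h = "\<lambda>s. (\<Sum>k. \<kappa> k * F k s) - \<sigma> s * mode_sum q s - q s * mode_flux q s"
    have "\<psi> t - mode_flux q t = frac_int \<rho> D\<psi> t - frac_int \<rho> ?h t"
      using Dpsi(2)[OF t] mode_flux_eq[OF q t] by simp
    also have "\<dots> = frac_int \<rho> (\<lambda>s. D\<psi> s - ?h s) t"
      by (rule frac_int_diff[OF rho(1) Dpsi(1) _ t, symmetric])
         (intro continuous_intros source_flux_cont sigma mode_sum_cont mode_flux_cont q)
    also have "\<dots> = frac_int \<rho> (\<lambda>s. (q s - feedback q s) * \<psi> s - q s * (\<psi> s - mode_flux q s)) t"
      by (rule frac_int_cong[OF rho(1) t]) (use t Dpsi_eq[of _ q] in \<open>auto simp: algebra_simps\<close>)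
    finally show "\<psi> t - mode_flux q t =
        0 + frac_int \<rho> (\<lambda>s. (q s - feedback q s) * \<psi> s - q s * (\<psi> s - mode_flux q s)) t" by simp
  qed
  thus ?thesis by simp
qed

text \<open>At a fixed point \<open>\<psi>\<close> and the flux solve the same linear equation with
  the same initial value.\<close>

lemma flux_eq_psi:
  assumes q: "continuous_on {0..T} q" and fix_q: "\<And>t. t \<in> {0..T} \<Longrightarrow> q t = feedback q t" and t: "t \<in> {0..T}"
  shows "mode_flux q t = \<psi> t"
proof (rule fractional_linear_equation_unique[OF rho q _ mode_flux_cont[OF q] _ psi(1) _ t])
  let ?g = "\<lambda>s. (\<Sum>k. \<kappa> k * F k s) - \<sigma> s * mode_sum q s"
  show "continuous_on {0..T} ?g"
    by (intro continuous_intros source_flux_cont sigma mode_sum_cont q)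
  fix t assume t: "t \<in> {0..T}"
  show "mode_flux q t = \<psi> 0 + frac_int \<rho> (\<lambda>s. ?g s - q s * mode_flux q s) t"
    by (rule mode_flux_eq[OF q t])
  show "\<psi> t = \<psi> 0 + frac_int \<rho> (\<lambda>s. ?g s - q s * \<psi> s) t"
    by (subst Dpsi(2)[OF t], intro arg_cong2[where f = "(+)"] refl frac_int_cong[OF rho(1) t])
       (use t Dpsi_eq[of _ q] fix_q in auto)
qed

text \<open>The quadratic term \<open>\<sigma> / \<psi> * (mode_sum q)\<^sup>2\<close> created by the feedback is absorbed by the
  dissipation: by the Cauchy--Schwarz inequality \<open>(\<Sum>\<kappa>\<^sup>3 c)\<^sup>2 \<le> (\<Sum>\<kappa> c) (\<Sum>\<kappa>\<^sup>5 c)\<close>, and the first factor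
  is at most \<open>\<psi>\<close>.  Hence the bound on the mode sum does not involve q.\<close>

lemma mode_sum_a_priori:
  obtains K where "0 < K" "\<And>q t. continuous_on {0..T} q \<Longrightarrow> (\<And>t. t \<in> {0..T} \<Longrightarrow> feedback q t \<le> q t) \<Longrightarrow>
     t \<in> {0..T} \<Longrightarrow> mode_sum q t \<le> K"
proof -
  obtain b where b: "0 < b" "\<And>n t. t \<in> {0..T} \<Longrightarrow> (\<Sum>k<n. \<kappa> k ^ 3 * F k t) \<le> b"
    using F_sum_bound by blast
  obtain C where C: "C > 0" "\<And>t. t \<in> {0..T} \<Longrightarrow> \<bar>\<sigma> t / \<psi> t\<bar> \<le> C"
    using ratio_bound by blast
  \<comment> \<open>Fractional integral of the constant \<open>b + 1\<close>, added to the initial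
    sum; the 1 pays for replacing the series by a partial sum.\<close>
  define K where "K = (\<Sum>k. \<kappa> k ^ 3 * B k) + (b + 1) * T powr \<rho> / Gamma (\<rho> + 1)"
  have B0: "0 \<le> \<kappa> k ^ 3 * B k" for k
    by (intro mult_nonneg_nonneg B less_imp_le[OF zero_less_power] kappa_pos)
  have G: "Gamma (\<rho> + 1) > 0" using rho by (intro Gamma_real_pos) auto
  have K: "K > 0" unfolding K_def
    using b T G by (intro add_nonneg_pos suminf_nonneg B(2) B0 divide_pos_pos mult_pos_pos) auto
  have "mode_sum q t \<le> K"
    if q: "continuous_on {0..T} q" and le: "\<And>t. t \<in> {0..T} \<Longrightarrow> feedback q t \<le> q t" and t: "t \<in> {0..T}" for q t
  proof -
    let ?S = "\<lambda>n t. \<Sum>k<n. \<kappa> k ^ 3 * mode q k t"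
    obtain H where H: "H > 0" "\<And>t. t \<in> {0..T} \<Longrightarrow> \<bar>mode_sum q t\<bar> \<le> H"
      using continuous_on_bounded_real[OF mode_sum_cont[OF q]] by blast
    have S0: "0 \<le> ?S n t" if "t \<in> {0..T}" for n t
      by (intro sum_nonneg mult_nonneg_nonneg mode_nonneg q that less_imp_le[OF zero_less_power] kappa_pos)
    have "\<forall>\<^sub>F n in sequentially. \<forall>t\<in>{0..T}. dist (?S n t) (mode_sum q t) < 1 / (C * H)"
      using uniform_limitD[OF uniformly_convergent_series_limit(1)[OF mode_conv[OF q]], of "1 / (C * H)"] C H
      by (simp add: mode_sum_def)
    hence "\<forall>\<^sub>F n in sequentially. ?S n t \<le> K"
    proof eventually_elim
      case (elim n)
      define h where "h = (\<lambda>s. \<Sum>k<n. \<kappa> k ^ 3 * (F k s - (\<sigma> s * (\<kappa> k)\<^sup>2 + q s) * mode q k s))"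
      have h: "h s \<le> b + 1" if s: "s \<in> {0..T}" for s
      proof -
        let ?S5 = "\<Sum>k<n. \<kappa> k ^ 5 * mode q k s"
        have S5: "0 \<le> ?S5"
          by (intro sum_nonneg mult_nonneg_nonneg mode_nonneg q s less_imp_le[OF zero_less_power] kappa_pos)
        \<comment> \<open>Cauchy-Schwarz in the splitting of the weight 3 as the mean of 1 and 5;
          nonnegativity of the modes allows the square roots.\<close>
        have "(?S n s)\<^sup>2 = (\<Sum>k<n. sqrt (\<kappa> k * mode q k s) * sqrt (\<kappa> k ^ 5 * mode q k s))\<^sup>2"
        proof (intro arg_cong[where f = "\<lambda>x. x\<^sup>2"] sum.cong refl)
          fix k
          have "sqrt (\<kappa> k * mode q k s) * sqrt (\<kappa> k ^ 5 * mode q k s) = sqrt ((\<kappa> k ^ 3 * mode q k s)\<^sup>2)"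
            unfolding real_sqrt_mult[symmetric] by (intro arg_cong[where f = sqrt]) (simp add: power_mult_distrib power_add[of _ 1 5, simplified] power2_eq_square[of "mode q k s"] flip: power_mult)
          thus "\<kappa> k ^ 3 * mode q k s = sqrt (\<kappa> k * mode q k s) * sqrt (\<kappa> k ^ 5 * mode q k s)"
            using mode_nonneg[OF q s, of k] kappa_pos[of k] by simp
        qed
        also have "\<dots> \<le> (\<Sum>k<n. (sqrt (\<kappa> k * mode q k s))\<^sup>2) * (\<Sum>k<n. (sqrt (\<kappa> k ^ 5 * mode q k s))\<^sup>2)"
          by (rule Cauchy_Schwarz_ineq_sum)
        also have "\<dots> = (\<Sum>k<n. \<kappa> k * mode q k s) * ?S5"
          using mode_nonneg[OF q s] kappa_pos by (simp add: less_imp_le)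
        also have "\<dots> \<le> \<psi> s * ?S5"
        proof (rule mult_right_mono[OF _ S5])
          have "(\<Sum>k<n. \<kappa> k * mode q k s) \<le> mode_flux q s"
            unfolding mode_flux_def
            by (intro sum_le_suminf uniformly_convergent_series_limit(2)[OF flux_conv[OF q] s])
               (auto intro!: mult_nonneg_nonneg mode_nonneg q s less_imp_le[OF kappa_pos])
          also have "\<dots> \<le> \<psi> s" by (rule flux_le_psi[OF q le s])
          finally show "(\<Sum>k<n. \<kappa> k * mode q k s) \<le> \<psi> s" .
        qed
        finally have CS: "(?S n s)\<^sup>2 / \<psi> s \<le> ?S5" using psi(2)[OF s] by (simp add: field_simps)
        have "0 \<le> q\<^sub>0 s" using q0_nonneg[OF s] psi(2)[OF s] by (simp add: q\<^sub>0_def)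
        hence qle: "- (\<sigma> s / \<psi> s * mode_sum q s) \<le> q s"
          using le[OF s] by (simp add: feedback_def)
        have "h s = (\<Sum>k<n. \<kappa> k ^ 3 * F k s) - \<sigma> s * ?S5 - q s * ?S n s"
        proof -
          have "\<kappa> k ^ 3 * (F k s - (\<sigma> s * (\<kappa> k)\<^sup>2 + q s) * mode q k s) =
              \<kappa> k ^ 3 * F k s - \<sigma> s * (\<kappa> k ^ 5 * mode q k s) - q s * (\<kappa> k ^ 3 * mode q k s)" for k
            by (simp add: algebra_simps power_add[of _ 2 3, simplified])
          thus ?thesis unfolding h_def by (simp add: sum_subtractf sum_distrib_left)
        qed
        also have "\<dots> \<le> b - \<sigma> s * ((?S n s)\<^sup>2 / \<psi> s) - - (\<sigma> s / \<psi> s * mode_sum q s) * ?S n s"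
          using b(2)[OF s] sigma(2)[OF s] CS qle S0[OF s]
          by (intro diff_mono mult_left_mono mult_right_mono) auto
        also have "\<dots> = b + (\<sigma> s / \<psi> s) * (?S n s * (mode_sum q s - ?S n s))"
          by (simp add: power2_eq_square right_diff_distrib mult_ac)
        also have "(\<sigma> s / \<psi> s) * (?S n s * (mode_sum q s - ?S n s)) \<le> C * (H * (1 / (C * H)))"
        proof (intro mult_mono)
          show "\<sigma> s / \<psi> s \<le> C" by (rule abs_le_D1[OF C(2)[OF s]])
          show "?S n s \<le> H" using mode_partial_sum_le[OF q s, of n] H(2)[OF s] by simp
          show "mode_sum q s - ?S n s \<le> 1 / (C * H)"
            using bspec[OF elim s] by (simp add: dist_real_def abs_less_iff)
          show "0 \<le> mode_sum q s - ?S n s" using mode_partial_sum_le[OF q s, of n] by simp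
        qed (use C H S0[OF s, of n] mode_partial_sum_le[OF q s, of n] in auto)
        also have "C * (H * (1 / (C * H))) = 1" using C H by simp
        finally show ?thesis by simp
      qed
      have h_cont: "continuous_on {0..T} h"
        unfolding h_def by (intro continuous_intros mode_rhs_cont q)
      have "?S n t = (\<Sum>k<n. \<kappa> k ^ 3 * B k + frac_int \<rho> (\<lambda>s. \<kappa> k ^ 3 * (F k s - (\<sigma> s * (\<kappa> k)\<^sup>2 + q s) * mode q k s)) t)"
        unfolding frac_int_cmult by (subst mode_eq[OF q t]) (simp add: distrib_left)
      also have "\<dots> = (\<Sum>k<n. \<kappa> k ^ 3 * B k) + frac_int \<rho> h t"
        unfolding h_def sum.distrib
        by (subst frac_int_sum[OF rho(1) _ t]) (auto intro!: continuous_intros mode_rhs_cont q)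
      also have "frac_int \<rho> h t \<le> frac_int \<rho> (\<lambda>_. b + 1) t"
        using t h by (intro frac_int_mono[OF rho(1) h_cont _ t] continuous_intros) auto
      also have "\<dots> \<le> (b + 1) * T powr \<rho> / Gamma (\<rho> + 1)"
        unfolding frac_int_const[OF rho(1)] using t b G rho
        by (intro divide_right_mono mult_left_mono powr_mono2) auto
      also have "(\<Sum>k<n. \<kappa> k ^ 3 * B k) \<le> (\<Sum>k. \<kappa> k ^ 3 * B k)"
        by (intro sum_le_suminf B(2)) (auto intro: B0)
      finally show ?case by (simp add: K_def)
    qed
    moreover have "(\<lambda>n. ?S n t) \<longlonglongrightarrow> mode_sum q t"
      unfolding mode_sum_def by (intro summable_LIMSEQ mode_summable q t)
    ultimately show ?thesis
      by (intro tendsto_upperbound[where F = sequentially]) auto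
  qed
  thus ?thesis using that[OF K] by blast
qed

theorem feedback_fixpoint_exists:
  obtains q where "continuous_on {0..T} q" "\<And>t. t \<in> {0..T} \<Longrightarrow> q t = feedback q t"
proof -
  obtain K where K: "0 < K" "\<And>q t. continuous_on {0..T} q \<Longrightarrow> (\<And>t. t \<in> {0..T} \<Longrightarrow> feedback q t \<le> q t) \<Longrightarrow>
     t \<in> {0..T} \<Longrightarrow> mode_sum q t \<le> K"
    using mode_sum_a_priori by blast
  obtain C where C: "C > 0" "\<And>t. t \<in> {0..T} \<Longrightarrow> \<bar>\<sigma> t / \<psi> t\<bar> \<le> C"
    using ratio_bound by blast
  obtain Q where Q: "Q > 0" "\<And>t. t \<in> {0..T} \<Longrightarrow> \<bar>q\<^sub>0 t\<bar> \<le> Q"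
    using continuous_on_bounded_real[OF q0_cont] by blast
  \<comment> \<open>\<open>Q\<close> keeps the upper cut inactive, and \<open>C * K\<close> is the a
    priori bound for the amount by which the feedback can fall below
    \<open>q\<^sub>0\<close>.\<close>
  define R where "R = max Q (C * K)"
  have R: "0 \<le> R" using Q by (simp add: R_def)
  obtain q where q: "continuous_on {0..T} q" "\<And>t. t \<in> {0..T} \<Longrightarrow> q t = feedback (clip R q) t"
    using clipped_fixpoint_exists[OF R] by blast
  note c = clip_cont[OF q(1), of R]
  have ratio: "0 \<le> \<sigma> t / \<psi> t" if "t \<in> {0..T}" for t
    using sigma(2)[OF that] psi(2)[OF that] by simp
  have q0_nonneg': "0 \<le> q\<^sub>0 t" if "t \<in> {0..T}" for t
    using q0_nonneg[OF that] psi(2)[OF that] by (simp add: q\<^sub>0_def)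
  have S_nonneg: "0 \<le> mode_sum (clip R q) t" if "t \<in> {0..T}" for t
    using mode_partial_sum_le[OF c that, of 0] by simp
  have q_le: "q t \<le> R" if t: "t \<in> {0..T}" for t
  proof -
    have "q t \<le> q\<^sub>0 t"
      unfolding q(2)[OF t] feedback_def using mult_nonneg_nonneg[OF ratio[OF t] S_nonneg[OF t]] by simp
    also have "\<dots> \<le> R" using Q(2)[OF t] unfolding R_def by linarith
    finally show ?thesis .
  qed
  \<comment> \<open>The upper cut being inactive, truncation can only raise q; this is the condition
    under which the a priori bound was proved.\<close>
  have "feedback (clip R q) t \<le> clip R q t" if t: "t \<in> {0..T}" for t
    unfolding q(2)[OF t, symmetric] using q_le[OF t] by (simp add: clip_def)
  from K(2)[OF c this] have S_le: "mode_sum (clip R q) t \<le> K" if "t \<in> {0..T}" for t using that by blast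
  have clip: "clip R q t = q t" if t: "t \<in> {0..T}" for t
  proof -
    have "\<sigma> t / \<psi> t * mode_sum (clip R q) t \<le> C * K"
      using abs_le_D1[OF C(2)[OF t]] S_le[OF t] S_nonneg[OF t] C(1) by (intro mult_mono) auto
    hence "- R \<le> q t"
      unfolding q(2)[OF t] feedback_def using q0_nonneg'[OF t] by (simp add: R_def)
    thus ?thesis using q_le[OF t] by (simp add: clip_def)
  qed
  show ?thesis
  proof (rule that[OF q(1)])
    fix t assume t: "t \<in> {0..T}"
    show "q t = feedback q t"
      using q(2)[OF t] feedback_cong[OF q(1) clip t] by simp
  qed
qed

end

section \<open>Test functions and the lemma of du Bois-Reymond\<close>

definition smooth :: "(real \<Rightarrow> real) \<Rightarrow> bool" where
  "smooth h \<longleftrightarrow> (\<forall>k x. ((deriv ^^ k) h) differentiable (at x))"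

section \<open>Smooth functions and bump functions\<close>

lemma test_function_iff:
  "test_function l \<zeta> \<longleftrightarrow> smooth \<zeta> \<and> (\<exists>a b. 0 < a \<and> b < l \<and> (\<forall>x. x \<notin> {a..b} \<longrightarrow> \<zeta> x = 0))"
  by (simp add: test_function_def smooth_def)

lemma smooth_coinduct:
  assumes "h \<in> S" "\<And>g x. g \<in> S \<Longrightarrow> g differentiable (at x)" "\<And>g. g \<in> S \<Longrightarrow> deriv g \<in> S"
  shows "smooth h"
proof -
  have "(deriv ^^ k) h \<in> S" for k
    by (induction k) (use assms in auto)
  thus ?thesis using assms(2) by (auto simp: smooth_def)
qed

lemma smooth_deriv: "smooth h \<Longrightarrow> smooth (deriv h)"
  unfolding smooth_def by (metis funpow_Suc_right o_apply)

lemma smooth_has_derivative: "smooth h \<Longrightarrow> (h has_real_derivative deriv h x) (at x)"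
  unfolding smooth_def using DERIV_deriv_iff_real_differentiable by (metis funpow_0)

lemma smooth_continuous: "smooth h \<Longrightarrow> continuous_on A h"
  using smooth_has_derivative by (meson DERIV_continuous continuous_at_imp_continuous_on)

lemma smooth_iff_deriv:
  assumes "\<And>x. (h has_real_derivative d x) (at x)" "smooth d"
  shows "smooth h"
proof -
  have d: "deriv h = d" using assms(1) by (auto simp: fun_eq_iff DERIV_imp_deriv)
  have "(deriv ^^ k) h differentiable at x" for k x
  proof (cases k)
    case 0
    then show ?thesis using assms(1)[of x] by (auto simp: real_differentiable_def)
  next
    case (Suc m)
    then show ?thesis using assms(2) d by (simp add: smooth_def funpow_Suc_right del: funpow.simps)
  qed
  thus ?thesis by (simp add: smooth_def)
qed

lemma deriv_power_linear:
  assumes "smooth f" "smooth g"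
  shows "(deriv ^^ k) (\<lambda>x. f x + c * g x) = (\<lambda>x. (deriv ^^ k) f x + c * (deriv ^^ k) g x)"
proof (induction k)
  case (Suc k)
  have "(deriv ^^ k) h differentiable at x" if "smooth h" for h x using that by (simp add: smooth_def)
  hence *: "((deriv ^^ k) h has_real_derivative deriv ((deriv ^^ k) h) x) (at x)" if "smooth h" for h x
    using that DERIV_deriv_iff_real_differentiable by blast
  show ?case
    unfolding funpow.simps o_apply Suc.IH
    by (rule ext, rule DERIV_imp_deriv) (auto intro!: derivative_eq_intros * assms)
qed simp

lemma smooth_linear:
  assumes "smooth f" "smooth g"
  shows "smooth (\<lambda>x. f x + c * g x)"
  using assms unfolding smooth_def deriv_power_linear[OF assms]
  by (auto intro!: derivative_intros)

text \<open>The flat function \<open>exp (- 1 / x)\<close>, continued by 0, with powers of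
  \<open>inverse x\<close> built in because differentiation produces them: the family is closed
  under derivatives up to linear combinations.\<close>

definition flat_exp :: "nat \<Rightarrow> real \<Rightarrow> real" where
  "flat_exp n x = (if x > 0 then inverse x ^ n * exp (- inverse x) else 0)"

lemma flat_exp_tendsto_0: "((\<lambda>x. flat_exp n x) \<longlongrightarrow> 0) (at 0)"
proof (rule filterlim_split_at)
  show "(flat_exp n \<longlongrightarrow> 0) (at_left 0)"
    by (rule tendsto_eventually) (auto simp: flat_exp_def eventually_at_filter)
  have "((\<lambda>x. inverse x ^ n / exp (inverse x :: real)) \<longlongrightarrow> 0) (at_right 0)"
    by (rule filterlim_compose[OF tendsto_power_div_exp_0 filterlim_inverse_at_top_right])
  thus "(flat_exp n \<longlongrightarrow> 0) (at_right 0)"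
    by (rule Lim_transform_eventually) (auto simp: flat_exp_def eventually_at_filter exp_minus field_simps)
qed

lemma flat_exp_derivative:
  "(flat_exp n has_real_derivative flat_exp (n + 2) x - real n * flat_exp (n + 1) x) (at x)"
proof (cases x "0::real" rule: linorder_cases)
  case less
  have "((\<lambda>x. 0) has_real_derivative 0) (at x)" by simp
  hence "(flat_exp n has_real_derivative 0) (at x)"
    by (rule has_field_derivative_transform_within_open[of _ _ _ "{..<0}"]) (use less in \<open>auto simp: flat_exp_def\<close>)
  thus ?thesis using less by (simp add: flat_exp_def)
next
  case equal
  \<comment> \<open>At 0 the difference quotient of \<open>flat_exp n\<close> is
    \<open>flat_exp (n + 1)\<close>, which tends to 0.\<close>
  have "((\<lambda>h. (flat_exp n (0 + h) - flat_exp n 0) / h) \<longlongrightarrow> 0) (at 0)"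
    by (rule Lim_transform_eventually[OF flat_exp_tendsto_0[of "n + 1"]])
      (auto simp: flat_exp_def eventually_at_filter field_simps)
  thus ?thesis using equal by (simp add: DERIV_def flat_exp_def)
next
  case greater
  have "((\<lambda>x. inverse x ^ n * exp (- inverse x)) has_real_derivative
      flat_exp (n + 2) x - real n * flat_exp (n + 1) x) (at x)"
  proof -
    have 1: "(inverse has_real_derivative - (inverse x)\<^sup>2) (at x)"
      using DERIV_inverse[of x] greater by (simp add: numeral_2_eq_2)
    have 2: "((\<lambda>x. exp (- inverse x)) has_real_derivative exp (- inverse x) * (inverse x)\<^sup>2) (at x)"
      using DERIV_chain'[OF DERIV_minus[OF 1] DERIV_exp] by simp
    from DERIV_mult[OF DERIV_power[OF 1, of n] 2] show ?thesis
    proof (rule DERIV_cong)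
      show "real n * (- (inverse x)\<^sup>2 * inverse x ^ (n - Suc 0)) * exp (- inverse x) +
          exp (- inverse x) * (inverse x)\<^sup>2 * inverse x ^ n =
          flat_exp (n + 2) x - real n * flat_exp (n + 1) x"
        using greater by (cases n) (simp_all add: flat_exp_def power2_eq_square algebra_simps)
    qed
  qed
  thus ?thesis
    by (rule has_field_derivative_transform_within_open[of _ _ _ "{0<..}"]) (use greater in \<open>auto simp: flat_exp_def\<close>)
qed

text \<open>A set of functions that contains the bumps on \<open>{a..b}\<close> and is closed under
  differentiation; this gives smoothness without a formula for the higher derivatives.\<close>

inductive_set flat_products :: "real \<Rightarrow> real \<Rightarrow> (real \<Rightarrow> real) set" for a b where
  base: "(\<lambda>x. c * flat_exp m (x - a) * flat_exp n (b - x)) \<in> flat_products a b"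
| add: "f \<in> flat_products a b \<Longrightarrow> g \<in> flat_products a b \<Longrightarrow> (\<lambda>x. f x + g x) \<in> flat_products a b"

lemma flat_products_derivative:
  assumes "f \<in> flat_products a b"
  obtains f' where "f' \<in> flat_products a b" "\<And>x. (f has_real_derivative f' x) (at x)"
proof -
  have "\<exists>f'\<in>flat_products a b. \<forall>x. (f has_real_derivative f' x) (at x)"
    using assms
  proof induction
    case (base c m n)
    let ?p = "\<lambda>c m n x. c * flat_exp m (x - a) * flat_exp n (b - x)"
    let ?f' = "\<lambda>x. (?p c (m + 2) n x + ?p (- c * real m) (m + 1) n x) +
        (?p (- c) m (n + 2) x + ?p (c * real n) m (n + 1) x)"
    have "?f' \<in> flat_products a b" by (intro flat_products.intros)
    moreover have "(?p c m n has_real_derivative ?f' x) (at x)" for x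
    proof -
      have 1: "((\<lambda>x. flat_exp m (x - a)) has_real_derivative
          flat_exp (m + 2) (x - a) - real m * flat_exp (m + 1) (x - a)) (at x)"
        by (rule DERIV_cong[OF DERIV_chain'[of "\<lambda>x. x - a" 1, OF _ flat_exp_derivative]])
           (auto intro!: derivative_eq_intros)
      have 2: "((\<lambda>x. flat_exp n (b - x)) has_real_derivative
          - (flat_exp (n + 2) (b - x) - real n * flat_exp (n + 1) (b - x))) (at x)"
        by (rule DERIV_cong[OF DERIV_chain'[of "\<lambda>x. b - x" "- 1", OF _ flat_exp_derivative]])
           (auto intro!: derivative_eq_intros)
      from DERIV_mult[OF DERIV_cmult[OF 1, of c] 2] show ?thesis
        by (rule DERIV_cong) (simp add: algebra_simps)
    qed
    ultimately show ?case by (intro bexI[of _ ?f'] allI)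
  next
    case (add f g)
    then obtain f' g' where "f' \<in> flat_products a b" "g' \<in> flat_products a b"
      "\<forall>x. (f has_real_derivative f' x) (at x)" "\<forall>x. (g has_real_derivative g' x) (at x)" by blast
    thus ?case
      by (intro bexI[of _ "\<lambda>x. f' x + g' x"] allI) (auto intro: flat_products.intros DERIV_add)
  qed
  thus ?thesis using that by blast
qed

lemma smooth_flat_products:
  assumes "f \<in> flat_products a b"
  shows "smooth f"
proof (rule smooth_coinduct[OF assms])
  fix g x assume g: "g \<in> flat_products a b"
  obtain g' where g': "g' \<in> flat_products a b" "\<And>x. (g has_real_derivative g' x) (at x)"
    using flat_products_derivative[OF g] by blast
  show "g differentiable at x" using g'(2)[of x] by (auto simp: real_differentiable_def)
  have "deriv g = g'" using g'(2) by (auto simp: fun_eq_iff DERIV_imp_deriv)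
  thus "deriv g \<in> flat_products a b" using g'(1) by simp
qed

text \<open>The factor 1 is kept to match the generator \<open>flat_products.base\<close>.\<close>

definition bump :: "real \<Rightarrow> real \<Rightarrow> real \<Rightarrow> real" where
  "bump a b x = 1 * flat_exp 0 (x - a) * flat_exp 0 (b - x)"

lemma smooth_bump: "smooth (bump a b)"
  unfolding bump_def by (rule smooth_flat_products[of _ a b], rule flat_products.base)

lemma bump_nonneg: "0 \<le> bump a b x"
  and bump_pos: "a < x \<Longrightarrow> x < b \<Longrightarrow> 0 < bump a b x"
  and bump_outside: "x \<notin> {a<..<b} \<Longrightarrow> bump a b x = 0"
  by (auto simp: bump_def flat_exp_def)

lemma test_function_bump:
  assumes "0 < a" "b < l"
  shows "test_function l (bump a b)"
  unfolding test_function_iff using assms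
  by (intro conjI smooth_bump exI[of _ a] exI[of _ b]) (auto intro!: bump_outside)

lemma test_function_smooth: "test_function l \<zeta> \<Longrightarrow> smooth \<zeta>"
  by (simp add: test_function_iff)

lemma test_function_linear:
  assumes "test_function l f" "test_function l g"
  shows "test_function l (\<lambda>x. f x + c * g x)"
proof -
  obtain a b where f: "0 < a" "b < l" "\<And>x. x \<notin> {a..b} \<Longrightarrow> f x = 0"
    using assms(1) unfolding test_function_iff by blast
  obtain a' b' where g: "0 < a'" "b' < l" "\<And>x. x \<notin> {a'..b'} \<Longrightarrow> g x = 0"
    using assms(2) unfolding test_function_iff by blast
  have "f x + c * g x = 0" if "x \<notin> {min a a'..max b b'}" for x
    using f(3)[of x] g(3)[of x] that by force
  moreover have "0 < min a a'" "max b b' < l" using f g by auto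
  ultimately show ?thesis
    using smooth_linear[of f g c] assms unfolding test_function_iff by blast
qed

lemma test_function_boundary:
  assumes "test_function l \<zeta>" shows "\<zeta> 0 = 0" "\<zeta> l = 0"
  using assms unfolding test_function_iff by force+

lemma test_function_deriv:
  assumes "test_function l \<zeta>"
  shows "test_function l (deriv \<zeta>)"
proof -
  obtain a b where z: "0 < a" "b < l" "\<And>x. x \<notin> {a..b} \<Longrightarrow> \<zeta> x = 0"
    using assms unfolding test_function_iff by blast
  have "deriv \<zeta> x = 0" if "x \<notin> {a..b}" for x
  proof (rule DERIV_imp_deriv)
    have "((\<lambda>x. 0) has_real_derivative 0) (at x)" by simp
    thus "(\<zeta> has_real_derivative 0) (at x)"
      by (rule has_field_derivative_transform_within_open[of _ _ _ "- {a..b}"]) (use that z in auto)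
  qed
  thus ?thesis using z smooth_deriv[OF test_function_smooth[OF assms]] unfolding test_function_iff by blast
qed

lemma test_function_deriv_power: "test_function l \<zeta> \<Longrightarrow> test_function l ((deriv ^^ j) \<zeta>)"
  by (induction j) (auto intro: test_function_deriv)

text \<open>The primitive from 0 vanishes to the left of the support, and to the right of it because
  the total integral is 0; so its support is again compact in the open interval.\<close>

lemma test_function_antiderivative:
  assumes z: "test_function l \<zeta>" and l: "0 < l" and int: "integral {0..l} \<zeta> = 0"
  obtains \<theta> where "test_function l \<theta>" "deriv \<theta> = \<zeta>"
proof -
  obtain a b where ab: "0 < a" "b < l" "\<And>x. x \<notin> {a..b} \<Longrightarrow> \<zeta> x = 0"
    using z unfolding test_function_iff by blast
  have cont: "continuous_on A \<zeta>" for A by (rule smooth_continuous[OF test_function_smooth[OF z]])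
  have zero: "integral {c..x} \<zeta> = 0" if "\<And>y. y \<in> {c..x} \<Longrightarrow> \<zeta> y = 0" for c x
    using integral_cong[of "{c..x}" \<zeta> "\<lambda>_. 0"] that by simp
  define \<theta> where "\<theta> = (\<lambda>x. integral {0..x} \<zeta>)"
  have \<theta>_out: "\<theta> x = 0" if "x \<notin> {a..b}" for x
  proof (cases "x < a")
    case True
    thus ?thesis unfolding \<theta>_def by (intro zero ab(3)) auto
  next
    case False
    with that have x: "b < x" "a \<le> x" by auto
    \<comment> \<open>x may lie on either side of l. Both integrals are compared with the one up to
      \<open>max x l\<close>, since nothing is added beyond b.\<close>
    have *: "integral {0..x} \<zeta> = integral {0..max x l} \<zeta>"
      using Henstock_Kurzweil_Integration.integral_combine[of 0 x "max x l" \<zeta>] x ab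
        zero[of x "max x l"] integrable_continuous_interval[OF cont] by auto
    have "integral {0..l} \<zeta> = integral {0..max x l} \<zeta>"
      using Henstock_Kurzweil_Integration.integral_combine[of 0 l "max x l" \<zeta>] l ab
        zero[of l "max x l"] integrable_continuous_interval[OF cont] by auto
    thus ?thesis unfolding \<theta>_def * using int by simp
  qed
  have deriv: "(\<theta> has_real_derivative \<zeta> x) (at x)" for x
  proof (cases "x < a")
    case True
    have "((\<lambda>x. 0) has_real_derivative 0) (at x)" by simp
    hence "(\<theta> has_real_derivative 0) (at x)"
      by (rule has_field_derivative_transform_within_open[of _ _ _ "{..<a}"]) (use True \<theta>_out in auto)
    thus ?thesis using True ab(3) by simp
  next
    case False
    hence "(\<theta> has_real_derivative \<zeta> x) (at x within {0..x + 1})"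
      unfolding \<theta>_def using ab by (intro integral_has_real_derivative cont) auto
    thus ?thesis
      using at_within_Icc_at[of 0 x "x + 1"] False ab by simp
  qed
  show ?thesis
  proof
    show "test_function l \<theta>"
      unfolding test_function_iff
      using smooth_iff_deriv[OF deriv test_function_smooth[OF z]] \<theta>_out ab by blast
    show "deriv \<theta> = \<zeta>" using deriv by (auto simp: fun_eq_iff DERIV_imp_deriv)
  qed
qed

lemma test_function_by_parts:
  assumes z: "test_function l \<zeta>" and l: "0 < l" and g: "continuous_on {0..l} g"
    and g': "continuous_on {0..l} g'" "\<And>x. x \<in> {0<..<l} \<Longrightarrow> (g has_real_derivative g' x) (at x)"
  shows "integral {0..l} (\<lambda>x. g x * deriv \<zeta> x) = - integral {0..l} (\<lambda>x. g' x * \<zeta> x)"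
proof -
  have c: "continuous_on {0..l} \<zeta>" "continuous_on {0..l} (deriv \<zeta>)"
    by (intro smooth_continuous smooth_deriv test_function_smooth[OF z])+
  have "((\<lambda>x. g' x * \<zeta> x) has_integral (- integral {0..l} (\<lambda>x. g x * deriv \<zeta> x))) {0..l}"
  proof (rule integration_by_parts_interior[OF bounded_bilinear_mult, of 0 l g \<zeta> g' "deriv \<zeta>"])
    show "(g has_vector_derivative g' x) (at x)" if "x \<in> {0<..<l}" for x
      using g'(2)[OF that] by (simp add: has_real_derivative_iff_has_vector_derivative)
    show "(\<zeta> has_vector_derivative deriv \<zeta> x) (at x)" for x
      using smooth_has_derivative[OF test_function_smooth[OF z]]
      by (simp add: has_real_derivative_iff_has_vector_derivative)
    have "((\<lambda>x. g x * deriv \<zeta> x) has_integral integral {0..l} (\<lambda>x. g x * deriv \<zeta> x)) {0..l}"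
      by (intro integrable_integral integrable_continuous_interval continuous_intros g c)
    thus "((\<lambda>x. g x * deriv \<zeta> x) has_integral
        g l * \<zeta> l - g 0 * \<zeta> 0 - - integral {0..l} (\<lambda>x. g x * deriv \<zeta> x)) {0..l}"
      using test_function_boundary[OF z] by simp
  qed (use l g c in auto)
  thus ?thesis by (simp add: integral_unique)
qed

lemma integral_add_cmult:
  fixes f g :: "real \<Rightarrow> real"
  assumes "continuous_on {a..b} f" "continuous_on {a..b} g"
  shows "integral {a..b} (\<lambda>x. f x + c * g x) = integral {a..b} f + c * integral {a..b} g"
  using assms
  by (subst Henstock_Kurzweil_Integration.integral_add) (auto intro!: integrable_continuous_interval continuous_intros)

lemma test_function_power_by_parts:
  assumes z: "test_function l \<zeta>" and l: "0 < l"
  shows "integral {0..l} (\<lambda>x. x ^ j * (deriv ^^ j) \<zeta> x) = (- 1) ^ j * fact j * integral {0..l} \<zeta>"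
proof (induction j)
  case (Suc j)
  have "integral {0..l} (\<lambda>x. x ^ Suc j * (deriv ^^ Suc j) \<zeta> x) =
      - integral {0..l} (\<lambda>x. (real (Suc j) * x ^ j) * (deriv ^^ j) \<zeta> x)"
    unfolding funpow.simps o_apply
    by (rule test_function_by_parts[OF test_function_deriv_power[OF z] l])
       (auto intro!: continuous_intros DERIV_cong[OF DERIV_pow] simp del: of_nat_Suc power_Suc)
  also have "\<dots> = - real (Suc j) * integral {0..l} (\<lambda>x. x ^ j * (deriv ^^ j) \<zeta> x)"
    unfolding mult.assoc integral_mult_right by (simp only: mult_minus_left)
  also have "\<dots> = (- 1) ^ Suc j * fact (Suc j) * integral {0..l} \<zeta>"
    unfolding Suc.IH by (simp add: algebra_simps)
  finally show ?case .
qed simp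

text \<open>Near an interior point with nonzero value w has a constant sign, and a bump supported
  there has a nonzero integral against w. The end points follow by continuity.\<close>

lemma continuous_zero_if_weakly_zero:
  assumes l: "0 < l" and w: "continuous_on {0..l} w"
    and zero: "\<And>\<zeta>. test_function l \<zeta> \<Longrightarrow> integral {0..l} (\<lambda>x. w x * \<zeta> x) = 0"
    and x: "x \<in> {0..l}"
  shows "w x = 0"
proof -
  have interior: "w y = 0" if y: "y \<in> {0<..<l}" for y
  proof (rule ccontr)
    assume "w y \<noteq> 0"
    define s where "s = sgn (w y)"
    have s: "s * w y > 0" using \<open>w y \<noteq> 0\<close> by (simp add: s_def sgn_mult_self_eq[symmetric] sgn_if)
    have sw: "continuous_on {0<..<l} (\<lambda>x. s * w x)"
      by (intro continuous_intros continuous_on_subset[OF w]) auto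
    have "open ({0<..<l} \<inter> (\<lambda>x. s * w x) -` {0<..})"
      by (rule continuous_open_preimage[OF sw]) auto
    moreover have "y \<in> {0<..<l} \<inter> (\<lambda>x. s * w x) -` {0<..}" using y s by auto
    ultimately obtain e where e: "e > 0" "cball y e \<subseteq> {0<..<l} \<inter> (\<lambda>x. s * w x) -` {0<..}"
      using open_contains_cball by blast
    define \<zeta> where "\<zeta> = bump (y - e) (y + e)"
    have ends: "y - e \<in> cball y e" "y + e \<in> cball y e" using e(1) by (auto simp: dist_real_def)
    have z: "test_function l \<zeta>"
      unfolding \<zeta>_def using subsetD[OF e(2) ends(1)] subsetD[OF e(2) ends(2)]
      by (intro test_function_bump) auto
    have cont: "continuous_on {0..l} (\<lambda>x. s * w x * \<zeta> x)"
      by (intro continuous_intros w smooth_continuous test_function_smooth[OF z])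
    have nonneg: "0 \<le> s * w x * \<zeta> x" for x
    proof (cases "x \<in> cball y e")
      case True
      hence "0 < s * w x" using e(2) by auto
      thus ?thesis by (simp add: \<zeta>_def bump_nonneg)
    next
      case False
      thus ?thesis using bump_outside[of x "y - e" "y + e"] by (auto simp: \<zeta>_def dist_real_def abs_if split: if_splits)
    qed
    have "integral {0..l} (\<lambda>x. s * w x * \<zeta> x) = 0"
      using zero[OF z] by (simp add: mult.assoc)
    hence "\<forall>x\<in>cbox 0 l. s * w x * \<zeta> x = 0"
      using integral_cbox_eq_0_iff[of 0 l "\<lambda>x. s * w x * \<zeta> x"] cont nonneg l by (simp add: cbox_interval)
    hence "s * w y * \<zeta> y = 0" using y by (auto simp del: mult_eq_0_iff)
    moreover have "\<zeta> y > 0" unfolding \<zeta>_def using e(1) by (intro bump_pos) auto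
    ultimately show False using mult_pos_pos[OF s, of "\<zeta> y"] by linarith
  qed
  have "{0..l} \<subseteq> closure {0<..<l}" using l by simp
  thus ?thesis
    using continuous_constant_on_closure[of "{0<..<l}" w 0 x] w interior x l by simp
qed

text \<open>Induction on the order: subtracting a suitable multiple of \<open>x ^ j\<close> from w reduces the order by one,
  because \<open>\<zeta> - (\<integral>\<zeta>) \<eta>\<close> has an antiderivative with compact support if \<open>\<integral>\<eta> = 1\<close>.\<close>

lemma du_Bois_Reymond:
  assumes l: "0 < l" and w: "continuous_on {0..l} w"
    and zero: "\<And>\<zeta>. test_function l \<zeta> \<Longrightarrow> integral {0..l} (\<lambda>x. w x * (deriv ^^ j) \<zeta> x) = 0"
  shows "\<exists>c. \<forall>x\<in>{0..l}. w x = (\<Sum>i<j. c i * x ^ i)"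
  using w zero
proof (induction j arbitrary: w)
  case 0
  have "w x = 0" if "x \<in> {0..l}" for x
    by (rule continuous_zero_if_weakly_zero[OF l 0(1) _ that]) (use 0(2) in simp)
  then show ?case by simp
next
  case (Suc j)
  define \<eta>\<^sub>0 where "\<eta>\<^sub>0 = bump (l / 3) (2 * l / 3)"
  have \<eta>\<^sub>0: "test_function l \<eta>\<^sub>0" unfolding \<eta>\<^sub>0_def using l by (intro test_function_bump) auto
  have int_ok: "continuous_on {0..l} ((deriv ^^ i) \<zeta>)" if "test_function l \<zeta>" for \<zeta> i
    by (intro smooth_continuous test_function_smooth[OF test_function_deriv_power[OF that]])
  define I where "I = integral {0..l} \<eta>\<^sub>0"
  have "I \<noteq> 0"
  proof
    assume "I = 0"
    hence "\<forall>x\<in>cbox 0 l. \<eta>\<^sub>0 x = 0"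
      using integral_cbox_eq_0_iff[of 0 l \<eta>\<^sub>0] int_ok[OF \<eta>\<^sub>0, of 0] bump_nonneg l
      by (simp add: cbox_interval I_def \<eta>\<^sub>0_def)
    hence "\<eta>\<^sub>0 (l / 2) = 0" using l by (simp add: cbox_interval)
    moreover have "\<eta>\<^sub>0 (l / 2) > 0" unfolding \<eta>\<^sub>0_def using l by (intro bump_pos) auto
    ultimately show False by simp
  qed
  define c where "c = integral {0..l} (\<lambda>x. w x * (deriv ^^ j) \<eta>\<^sub>0 x) / I"
  \<comment> \<open>Chosen by \<open>test_function_power_by_parts\<close>, so that
    \<open>d * x ^ j\<close>, tested with the j-th derivative of \<open>\<zeta>\<close>, yields c
    times the integral of \<open>\<zeta>\<close>, exactly as w does.\<close>
  define d where "d = (- 1) ^ j * c / fact j"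
  have "\<exists>b. \<forall>x\<in>{0..l}. w x - d * x ^ j = (\<Sum>i<j. b i * x ^ i)"
  proof (rule Suc.IH)
    show "continuous_on {0..l} (\<lambda>x. w x - d * x ^ j)" by (intro continuous_intros Suc.prems)
    fix \<zeta> assume z: "test_function l \<zeta>"
    define m where "m = integral {0..l} \<zeta>"
    have "integral {0..l} (\<lambda>x. \<zeta> x + (- m / I) * \<eta>\<^sub>0 x) = 0"
      using int_ok[OF z, of 0] int_ok[OF \<eta>\<^sub>0, of 0] \<open>I \<noteq> 0\<close>
      by (subst integral_add_cmult) (auto simp: m_def simp flip: I_def)
    then obtain \<theta> where \<theta>: "test_function l \<theta>" "deriv \<theta> = (\<lambda>x. \<zeta> x + (- m / I) * \<eta>\<^sub>0 x)"
      using test_function_antiderivative[OF test_function_linear[OF z \<eta>\<^sub>0] l] by blast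
    have "0 = integral {0..l} (\<lambda>x. w x * (deriv ^^ Suc j) \<theta> x)"
      using Suc.prems(2)[OF \<theta>(1)] by simp
    also have "(deriv ^^ Suc j) \<theta> = (\<lambda>x. (deriv ^^ j) \<zeta> x + (- m / I) * (deriv ^^ j) \<eta>\<^sub>0 x)"
      unfolding funpow_Suc_right o_apply \<theta>(2)
      by (rule deriv_power_linear[OF test_function_smooth[OF z] test_function_smooth[OF \<eta>\<^sub>0]])
    also have "(\<lambda>x. w x * ((deriv ^^ j) \<zeta> x + (- m / I) * (deriv ^^ j) \<eta>\<^sub>0 x)) =
        (\<lambda>x. w x * (deriv ^^ j) \<zeta> x + (- m / I) * (w x * (deriv ^^ j) \<eta>\<^sub>0 x))"
      by (simp add: algebra_simps)
    also have "integral {0..l} \<dots> = integral {0..l} (\<lambda>x. w x * (deriv ^^ j) \<zeta> x) +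
        (- m / I) * integral {0..l} (\<lambda>x. w x * (deriv ^^ j) \<eta>\<^sub>0 x)"
      by (intro integral_add_cmult continuous_intros int_ok z \<eta>\<^sub>0 Suc.prems(1))
    finally have 1: "integral {0..l} (\<lambda>x. w x * (deriv ^^ j) \<zeta> x) = m * c"
      using \<open>I \<noteq> 0\<close> by (simp add: c_def)
    have "integral {0..l} (\<lambda>x. (w x - d * x ^ j) * (deriv ^^ j) \<zeta> x) =
        integral {0..l} (\<lambda>x. w x * (deriv ^^ j) \<zeta> x - d * (x ^ j * (deriv ^^ j) \<zeta> x))"
      by (simp add: algebra_simps)
    also have "\<dots> = integral {0..l} (\<lambda>x. w x * (deriv ^^ j) \<zeta> x) -
        integral {0..l} (\<lambda>x. d * (x ^ j * (deriv ^^ j) \<zeta> x))"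
      by (intro Henstock_Kurzweil_Integration.integral_diff integrable_continuous_interval continuous_intros
          int_ok z Suc.prems(1))
    also have "\<dots> = m * c - d * ((- 1) ^ j * fact j * m)"
      unfolding 1 integral_mult_right test_function_power_by_parts[OF z l] m_def ..
    also have "\<dots> = 0" by (simp add: d_def power_mult_distrib[symmetric] flip: power_add mult_2)
    finally show "integral {0..l} (\<lambda>x. (w x - d * x ^ j) * (deriv ^^ j) \<zeta> x) = 0" .
  qed
  then obtain b where b: "\<And>x. x \<in> {0..l} \<Longrightarrow> w x - d * x ^ j = (\<Sum>i<j. b i * x ^ i)" by blast
  have "w x = (\<Sum>i<Suc j. (b(j := d)) i * x ^ i)" if "x \<in> {0..l}" for x
    using b[OF that] by simp
  thus ?case by blast
qed

section \<open>Regularity of Sobolev functions on an interval\<close>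

lemma lebesgue_on_integral_eq:
  fixes f :: "real \<Rightarrow> real"
  assumes "f absolutely_integrable_on {0..l}"
  shows "(\<integral>x. f x \<partial>lebesgue_on {0<..<l}) = integral {0..l} f"
proof -
  have "f absolutely_integrable_on {0<..<l}"
    by (rule set_integrable_subset[OF assms]) auto
  from set_lebesgue_integral_eq_integral(2)[OF this]
  have "(LINT x:{0<..<l}|lebesgue. f x) = integral {0<..<l} f" .
  also have "\<dots> = integral {0..l} f" by (simp add: integral_open_interval_real)
  finally show ?thesis by (simp add: integral_restrict_space set_lebesgue_integral_def)
qed

lemma lebesgue_on_integrable_iff:
  fixes f :: "real \<Rightarrow> real"
  shows "integrable (lebesgue_on {0<..<l}) f \<longleftrightarrow> f absolutely_integrable_on {0..l}"
proof -
  have "integrable (lebesgue_on {0<..<l}) f \<longleftrightarrow> f absolutely_integrable_on {0<..<l}"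
    by (simp add: integrable_restrict_space set_integrable_def)
  also have "\<dots> \<longleftrightarrow> f absolutely_integrable_on {0..l}"
    by (rule absolutely_integrable_spike_set_eq)
      (auto intro: negligible_subset[of "{0, l}"])
  finally show ?thesis .
qed

lemma L2_absolutely_integrable:
  assumes "L2 l v"
  shows "v absolutely_integrable_on {0..l}"
proof -
  have v: "v \<in> borel_measurable (lebesgue_on {0<..<l})" "integrable (lebesgue_on {0<..<l}) (\<lambda>x. (v x)\<^sup>2)"
    using assms by (auto simp: L2_def)
  have "(\<lambda>x. 1 :: real) absolutely_integrable_on {0..l}"
    by (intro absolutely_integrable_continuous_real continuous_intros)
  hence "integrable (lebesgue_on {0<..<l}) (\<lambda>x. 1 :: real)"
    by (simp only: lebesgue_on_integrable_iff)
  hence "integrable (lebesgue_on {0<..<l}) (\<lambda>x. 1 + (v x)\<^sup>2)"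
    using v by (intro Bochner_Integration.integrable_add)
  hence "integrable (lebesgue_on {0<..<l}) v"
  proof (rule Bochner_Integration.integrable_bound)
    have "\<bar>y\<bar> \<le> 1 + y\<^sup>2" for y :: real
    proof -
      have "0 \<le> (\<bar>y\<bar> - 1)\<^sup>2" by simp
      hence "2 * \<bar>y\<bar> \<le> 1 + y\<^sup>2" by (simp add: power2_diff)
      thus ?thesis using abs_ge_zero[of y] by linarith
    qed
    thus "AE x in lebesgue_on {0<..<l}. norm (v x) \<le> norm (1 + (v x)\<^sup>2)" by simp
  qed (use v in auto)
  thus ?thesis by (simp only: lebesgue_on_integrable_iff)
qed

lemma L2_square_absolutely_integrable:
  "L2 l v \<Longrightarrow> (\<lambda>x. (v x)\<^sup>2) absolutely_integrable_on {0..l}"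
  by (simp add: L2_def flip: lebesgue_on_integrable_iff)

lemma absolutely_integrable_continuous_times:
  fixes f v :: "real \<Rightarrow> real"
  assumes v: "v absolutely_integrable_on {0..l}" and f: "continuous_on {0..l} f"
  shows "(\<lambda>x. v x * f x) absolutely_integrable_on {0..l}"
proof -
  have "(\<lambda>x. f x * v x) absolutely_integrable_on {0..l}"
  proof (rule absolutely_integrable_bounded_measurable_product_real[OF _ _ _ v])
    show "f \<in> borel_measurable (lebesgue_on {0..l})"
      by (rule continuous_imp_measurable_on_sets_lebesgue[OF f]) auto
    show "bounded (f ` {0..l})" by (intro compact_imp_bounded compact_continuous_image f) auto
  qed auto
  thus ?thesis by (simp add: mult.commute)
qed

lemma L2_diff:
  assumes "L2 l v" "L2 l w"
  shows "L2 l (\<lambda>x. v x - w x)"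
proof -
  have m: "v \<in> borel_measurable (lebesgue_on {0<..<l})" "w \<in> borel_measurable (lebesgue_on {0<..<l})"
    and i: "integrable (lebesgue_on {0<..<l}) (\<lambda>x. (v x)\<^sup>2)" "integrable (lebesgue_on {0<..<l}) (\<lambda>x. (w x)\<^sup>2)"
    using assms by (auto simp: L2_def)
  have "integrable (lebesgue_on {0<..<l}) (\<lambda>x. (v x - w x)\<^sup>2)"
  proof (rule Bochner_Integration.integrable_bound)
    show "integrable (lebesgue_on {0<..<l}) (\<lambda>x. 2 * (v x)\<^sup>2 + 2 * (w x)\<^sup>2)"
      using i by (intro Bochner_Integration.integrable_add integrable_mult_right)
    have "(a - b)\<^sup>2 \<le> 2 * a\<^sup>2 + 2 * b\<^sup>2" for a b :: real
      using zero_le_power2[of "a + b"] by (simp add: power2_sum power2_diff)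
    thus "AE x in lebesgue_on {0<..<l}. norm ((v x - w x)\<^sup>2) \<le> norm (2 * (v x)\<^sup>2 + 2 * (w x)\<^sup>2)" by simp
  qed (use m in measurable)
  thus ?thesis using m by (auto simp: L2_def)
qed

lemma weak_derivative_L2_iff:
  assumes "L2 l g" "L2 l v"
  shows "weak_derivative l j g v \<longleftrightarrow> (\<forall>\<zeta>. test_function l \<zeta> \<longrightarrow>
    integral {0..l} (\<lambda>x. g x * (deriv ^^ j) \<zeta> x) = (- 1) ^ j * integral {0..l} (\<lambda>x. v x * \<zeta> x))"
proof -
  have "continuous_on {0..l} ((deriv ^^ i) \<zeta>)" if "test_function l \<zeta>" for \<zeta> i
    by (intro smooth_continuous test_function_smooth[OF test_function_deriv_power[OF that]])
  from this this[of _ 0]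
  have "(\<integral>x. g x * (deriv ^^ j) \<zeta> x \<partial>lebesgue_on {0<..<l}) = integral {0..l} (\<lambda>x. g x * (deriv ^^ j) \<zeta> x)"
    "(\<integral>x. v x * \<zeta> x \<partial>lebesgue_on {0<..<l}) = integral {0..l} (\<lambda>x. v x * \<zeta> x)"
    if "test_function l \<zeta>" for \<zeta>
    using that assms
    by (auto intro!: lebesgue_on_integral_eq
        absolutely_integrable_continuous_times[OF L2_absolutely_integrable[OF assms(1)]]
        absolutely_integrable_continuous_times[OF L2_absolutely_integrable[OF assms(2)]])
  thus ?thesis unfolding weak_derivative_def by simp
qed

lemma weak_derivative_diff:
  assumes "L2 l g" "L2 l v" "L2 l h" "L2 l w" "weak_derivative l j g v" "weak_derivative l j h w"
  shows "weak_derivative l j (\<lambda>x. g x - h x) (\<lambda>x. v x - w x)"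
  unfolding weak_derivative_L2_iff[OF L2_diff[OF assms(1,3)] L2_diff[OF assms(2,4)]]
proof safe
  fix \<zeta> assume z: "test_function l \<zeta>"
  have cont: "continuous_on {0..l} ((deriv ^^ i) \<zeta>)" for i
    by (intro smooth_continuous test_function_smooth[OF test_function_deriv_power[OF z]])
  have int: "(\<lambda>x. u x * (deriv ^^ i) \<zeta> x) integrable_on {0..l}" if "L2 l u" for u i
    by (intro set_lebesgue_integral_eq_integral(1) absolutely_integrable_continuous_times
        L2_absolutely_integrable that cont)
  have "integral {0..l} (\<lambda>x. (g x - h x) * (deriv ^^ j) \<zeta> x) =
      integral {0..l} (\<lambda>x. g x * (deriv ^^ j) \<zeta> x) - integral {0..l} (\<lambda>x. h x * (deriv ^^ j) \<zeta> x)"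
    unfolding left_diff_distrib by (intro Henstock_Kurzweil_Integration.integral_diff int assms)
  also have "\<dots> = (- 1) ^ j * (integral {0..l} (\<lambda>x. v x * \<zeta> x) - integral {0..l} (\<lambda>x. w x * \<zeta> x))"
    using assms(5,6) z unfolding weak_derivative_L2_iff[OF assms(1,2)] weak_derivative_L2_iff[OF assms(3,4)]
    by (simp add: right_diff_distrib)
  also have "integral {0..l} (\<lambda>x. v x * \<zeta> x) - integral {0..l} (\<lambda>x. w x * \<zeta> x) =
      integral {0..l} (\<lambda>x. (v x - w x) * \<zeta> x)"
    unfolding left_diff_distrib
    using int[of v 0] int[of w 0] assms by (intro Henstock_Kurzweil_Integration.integral_diff[symmetric]) auto
  finally show "integral {0..l} (\<lambda>x. (g x - h x) * (deriv ^^ j) \<zeta> x) =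
      (- 1) ^ j * integral {0..l} (\<lambda>x. (v x - w x) * \<zeta> x)" .
qed

text \<open>v is merely integrable, so its primitive need not be differentiable everywhere. Fubini
  on the triangle \<open>y \<le> x\<close> replaces the product rule.\<close>

lemma absolutely_continuous_by_parts:
  fixes v d :: "real \<Rightarrow> real"
  assumes l: "0 < l" and v: "v absolutely_integrable_on {0..l}"
    and phi: "\<And>x. x \<in> {0..l} \<Longrightarrow> (\<phi> has_real_derivative d x) (at x within {0..l})"
    and d: "continuous_on {0..l} d"
  shows "integral {0..l} (\<lambda>x. integral {0..x} v * d x) =
    integral {0..l} v * \<phi> l - integral {0..l} (\<lambda>x. v x * \<phi> x)"
proof -
  define v' where "v' = (\<lambda>y. indicator {0..l} y * v y)"
  define d' where "d' = (\<lambda>x. indicator {0..l} x * d x)"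
  define F where "F = (\<lambda>(x, y). if y \<le> x then d' x * v' y else 0)"
  interpret sigma_finite_measure "lebesgue :: real measure"
    by (rule sigma_finite_lebesgue)
  interpret P: pair_sigma_finite "lebesgue :: real measure" "lebesgue :: real measure" ..
  have v'_int: "integrable lebesgue v'" using v by (simp add: set_integrable_def v'_def)
  have d'_int: "integrable lebesgue d'"
    using absolutely_integrable_continuous_real[OF d] by (simp add: set_integrable_def d'_def)
  have [measurable]: "v' \<in> borel_measurable lebesgue" "d' \<in> borel_measurable lebesgue"
    using v'_int d'_int by auto
  have id_meas: "(\<lambda>x::real. x) \<in> borel_measurable lebesgue"
    by (rule measurable_completion) simp
  have [measurable]: "fst \<in> borel_measurable (lebesgue \<Otimes>\<^sub>M lebesgue :: (real \<times> real) measure)"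
    by (rule measurable_compose[OF measurable_fst id_meas])
  have [measurable]: "snd \<in> borel_measurable (lebesgue \<Otimes>\<^sub>M lebesgue :: (real \<times> real) measure)"
    by (rule measurable_compose[OF measurable_snd id_meas])
  have prod_int: "integrable (lebesgue \<Otimes>\<^sub>M lebesgue) (\<lambda>(x, y). d' x * v' y)"
    by (rule P.Fubini_integrable) (use v'_int d'_int in \<open>auto simp: abs_mult\<close>)
  have FI: "integrable (lebesgue \<Otimes>\<^sub>M lebesgue) F"
    by (rule Bochner_Integration.integrable_bound[OF prod_int])
       (auto simp: F_def case_prod_beta intro!: measurable_If)
  hence FI': "integrable (lebesgue \<Otimes>\<^sub>M lebesgue) (case_prod (\<lambda>x y. if y \<le> x then d' x * v' y else 0))"
    by (simp add: F_def)
  have vx: "v absolutely_integrable_on {0..x}" if "x \<le> l" for x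
    by (rule set_integrable_subset[OF v]) (use that in auto)
  have inner_y: "(\<integral>y. (if y \<le> x then d' x * v' y else 0) \<partial>lebesgue) = indicator {0..l} x *\<^sub>R (integral {0..x} v * d x)" for x
  proof (cases "x \<in> {0..l}")
    case True
    have "(\<lambda>y. if y \<le> x then d' x * v' y else 0) = (\<lambda>y. d x * (indicator {0..x} y *\<^sub>R v y))"
      using True by (auto simp: d'_def v'_def indicator_def fun_eq_iff)
    thus ?thesis
      using set_lebesgue_integral_eq_integral(2)[OF vx[of x]] True
      by (simp add: set_lebesgue_integral_def)
  next
    case False
    hence "d' x = 0" by (simp add: d'_def)
    hence "(\<lambda>y. if y \<le> x then d' x * v' y else 0) = (\<lambda>_. 0)" by auto
    thus ?thesis using False by simp
  qed
  have inner_x: "(\<integral>x. (if y \<le> x then d' x * v' y else 0) \<partial>lebesgue) = indicator {0..l} y *\<^sub>R (v y * (\<phi> l - \<phi> y))" for y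
  proof (cases "y \<in> {0..l}")
    case True
    have "(d has_integral \<phi> l - \<phi> y) {y..l}"
    proof (rule fundamental_theorem_of_calculus)
      show "(\<phi> has_vector_derivative d x) (at x within {y..l})" if "x \<in> {y..l}" for x
        using has_field_derivative_subset[OF phi[of x], of "{y..l}"] True that
        by (auto simp: has_real_derivative_iff_has_vector_derivative)
    qed (use True in auto)
    moreover have "d absolutely_integrable_on {y..l}"
      by (intro absolutely_integrable_continuous_real continuous_on_subset[OF d]) (use True in auto)
    ultimately have "(LINT x:{y..l}|lebesgue. d x) = \<phi> l - \<phi> y"
      by (simp add: set_lebesgue_integral_eq_integral(2) integral_unique)
    moreover have "(\<lambda>x. if y \<le> x then d' x * v' y else 0) = (\<lambda>x. v y * (indicator {y..l} x *\<^sub>R d x))"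
      using True by (auto simp: d'_def v'_def indicator_def fun_eq_iff)
    ultimately show ?thesis using True by (simp add: set_lebesgue_integral_def)
  next
    case False
    hence "v' y = 0" by (simp add: v'_def)
    hence "(\<lambda>x. if y \<le> x then d' x * v' y else 0) = (\<lambda>_. 0)" by auto
    thus ?thesis using False by simp
  qed
  have phi_cont: "continuous_on {0..l} \<phi>"
    using phi by (meson DERIV_continuous_on)
  have "(\<lambda>x. integral {0..x} v) absolutely_integrable_on {0..l}"
    by (intro absolutely_integrable_continuous_real indefinite_integral_continuous_1
        set_lebesgue_integral_eq_integral(1) v)
  hence 1: "(\<lambda>x. integral {0..x} v * d x) absolutely_integrable_on {0..l}"
    by (rule absolutely_integrable_continuous_times[OF _ d])
  have 2: "(\<lambda>y. v y * (\<phi> l - \<phi> y)) absolutely_integrable_on {0..l}"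
    by (intro absolutely_integrable_continuous_times v continuous_intros phi_cont)
  have "integral {0..l} (\<lambda>x. integral {0..x} v * d x) = integral {0..l} (\<lambda>y. v y * (\<phi> l - \<phi> y))"
    using P.Fubini_integral[OF FI'] unfolding inner_x inner_y
      set_lebesgue_integral_eq_integral(2)[OF 1, symmetric] set_lebesgue_integral_eq_integral(2)[OF 2, symmetric]
    by (simp add: set_lebesgue_integral_def)
  also have "\<dots> = integral {0..l} (\<lambda>y. \<phi> l * v y) - integral {0..l} (\<lambda>y. v y * \<phi> y)"
    unfolding right_diff_distrib mult.commute[of _ "\<phi> l"]
    by (intro Henstock_Kurzweil_Integration.integral_diff set_lebesgue_integral_eq_integral(1)
        absolutely_integrable_continuous_times v phi_cont set_integrable_mult_right)
  finally show ?thesis by (simp add: mult.commute)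
qed

text \<open>The fourfold primitive \<open>V4\<close> of the weak derivative v has the same weak
  fourth derivative as g, so by du Bois-Reymond the two differ by a cubic polynomial. Thus g
  inherits three classical derivatives up to the boundary, and its third derivative is a primitive
  of v up to a constant.\<close>

lemma W2_4_regularity:
  assumes l: "0 < l" and g: "L2 l g" "continuous_on {0..l} g" and v: "L2 l v" "weak_derivative l 4 g v"
  obtains g1 g2 g3 C where
    "\<And>x. x \<in> {0..l} \<Longrightarrow> (g has_real_derivative g1 x) (at x within {0..l})"
    "\<And>x. x \<in> {0..l} \<Longrightarrow> (g1 has_real_derivative g2 x) (at x within {0..l})"
    "\<And>x. x \<in> {0..l} \<Longrightarrow> (g2 has_real_derivative g3 x) (at x within {0..l})"
    "\<And>x. x \<in> {0..l} \<Longrightarrow> g3 x = C + integral {0..x} v"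
proof -
  have va: "v absolutely_integrable_on {0..l}" by (rule L2_absolutely_integrable[OF v(1)])
  define V1 where "V1 = (\<lambda>x. integral {0..x} v)"
  define V2 where "V2 = (\<lambda>x. integral {0..x} V1)"
  define V3 where "V3 = (\<lambda>x. integral {0..x} V2)"
  define V4 where "V4 = (\<lambda>x. integral {0..x} V3)"
  have V1_cont: "continuous_on {0..l} V1"
    unfolding V1_def by (intro indefinite_integral_continuous_1 set_lebesgue_integral_eq_integral(1) va)
  have deriv: "((\<lambda>x. integral {0..x} V) has_real_derivative V x) (at x within {0..l})"
    if "continuous_on {0..l} V" "x \<in> {0..l}" for V x
    using integral_has_real_derivative[OF that] .
  have deriv_at: "((\<lambda>x. integral {0..x} V) has_real_derivative V x) (at x)"
    if "continuous_on {0..l} V" "x \<in> {0<..<l}" for V x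
    using deriv[OF that(1), of x] that(2) at_within_Icc_at[of 0 x l] by auto
  have cont: "continuous_on {0..l} (\<lambda>x. integral {0..x} V)" if "continuous_on {0..l} V" for V :: "real \<Rightarrow> real"
    by (intro indefinite_integral_continuous_1 integrable_continuous_interval that)
  have V2_cont: "continuous_on {0..l} V2" unfolding V2_def by (rule cont[OF V1_cont])
  have V3_cont: "continuous_on {0..l} V3" unfolding V3_def by (rule cont[OF V2_cont])
  have V4_cont: "continuous_on {0..l} V4" unfolding V4_def by (rule cont[OF V3_cont])
  have "\<exists>c. \<forall>x\<in>{0..l}. g x - V4 x = (\<Sum>i<4. c i * x ^ i)"
  proof (rule du_Bois_Reymond[OF l])
    show "continuous_on {0..l} (\<lambda>x. g x - V4 x)" by (intro continuous_intros g V4_cont)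
    fix \<zeta> assume z: "test_function l \<zeta>"
    have zi: "test_function l ((deriv ^^ i) \<zeta>)" for i by (rule test_function_deriv_power[OF z])
    have zcont: "continuous_on {0..l} ((deriv ^^ i) \<zeta>)" for i
      by (intro smooth_continuous test_function_smooth[OF zi])
    have "integral {0..l} (\<lambda>x. V4 x * (deriv ^^ 4) \<zeta> x) = integral {0..l} (\<lambda>x. V4 x * deriv ((deriv ^^ 3) \<zeta>) x)"
      by (simp add: eval_nat_numeral)
    also have "\<dots> = - integral {0..l} (\<lambda>x. V3 x * (deriv ^^ 3) \<zeta> x)"
      by (rule test_function_by_parts[OF zi l V4_cont V3_cont]) (simp add: V4_def deriv_at V3_cont)
    also have "integral {0..l} (\<lambda>x. V3 x * (deriv ^^ 3) \<zeta> x) = integral {0..l} (\<lambda>x. V3 x * deriv ((deriv ^^ 2) \<zeta>) x)"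
      by (simp add: eval_nat_numeral)
    also have "\<dots> = - integral {0..l} (\<lambda>x. V2 x * (deriv ^^ 2) \<zeta> x)"
      by (rule test_function_by_parts[OF zi l V3_cont V2_cont]) (simp add: V3_def deriv_at V2_cont)
    also have "integral {0..l} (\<lambda>x. V2 x * (deriv ^^ 2) \<zeta> x) = integral {0..l} (\<lambda>x. V2 x * deriv ((deriv ^^ 1) \<zeta>) x)"
      by (simp add: eval_nat_numeral)
    also have "\<dots> = - integral {0..l} (\<lambda>x. V1 x * (deriv ^^ 1) \<zeta> x)"
      by (rule test_function_by_parts[OF zi l V2_cont V1_cont]) (simp add: V2_def deriv_at V1_cont)
    \<comment> \<open>\<open>V1\<close> is only a primitive of an integrable function, so the last
      of the four integrations by parts goes through Fubini.\<close>
    also have "integral {0..l} (\<lambda>x. V1 x * (deriv ^^ 1) \<zeta> x) = - integral {0..l} (\<lambda>x. v x * \<zeta> x)"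
    proof -
      have "integral {0..l} (\<lambda>x. V1 x * deriv \<zeta> x) = integral {0..l} v * \<zeta> l - integral {0..l} (\<lambda>x. v x * \<zeta> x)"
        unfolding V1_def
        by (rule absolutely_continuous_by_parts[OF l va])
           (use zcont[of 1] in \<open>auto intro: has_field_derivative_at_within[OF smooth_has_derivative[OF test_function_smooth[OF z]]]\<close>)
      thus ?thesis using test_function_boundary(2)[OF z] by simp
    qed
    finally have V4: "integral {0..l} (\<lambda>x. V4 x * (deriv ^^ 4) \<zeta> x) = integral {0..l} (\<lambda>x. v x * \<zeta> x)" by simp
    have "integral {0..l} (\<lambda>x. g x * (deriv ^^ 4) \<zeta> x) = integral {0..l} (\<lambda>x. v x * \<zeta> x)"
      using v(2) z unfolding weak_derivative_L2_iff[OF g(1) v(1)] by auto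
    moreover have "integral {0..l} (\<lambda>x. (g x - V4 x) * (deriv ^^ 4) \<zeta> x) =
        integral {0..l} (\<lambda>x. g x * (deriv ^^ 4) \<zeta> x) - integral {0..l} (\<lambda>x. V4 x * (deriv ^^ 4) \<zeta> x)"
      unfolding left_diff_distrib
      by (intro Henstock_Kurzweil_Integration.integral_diff integrable_continuous_interval continuous_intros g V4_cont zcont)
    ultimately show "integral {0..l} (\<lambda>x. (g x - V4 x) * (deriv ^^ 4) \<zeta> x) = 0" using V4 by simp
  qed
  then obtain c where c: "\<And>x. x \<in> {0..l} \<Longrightarrow> g x - V4 x = (\<Sum>i<4. c i * x ^ i)" by blast
  have g_eq: "g x = V4 x + (c 0 + c 1 * x + c 2 * x\<^sup>2 + c 3 * x ^ 3)" if "x \<in> {0..l}" for x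
    using c[OF that] by (simp add: eval_nat_numeral)
  define g1 where "g1 = (\<lambda>x. V3 x + (c 1 + 2 * c 2 * x + 3 * c 3 * x\<^sup>2))"
  define g2 where "g2 = (\<lambda>x. V2 x + (2 * c 2 + 6 * c 3 * x))"
  define g3 where "g3 = (\<lambda>x. V1 x + 6 * c 3)"
  show ?thesis
  proof (rule that[of g1 g2 g3 "6 * c 3"])
    fix x assume x: "x \<in> {0..l}"
    have d4: "(V4 has_real_derivative V3 x) (at x within {0..l})" unfolding V4_def by (rule deriv[OF V3_cont x])
    have d3: "(V3 has_real_derivative V2 x) (at x within {0..l})" unfolding V3_def by (rule deriv[OF V2_cont x])
    have d2: "(V2 has_real_derivative V1 x) (at x within {0..l})" unfolding V2_def by (rule deriv[OF V1_cont x])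
    have "((\<lambda>x. V4 x + (c 0 + c 1 * x + c 2 * x\<^sup>2 + c 3 * x ^ 3)) has_real_derivative g1 x) (at x within {0..l})"
      unfolding g1_def by (rule DERIV_add[OF d4]) (auto intro!: derivative_eq_intros)
    thus "(g has_real_derivative g1 x) (at x within {0..l})"
      by (rule has_field_derivative_transform_within[OF _ zero_less_one x]) (use g_eq in auto)
    show "(g1 has_real_derivative g2 x) (at x within {0..l})"
      unfolding g1_def g2_def by (rule DERIV_add[OF d3]) (auto intro!: derivative_eq_intros)
    show "(g2 has_real_derivative g3 x) (at x within {0..l})"
      unfolding g2_def g3_def by (rule DERIV_add[OF d2]) (auto intro!: derivative_eq_intros)
    show "g3 x = 6 * c 3 + integral {0..x} v" by (simp add: g3_def V1_def)
  qed
qed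

lemma xderiv_Suc_eq:
  assumes l: "0 < l" and eq: "\<And>x. x \<in> {0..l} \<Longrightarrow> xderiv l n g x = h x"
    and deriv: "\<And>x. x \<in> {0..l} \<Longrightarrow> (h has_real_derivative h' x) (at x within {0..l})"
    and x: "x \<in> {0..l}"
  shows "xderiv l (Suc n) g x = h' x"
proof -
  have "(xderiv l n g has_real_derivative h' x) (at x within {0..l})"
    by (rule has_field_derivative_transform_within[OF deriv[OF x] zero_less_one x]) (simp add: eq)
  hence "(xderiv l n g has_vector_derivative h' x) (at x within {0..l})"
    by (simp add: has_real_derivative_iff_has_vector_derivative)
  thus ?thesis
    using vector_derivative_within_closed_interval[of 0 l x "xderiv l n g" "h' x"] l x by simp
qed

section \<open>Sine series\<close>

text \<open>Indices start at 0, so \<open>freq l k\<close> is the frequency \<open>\<lambda>\<close>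
  with number \<open>k + 1\<close>.\<close>

definition freq :: "real \<Rightarrow> nat \<Rightarrow> real" where
  "freq l k = pi * real (Suc k) / l"

text \<open>Normalised with \<open>2 / l\<close>, so that these are the coefficients in front of the
  plain sines; the coefficients for the orthonormal system differ by the positive factor
  \<open>sqrt (2 / l)\<close>, which preserves signs.\<close>

definition fourier_coeff :: "real \<Rightarrow> nat \<Rightarrow> (real \<Rightarrow> real) \<Rightarrow> real" where
  "fourier_coeff l k g = 2 / l * integral {0..l} (\<lambda>x. g x * sin (freq l k * x))"

lemma fourier_coeff_sine_coeff:
  "0 < l \<Longrightarrow> fourier_coeff l k g = sqrt (2 / l) * sine_coeff l (Suc k) g"
  by (simp add: fourier_coeff_def sine_coeff_def freq_def flip: mult.assoc)

lemma freq_pos: "0 < l \<Longrightarrow> 0 < freq l k"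
  by (simp add: freq_def)

lemma freq_mono: "0 < l \<Longrightarrow> freq l 0 \<le> freq l k"
  by (simp add: freq_def divide_right_mono)

lemma freq_boundary:
  assumes "0 < l" shows "sin (freq l k * l) = 0"
  using assms sin_npi2[of "Suc k"] by (simp add: freq_def)

lemma summable_inverse_freq_squares: "0 < l \<Longrightarrow> summable (\<lambda>k. 1 / (freq l k)\<^sup>2)"
proof -
  have "summable (\<lambda>n. inverse (real n ^ 2))" by (rule inverse_power_summable) simp
  hence "summable (\<lambda>n. inverse (real (Suc n) ^ 2))" by (subst summable_Suc_iff)
  hence "summable (\<lambda>n. (l / pi)\<^sup>2 * inverse (real (Suc n) ^ 2))" by (rule summable_mult)
  moreover have "(l / pi)\<^sup>2 * inverse (real (Suc n) ^ 2) = 1 / (freq l n)\<^sup>2" for n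
    by (simp add: freq_def power_divide power_mult_distrib divide_simps del: of_nat_Suc)
  ultimately show ?thesis by (simp only:)
qed

section \<open>Orthogonality and completeness of the sine system\<close>

lemma integral_cos_multiple:
  assumes l: "0 < l"
  shows "integral {0..l} (\<lambda>x. cos (pi * of_int m / l * x)) = (if m = 0 then l else 0)"
proof (cases "m = 0")
  case False
  define a where "a = pi * of_int m / l"
  have a: "a \<noteq> 0" "a * l = pi * of_int m" using False l by (auto simp: a_def)
  have "((\<lambda>x. cos (a * x)) has_integral sin (a * l) / a - sin (a * 0) / a) {0..l}"
  proof (rule fundamental_theorem_of_calculus)
    show "((\<lambda>x. sin (a * x) / a) has_vector_derivative cos (a * x)) (at x within {0..l})" for x
      unfolding has_real_derivative_iff_has_vector_derivative[symmetric]
      using a by (auto intro!: derivative_eq_intros)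
  qed (use l in auto)
  thus ?thesis using False a sin_zero_iff_int2[of "pi * of_int m"]
    by (auto simp: integral_unique mult.commute simp flip: a_def)
qed (use l in simp)

lemma sine_orthogonality:
  assumes l: "0 < l"
  shows "integral {0..l} (\<lambda>x. sin (freq l j * x) * sin (freq l k * x)) = (if j = k then l / 2 else 0)"
proof -
  define m n where "m = int j - int k" and "n = int j + int k + 2"
  have "integral {0..l} (\<lambda>x. sin (freq l j * x) * sin (freq l k * x)) =
      integral {0..l} (\<lambda>x. (cos (pi * of_int m / l * x) - cos (pi * of_int n / l * x)) / 2)"
  proof (intro integral_cong)
    fix x
    have "freq l j * x - freq l k * x = pi * of_int m / l * x" "freq l j * x + freq l k * x = pi * of_int n / l * x"
      using l by (auto simp: freq_def m_def n_def field_simps)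
    thus "sin (freq l j * x) * sin (freq l k * x) = (cos (pi * of_int m / l * x) - cos (pi * of_int n / l * x)) / 2"
      by (simp only: sin_times_sin)
  qed
  also have "\<dots> = (integral {0..l} (\<lambda>x. cos (pi * of_int m / l * x)) - integral {0..l} (\<lambda>x. cos (pi * of_int n / l * x))) / 2"
    by (simp only: integral_divide, subst Henstock_Kurzweil_Integration.integral_diff)
       (use l in \<open>auto intro!: integrable_continuous_interval continuous_intros\<close>)
  also have "\<dots> = (if j = k then l / 2 else 0)"
    unfolding integral_cos_multiple[OF l] by (auto simp: m_def n_def)
  finally show ?thesis .
qed

text \<open>Expansion of the nonnegative integral of \<open>(v - s)^2\<close>, where s is the
  partial sum of the sine series of v.\<close>

lemma Bessel_inequality:
  assumes l: "0 < l" and v: "L2 l v"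
  shows "(\<Sum>k<n. (integral {0..l} (\<lambda>x. v x * sin (freq l k * x)))\<^sup>2) \<le> l / 2 * integral {0..l} (\<lambda>x. (v x)\<^sup>2)"
proof -
  define b where "b = (\<lambda>k. integral {0..l} (\<lambda>x. v x * sin (freq l k * x)))"
  define s where "s = (\<lambda>x. \<Sum>k<n. 2 / l * b k * sin (freq l k * x))"
  have s_cont: "continuous_on {0..l} s" unfolding s_def by (intro continuous_intros)
  note int = set_lebesgue_integral_eq_integral(1)
  have va: "v absolutely_integrable_on {0..l}" by (rule L2_absolutely_integrable[OF v])
  have i1: "(\<lambda>x. (v x)\<^sup>2) integrable_on {0..l}" by (intro int L2_square_absolutely_integrable v)
  have i2: "(\<lambda>x. v x * h x) integrable_on {0..l}" if "continuous_on {0..l} h" for h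
    by (intro int absolutely_integrable_continuous_times va that)
  have vs: "integral {0..l} (\<lambda>x. v x * s x) = 2 / l * (\<Sum>k<n. (b k)\<^sup>2)"
  proof -
    have "integral {0..l} (\<lambda>x. v x * s x) = integral {0..l} (\<lambda>x. \<Sum>k<n. 2 / l * b k * (v x * sin (freq l k * x)))"
      by (simp add: s_def sum_distrib_left mult_ac)
    also have "\<dots> = (\<Sum>k<n. integral {0..l} (\<lambda>x. 2 / l * b k * (v x * sin (freq l k * x))))"
      by (intro Henstock_Kurzweil_Integration.integral_sum integrable_on_mult_right i2 continuous_intros) auto
    also have "\<dots> = 2 / l * (\<Sum>k<n. (b k)\<^sup>2)"
      unfolding integral_mult_right by (simp add: sum_distrib_left b_def power2_eq_square mult_ac)
    finally show ?thesis .
  qed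
  have ss: "integral {0..l} (\<lambda>x. (s x)\<^sup>2) = 2 / l * (\<Sum>k<n. (b k)\<^sup>2)"
  proof -
    have "integral {0..l} (\<lambda>x. (s x)\<^sup>2) = integral {0..l} (\<lambda>x. \<Sum>j<n. \<Sum>k<n.
        2 / l * b j * (2 / l * b k) * (sin (freq l j * x) * sin (freq l k * x)))"
      by (simp add: s_def power2_eq_square sum_product mult_ac)
    also have "\<dots> = (\<Sum>j<n. \<Sum>k<n. integral {0..l} (\<lambda>x.
        2 / l * b j * (2 / l * b k) * (sin (freq l j * x) * sin (freq l k * x))))"
      by (subst Henstock_Kurzweil_Integration.integral_sum;
          (intro sum.cong refl, subst Henstock_Kurzweil_Integration.integral_sum)?)
         (use l in \<open>auto intro!: integrable_continuous_interval continuous_intros\<close>)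
    also have "\<dots> = (\<Sum>j<n. \<Sum>k<n. 2 / l * b j * (2 / l * b k) * (if j = k then l / 2 else 0))"
      unfolding integral_mult_right sine_orthogonality[OF l] ..
    also have "\<dots> = (\<Sum>j<n. 2 / l * b j * (2 / l * b j) * (l / 2))"
      by (intro sum.cong refl) (simp add: if_distrib sum.delta cong: if_cong)
    also have "\<dots> = 2 / l * (\<Sum>k<n. (b k)\<^sup>2)"
      using l by (simp add: sum_distrib_left power2_eq_square)
    finally show ?thesis .
  qed
  have i3: "(\<lambda>x. (v x)\<^sup>2 + (s x)\<^sup>2) integrable_on {0..l}"
    by (intro integrable_add i1 integrable_continuous_interval continuous_intros s_cont)
  have "0 \<le> integral {0..l} (\<lambda>x. (v x)\<^sup>2 + (s x)\<^sup>2 - 2 * (v x * s x))"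
  proof (rule integral_nonneg)
    show "(\<lambda>x. (v x)\<^sup>2 + (s x)\<^sup>2 - 2 * (v x * s x)) integrable_on {0..l}"
      by (intro integrable_diff i3 integrable_on_mult_right i2 s_cont)
    show "0 \<le> (v x)\<^sup>2 + (s x)\<^sup>2 - 2 * (v x * s x)" for x
      using zero_le_power2[of "v x - s x"] by (simp add: power2_diff)
  qed
  also have "\<dots> = integral {0..l} (\<lambda>x. (v x)\<^sup>2 + (s x)\<^sup>2) - integral {0..l} (\<lambda>x. 2 * (v x * s x))"
    by (intro Henstock_Kurzweil_Integration.integral_diff i3 integrable_on_mult_right i2 s_cont)
  also have "integral {0..l} (\<lambda>x. (v x)\<^sup>2 + (s x)\<^sup>2) = integral {0..l} (\<lambda>x. (v x)\<^sup>2) + integral {0..l} (\<lambda>x. (s x)\<^sup>2)"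
    by (intro Henstock_Kurzweil_Integration.integral_add i1 integrable_continuous_interval continuous_intros s_cont)
  finally have "2 / l * (\<Sum>k<n. (b k)\<^sup>2) \<le> integral {0..l} (\<lambda>x. (v x)\<^sup>2)"
    using vs ss by simp
  thus ?thesis using l by (simp add: b_def field_simps)
qed

text \<open>One factor \<open>cos (pi / l * x)\<close> replaces the k-th sine by the mean of its two
  neighbours, so the induction on n runs for all k at once. Here k is the true frequency number; the
  case k = 0, reached from k = 1, is trivial.\<close>

lemma sine_cosine_power_orthogonal:
  assumes g: "continuous_on {0..l} g"
    and zero: "\<And>k. integral {0..l} (\<lambda>x. g x * sin (freq l k * x)) = 0"
  shows "integral {0..l} (\<lambda>x. g x * sin (pi * real k / l * x) * cos (pi / l * x) ^ n) = 0"
proof (induction n arbitrary: k)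
  case 0
  then show ?case using zero[of "k - 1"] by (cases k) (auto simp: freq_def)
next
  case (Suc n)
  show ?case
  proof (cases k)
    case (Suc j)
    let ?f = "\<lambda>k x. g x * sin (pi * real k / l * x) * cos (pi / l * x) ^ n"
    have cont: "continuous_on {0..l} (?f k)" for k by (intro continuous_intros g)
    have "g x * sin (pi * real k / l * x) * cos (pi / l * x) ^ Suc n = 1 / 2 * ?f (Suc k) x + 1 / 2 * ?f j x" for x
    proof -
      have "pi * real k / l * x + pi / l * x = pi * real (Suc k) / l * x"
        "pi * real k / l * x - pi / l * x = pi * real j / l * x"
        using Suc by (auto simp: field_simps add_divide_distrib)
      hence "sin (pi * real k / l * x) * cos (pi / l * x) =
          (sin (pi * real (Suc k) / l * x) + sin (pi * real j / l * x)) / 2"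
        using sin_times_cos[of "pi * real k / l * x" "pi / l * x"] by simp
      moreover have "g x * sin (pi * real k / l * x) * cos (pi / l * x) ^ Suc n =
          g x * (sin (pi * real k / l * x) * cos (pi / l * x)) * cos (pi / l * x) ^ n"
        by simp
      moreover have "a * ((b + c) / 2) * d = 1 / 2 * (a * b * d) + 1 / 2 * (a * c * d)" for a b c d :: real
        by (simp add: algebra_simps)
      ultimately show ?thesis by (simp only:)
    qed
    hence "integral {0..l} (\<lambda>x. g x * sin (pi * real k / l * x) * cos (pi / l * x) ^ Suc n) =
        integral {0..l} (\<lambda>x. 1 / 2 * ?f (Suc k) x + 1 / 2 * ?f j x)" by simp
    also have "\<dots> = 1 / 2 * integral {0..l} (?f (Suc k)) + 1 / 2 * integral {0..l} (?f j)"
      using integral_add_cmult[OF continuous_on_mult[OF continuous_on_const cont] cont, of "1 / 2" "Suc k" "1 / 2" j]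
      by (simp only: integral_mult_right)
    finally show ?thesis unfolding Suc.IH by simp
  qed simp
qed

text \<open>Completeness of the sine system: \<open>g x = H (cos (\<pi> x / l))\<close> with a continuous H, and H is a
  uniform limit of polynomials on \<open>{-1..1}\<close>, so that g is orthogonal to \<open>g x * sin (\<pi> x / l)\<close>.\<close>

lemma sine_system_complete:
  assumes l: "0 < l" and g: "continuous_on {0..l} g"
    and zero: "\<And>k. integral {0..l} (\<lambda>x. g x * sin (freq l k * x)) = 0" and x: "x \<in> {0..l}"
  shows "g x = 0"
proof -
  let ?s = "\<lambda>x. sin (pi / l * x)" and ?c = "\<lambda>x. cos (pi / l * x)"
  \<comment> \<open>g read in the variable \<open>y = cos (pi * x / l)\<close>, in which polynomials
    in y become powers of the cosine.\<close>
  define H where "H = (\<lambda>y. g (l / pi * arccos y))"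
  have H_cont: "continuous_on {-1..1} H"
    unfolding H_def
  proof (rule continuous_on_compose2[OF g])
    show "continuous_on {-1..1} (\<lambda>x. l / pi * arccos x)" by (intro continuous_intros) auto
    show "(\<lambda>x. l / pi * arccos x) ` {-1..1} \<subseteq> {0..l}"
      using l arccos_bounded by (auto simp: field_simps mult_left_mono)
  qed
  have range: "pi / l * x \<in> {0..pi}" if "x \<in> {0..l}" for x
    using that l by (auto simp: field_simps)
  have H_cos: "H (?c x) = g x" if "x \<in> {0..l}" for x
    using range[OF that] l by (simp add: H_def arccos_cos)
  obtain M where M: "M > 0" "\<And>x. x \<in> {0..l} \<Longrightarrow> \<bar>g x\<bar> \<le> M"
    using continuous_on_bounded_real[OF g] by blast
  have gs: "continuous_on {0..l} (\<lambda>x. g x * ?s x * h x)" if "continuous_on {0..l} h" for h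
    by (intro continuous_intros g that)
  have s_nonneg: "0 \<le> ?s x" if "x \<in> {0..l}" for x
    using range[OF that] by (intro sin_ge_zero) auto
  have "integral {0..l} (\<lambda>x. g x * ?s x * g x) \<le> 0 + e" if e: "e > 0" for e
  proof -
    \<comment> \<open>The error is at most \<open>M * e'\<close> pointwise, hence at most
      \<open>M * e' * l = e\<close> after integration.\<close>
    define e' where "e' = e / (M * l)"
    have e': "e' > 0" using e M l by (simp add: e'_def)
    obtain p where p: "real_polynomial_function p" "\<And>y. y \<in> {-1..1} \<Longrightarrow> \<bar>H y - p y\<bar> < e'"
      using Stone_Weierstrass_real_polynomial_function[OF _ H_cont e'] by auto
    obtain a n where a: "p = (\<lambda>y. \<Sum>i\<le>n. a i * y ^ i)"
      using p(1) unfolding real_polynomial_function_iff_sum by blast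
    have "integral {0..l} (\<lambda>x. g x * ?s x * p (?c x)) =
        integral {0..l} (\<lambda>x. \<Sum>i\<le>n. a i * (g x * ?s x * ?c x ^ i))"
      by (simp add: a sum_distrib_left mult_ac)
    also have "\<dots> = (\<Sum>i\<le>n. integral {0..l} (\<lambda>x. a i * (g x * ?s x * ?c x ^ i)))"
      by (intro Henstock_Kurzweil_Integration.integral_sum integrable_continuous_interval continuous_intros g) auto
    also have "\<dots> = 0"
      using sine_cosine_power_orthogonal[OF g zero, of 1] by simp
    finally have p0: "integral {0..l} (\<lambda>x. g x * ?s x * p (?c x)) = 0" .
    have p_cont: "continuous_on {0..l} (\<lambda>x. p (?c x))" unfolding a by (intro continuous_intros)
    have "integral {0..l} (\<lambda>x. g x * ?s x * g x) =
        integral {0..l} (\<lambda>x. g x * ?s x * g x) - integral {0..l} (\<lambda>x. g x * ?s x * p (?c x))"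
      using p0 by simp
    also have "\<dots> = integral {0..l} (\<lambda>x. g x * ?s x * (g x - p (?c x)))"
      unfolding right_diff_distrib
      by (intro Henstock_Kurzweil_Integration.integral_diff[symmetric] integrable_continuous_interval gs g p_cont)
    also have "\<dots> \<le> integral {0..l} (\<lambda>_. M * e')"
    proof (rule integral_le)
      show "(\<lambda>x. g x * ?s x * (g x - p (?c x))) integrable_on {0..l}"
        by (intro integrable_continuous_interval continuous_intros g p_cont)
      fix x assume x: "x \<in> {0..l}"
      have "\<bar>g x - p (?c x)\<bar> \<le> e'"
        using p(2)[of "?c x"] H_cos[OF x] by auto
      moreover have "\<bar>g x * ?s x\<bar> \<le> M * 1"
        unfolding abs_mult by (intro mult_mono M(2) x) (use M in auto)
      ultimately have "\<bar>g x * ?s x * (g x - p (?c x))\<bar> \<le> M * e'"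
        unfolding abs_mult[of "g x * ?s x"] using M by (intro mult_mono) auto
      thus "g x * ?s x * (g x - p (?c x)) \<le> M * e'" by simp
    qed auto
    also have "\<dots> = e" using l M by (simp add: e'_def)
    finally show ?thesis by simp
  qed
  hence "integral {0..l} (\<lambda>x. g x * ?s x * g x) \<le> 0" by (rule field_le_epsilon)
  moreover have nonneg: "0 \<le> g x * ?s x * g x" if "x \<in> {0..l}" for x
    using mult_nonneg_nonneg[OF s_nonneg[OF that] zero_le_square[of "g x"]] by (simp add: mult_ac)
  moreover have "0 \<le> integral {0..l} (\<lambda>x. g x * ?s x * g x)"
    by (intro integral_nonneg integrable_continuous_interval gs g nonneg)
  ultimately have "integral {0..l} (\<lambda>x. g x * ?s x * g x) = 0" by simp
  hence all0: "g y * ?s y * g y = 0" if "y \<in> {0..l}" for y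
    using integral_cbox_eq_0_iff[of 0 l "\<lambda>x. g x * ?s x * g x"] gs[OF g] nonneg l that
    by (auto simp: cbox_interval simp del: mult_eq_0_iff)
  have interior: "g y = 0" if y: "y \<in> {0<..<l}" for y
  proof -
    have "0 < ?s y" using y l by (intro sin_gt_zero) (auto simp: field_simps)
    thus ?thesis using all0[of y] y by auto
  qed
  show ?thesis
    using continuous_constant_on_closure[of "{0<..<l}" g 0 x] g interior x l by simp
qed

lemma integral_sine_series:
  assumes l: "0 < l" and a: "summable (\<lambda>k. \<bar>a k\<bar>)"
  shows "continuous_on UNIV (\<lambda>x. \<Sum>k. a k * sin (freq l k * x))"
    and "fourier_coeff l j (\<lambda>x. \<Sum>k. a k * sin (freq l k * x)) = a j"
proof -
  let ?G = "\<lambda>x. \<Sum>k. a k * sin (freq l k * x)"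
  have conv: "uniformly_convergent_on S (\<lambda>n x. \<Sum>k<n. a k * sin (freq l k * x))" for S :: "real set"
    by (rule uniformly_convergent_series_comparison[OF uniformly_convergent_series_const[OF a]])
       (auto simp: abs_mult intro!: mult_left_le)
  show G_cont: "continuous_on UNIV ?G"
    by (rule continuous_on_series[OF conv]) (auto intro!: continuous_intros)
  have "uniform_limit {0..l} (\<lambda>n x. (\<Sum>k<n. a k * sin (freq l k * x)) * sin (freq l j * x))
      (\<lambda>x. ?G x * sin (freq l j * x)) sequentially"
    by (intro uniform_lim_mult uniformly_convergent_series_limit(1)[OF conv] uniform_limit_const
          compact_imp_bounded compact_continuous_image continuous_intros continuous_on_subset[OF G_cont]) auto
  then obtain I J where I: "\<And>n. ((\<lambda>x. (\<Sum>k<n. a k * sin (freq l k * x)) * sin (freq l j * x)) has_integral I n) {0..l}"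
    and J: "((\<lambda>x. ?G x * sin (freq l j * x)) has_integral J) {0..l}" and lim: "(I \<longlongrightarrow> J) sequentially"
    by (rule uniform_limit_integral) (auto intro!: continuous_intros)
  have "I n = (if j < n then a j * (l / 2) else 0)" for n
  proof -
    have "I n = integral {0..l} (\<lambda>x. \<Sum>k<n. a k * (sin (freq l k * x) * sin (freq l j * x)))"
      using I[of n] by (simp add: integral_unique sum_distrib_right mult.assoc)
    also have "\<dots> = (\<Sum>k<n. integral {0..l} (\<lambda>x. a k * (sin (freq l k * x) * sin (freq l j * x))))"
      by (intro Henstock_Kurzweil_Integration.integral_sum integrable_continuous_interval continuous_intros) auto
    also have "\<dots> = (\<Sum>k<n. if k = j then a k * (l / 2) else 0)"
      unfolding integral_mult_right sine_orthogonality[OF l] by (intro sum.cong) auto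
    finally show ?thesis by (simp add: sum.delta)
  qed
  hence "\<forall>\<^sub>F n in sequentially. I n = a j * (l / 2)"
    by (intro eventually_mono[OF eventually_gt_at_top[of j]]) simp
  hence "J = a j * (l / 2)"
    using lim by (metis LIMSEQ_unique tendsto_eventually)
  thus "fourier_coeff l j ?G = a j" using J l by (simp add: fourier_coeff_def integral_unique field_simps)
qed

text \<open>The difference of g and its sine series is continuous and has vanishing sine
  coefficients, so completeness applies.\<close>

lemma sine_series_expansion:
  assumes l: "0 < l" and g: "continuous_on {0..l} g" and sum: "summable (\<lambda>k. \<bar>fourier_coeff l k g\<bar>)"
    and x: "x \<in> {0..l}"
  shows "g x = (\<Sum>k. fourier_coeff l k g * sin (freq l k * x))"
proof -
  let ?G = "\<lambda>x. \<Sum>k. fourier_coeff l k g * sin (freq l k * x)"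
  have G: "continuous_on {0..l} ?G"
    using integral_sine_series(1)[OF l sum] by (rule continuous_on_subset) simp
  have "integral {0..l} (\<lambda>x. (g x - ?G x) * sin (freq l k * x)) = 0" for k
  proof -
    have "integral {0..l} (\<lambda>x. (g x - ?G x) * sin (freq l k * x)) =
        integral {0..l} (\<lambda>x. g x * sin (freq l k * x)) - integral {0..l} (\<lambda>x. ?G x * sin (freq l k * x))"
      unfolding left_diff_distrib
      by (intro Henstock_Kurzweil_Integration.integral_diff integrable_continuous_interval continuous_intros g G)
    also have "\<dots> = 0"
      using integral_sine_series(2)[OF l sum, of k] l by (simp add: fourier_coeff_def)
    finally show ?thesis .
  qed
  from sine_system_complete[OF l continuous_on_diff[OF g G] this x] show ?thesis by simp
qed

text \<open>The boundary conditions of a hinged plate, named after Navier. They remove the boundary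
  terms when the sine coefficients are integrated by parts four times.\<close>

definition navier :: "real \<Rightarrow> (real \<Rightarrow> real) \<Rightarrow> bool" where
  "navier l g \<longleftrightarrow> W2_rep 4 l g \<and> g 0 = 0 \<and> g l = 0 \<and> xderiv l 2 g 0 = 0 \<and> xderiv l 2 g l = 0"

lemma wderiv_4:
  assumes "W2 4 l g"
  shows "L2 l (wderiv l 4 g)" "weak_derivative l 4 g (wderiv l 4 g)"
proof -
  have "\<exists>v. L2 l v \<and> weak_derivative l 4 g v" using assms by (auto simp: W2_def)
  from someI_ex[OF this] show "L2 l (wderiv l 4 g)" "weak_derivative l 4 g (wderiv l 4 g)"
    by (auto simp: wderiv_def)
qed

lemma navier_regularity:
  assumes l: "0 < l" and g: "navier l g"
  obtains g1 g2 g3 C where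
    "\<And>x. x \<in> {0..l} \<Longrightarrow> (g has_real_derivative g1 x) (at x within {0..l})"
    "\<And>x. x \<in> {0..l} \<Longrightarrow> (g1 has_real_derivative g2 x) (at x within {0..l})"
    "\<And>x. x \<in> {0..l} \<Longrightarrow> (g2 has_real_derivative g3 x) (at x within {0..l})"
    "\<And>x. x \<in> {0..l} \<Longrightarrow> g3 x = C + integral {0..x} (wderiv l 4 g)"
    "\<And>x. x \<in> {0..l} \<Longrightarrow> xderiv l 1 g x = g1 x" "\<And>x. x \<in> {0..l} \<Longrightarrow> xderiv l 2 g x = g2 x"
    "g 0 = 0" "g l = 0" "g2 0 = 0" "g2 l = 0"
proof -
  have W: "W2 4 l g" "continuous_on {0..l} g" "L2 l g" and bc: "g 0 = 0" "g l = 0" "xderiv l 2 g 0 = 0" "xderiv l 2 g l = 0"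
    using g by (auto simp: navier_def W2_rep_def W2_def)
  obtain g1 g2 g3 C where *:
    "\<And>x. x \<in> {0..l} \<Longrightarrow> (g has_real_derivative g1 x) (at x within {0..l})"
    "\<And>x. x \<in> {0..l} \<Longrightarrow> (g1 has_real_derivative g2 x) (at x within {0..l})"
    "\<And>x. x \<in> {0..l} \<Longrightarrow> (g2 has_real_derivative g3 x) (at x within {0..l})"
    "\<And>x. x \<in> {0..l} \<Longrightarrow> g3 x = C + integral {0..x} (wderiv l 4 g)"
    using W2_4_regularity[OF l W(3,2) wderiv_4[OF W(1)]] by blast
  have x1: "xderiv l 1 g x = g1 x" if "x \<in> {0..l}" for x
    using xderiv_Suc_eq[OF l _ *(1) that, of 0 g] by simp
  have x2: "xderiv l 2 g x = g2 x" if "x \<in> {0..l}" for x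
    using xderiv_Suc_eq[OF l x1 *(2) that] by (simp add: numeral_2_eq_2)
  show ?thesis using that[OF * x1 x2] bc x2[of 0] x2[of l] l by simp
qed

lemma integral_by_parts_real:
  fixes f g :: "real \<Rightarrow> real"
  assumes "a \<le> b"
    and f: "\<And>x. x \<in> {a..b} \<Longrightarrow> (f has_real_derivative f' x) (at x within {a..b})" "continuous_on {a..b} f'"
    and g: "\<And>x. x \<in> {a..b} \<Longrightarrow> (g has_real_derivative g' x) (at x within {a..b})" "continuous_on {a..b} g'"
  shows "integral {a..b} (\<lambda>x. f x * g' x) = f b * g b - f a * g a - integral {a..b} (\<lambda>x. f' x * g x)"
proof -
  have c: "continuous_on {a..b} f" "continuous_on {a..b} g" using f(1) g(1) by (meson DERIV_continuous_on)+
  have "((\<lambda>x. f' x * g x + f x * g' x) has_integral f b * g b - f a * g a) {a..b}"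
    using assms by (intro fundamental_theorem_of_calculus)
      (auto intro!: derivative_eq_intros simp flip: has_real_derivative_iff_has_vector_derivative)
  hence "integral {a..b} (\<lambda>x. f' x * g x + f x * g' x) = f b * g b - f a * g a" by (rule integral_unique)
  moreover have "integral {a..b} (\<lambda>x. f' x * g x + f x * g' x) =
      integral {a..b} (\<lambda>x. f' x * g x) + integral {a..b} (\<lambda>x. f x * g' x)"
    by (intro Henstock_Kurzweil_Integration.integral_add integrable_continuous_interval continuous_intros f g c)
  ultimately show ?thesis by simp
qed

lemma integral_sine_second_derivative:
  assumes l: "0 < l"
    and g: "\<And>x. x \<in> {0..l} \<Longrightarrow> (g has_real_derivative g1 x) (at x within {0..l})"
      "\<And>x. x \<in> {0..l} \<Longrightarrow> (g1 has_real_derivative g2 x) (at x within {0..l})" "continuous_on {0..l} g2"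
    and bc: "g 0 = 0" "g l = 0"
  shows "integral {0..l} (\<lambda>x. g2 x * sin (freq l k * x)) = - (freq l k)\<^sup>2 * integral {0..l} (\<lambda>x. g x * sin (freq l k * x))"
proof -
  let ?a = "freq l k"
  have g1: "continuous_on {0..l} g1" using g(2) by (meson DERIV_continuous_on)
  have "integral {0..l} (\<lambda>x. sin (?a * x) * g2 x) = - integral {0..l} (\<lambda>x. (?a * cos (?a * x)) * g1 x)"
    by (subst integral_by_parts_real[OF _ _ _ g(2,3)])
       (use l freq_boundary[OF l] in \<open>auto intro!: derivative_eq_intros continuous_intros\<close>)
  also have "integral {0..l} (\<lambda>x. (?a * cos (?a * x)) * g1 x) = - integral {0..l} (\<lambda>x. (- (?a\<^sup>2) * sin (?a * x)) * g x)"
    by (subst integral_by_parts_real[OF _ _ _ g(1) g1])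
       (use l bc in \<open>auto intro!: derivative_eq_intros continuous_intros simp: power2_eq_square mult_ac\<close>)
  also have "(\<lambda>x. (- (?a\<^sup>2) * sin (?a * x)) * g x) = (\<lambda>x. - (?a\<^sup>2) * (g x * sin (?a * x)))"
    by (simp add: mult_ac)
  finally show ?thesis unfolding integral_mult_right by (simp add: mult.commute)
qed

text \<open>Two classical integrations by parts reach the second derivative, a third reaches
  \<open>g3\<close>, and the fourth uses that \<open>g3\<close> is a constant plus the primitive of
  the weak fourth derivative.\<close>

lemma navier_sine_integral:
  assumes l: "0 < l" and g: "navier l g"
  shows "freq l k ^ 4 * integral {0..l} (\<lambda>x. g x * sin (freq l k * x)) =
    integral {0..l} (\<lambda>x. wderiv l 4 g x * sin (freq l k * x))"
proof -
  let ?a = "freq l k" and ?v = "wderiv l 4 g"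
  obtain g1 g2 g3 C where d:
    "\<And>x. x \<in> {0..l} \<Longrightarrow> (g has_real_derivative g1 x) (at x within {0..l})"
    "\<And>x. x \<in> {0..l} \<Longrightarrow> (g1 has_real_derivative g2 x) (at x within {0..l})"
    "\<And>x. x \<in> {0..l} \<Longrightarrow> (g2 has_real_derivative g3 x) (at x within {0..l})"
    and g3: "\<And>x. x \<in> {0..l} \<Longrightarrow> g3 x = C + integral {0..x} ?v"
    and x_eq: "\<And>x. x \<in> {0..l} \<Longrightarrow> xderiv l 1 g x = g1 x" "\<And>x. x \<in> {0..l} \<Longrightarrow> xderiv l 2 g x = g2 x"
    and bc: "g 0 = 0" "g l = 0" "g2 0 = 0" "g2 l = 0"
    using navier_regularity[OF l g] by blast
  have W: "W2 4 l g" using g by (simp add: navier_def W2_rep_def)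
  have va: "?v absolutely_integrable_on {0..l}"
    by (rule L2_absolutely_integrable[OF wderiv_4(1)[OF W]])
  have g2: "continuous_on {0..l} g2" using d(3) by (meson DERIV_continuous_on)
  have V_cont: "continuous_on {0..l} (\<lambda>x. integral {0..x} ?v)"
    by (intro indefinite_integral_continuous_1 set_lebesgue_integral_eq_integral(1) va)
  hence g3_cont: "continuous_on {0..l} g3"
    by (subst continuous_on_cong[OF refl g3]) (auto intro!: continuous_intros)
  have "integral {0..l} (\<lambda>x. g2 x * (?a\<^sup>2 * sin (?a * x))) = - integral {0..l} (\<lambda>x. g3 x * (- ?a * cos (?a * x)))"
    by (subst integral_by_parts_real[OF _ d(3) g3_cont, where g = "\<lambda>x. - ?a * cos (?a * x)"])
       (use l bc in \<open>auto intro!: derivative_eq_intros continuous_intros simp: power2_eq_square\<close>)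
  also have "\<dots> = integral {0..l} (\<lambda>x. g3 x * (?a * cos (?a * x)))" by simp
  also have "\<dots> = integral {0..l} (\<lambda>x. C * (?a * cos (?a * x)) + integral {0..x} ?v * (?a * cos (?a * x)))"
    by (intro integral_cong) (simp add: g3 distrib_right)
  also have "\<dots> = integral {0..l} (\<lambda>x. C * (?a * cos (?a * x))) + integral {0..l} (\<lambda>x. integral {0..x} ?v * (?a * cos (?a * x)))"
    by (intro Henstock_Kurzweil_Integration.integral_add integrable_continuous_interval continuous_intros V_cont)
  \<comment> \<open>The constant of integration drops out because the sine vanishes at both
    ends.\<close>
  also have "integral {0..l} (\<lambda>x. C * (?a * cos (?a * x))) = 0"
    by (subst integral_by_parts_real[where g = "\<lambda>x. sin (?a * x)" and f' = "\<lambda>_. 0"])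
       (use l freq_boundary[OF l] in \<open>auto intro!: derivative_eq_intros continuous_intros\<close>)
  also have "integral {0..l} (\<lambda>x. integral {0..x} ?v * (?a * cos (?a * x))) = - integral {0..l} (\<lambda>x. ?v x * sin (?a * x))"
    by (subst absolutely_continuous_by_parts[OF l va, of "\<lambda>x. sin (?a * x)"])
       (use freq_boundary[OF l] in \<open>auto intro!: derivative_eq_intros continuous_intros\<close>)
  finally have "integral {0..l} (\<lambda>x. g2 x * (?a\<^sup>2 * sin (?a * x))) = - integral {0..l} (\<lambda>x. ?v x * sin (?a * x))" by simp
  moreover have "integral {0..l} (\<lambda>x. g2 x * (?a\<^sup>2 * sin (?a * x))) = ?a\<^sup>2 * integral {0..l} (\<lambda>x. g2 x * sin (?a * x))"
    by (simp only: integral_mult_right[symmetric] mult.left_commute)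
  ultimately show ?thesis
    using integral_sine_second_derivative[OF l d(1,2) g2 bc(1,2), of k] by (simp add: eval_nat_numeral mult_ac)
qed

lemma navier_coeff_squares:
  assumes l: "0 < l" and g: "navier l g"
  shows "(\<Sum>k<n. (freq l k ^ 4 * fourier_coeff l k g)\<^sup>2) \<le> 2 / l * (L2_norm l (wderiv l 4 g))\<^sup>2"
proof -
  have v: "L2 l (wderiv l 4 g)" using g by (intro wderiv_4) (simp add: navier_def W2_rep_def)
  have sq: "(L2_norm l (wderiv l 4 g))\<^sup>2 = integral {0..l} (\<lambda>x. (wderiv l 4 g x)\<^sup>2)"
    unfolding L2_norm_def lebesgue_on_integral_eq[OF L2_square_absolutely_integrable[OF v]]
    by (rule real_sqrt_pow2)
       (intro integral_nonneg set_lebesgue_integral_eq_integral(1) L2_square_absolutely_integrable v zero_le_power2)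
  have "(\<Sum>k<n. (freq l k ^ 4 * fourier_coeff l k g)\<^sup>2) =
      (2 / l)\<^sup>2 * (\<Sum>k<n. (integral {0..l} (\<lambda>x. wderiv l 4 g x * sin (freq l k * x)))\<^sup>2)"
    unfolding navier_sine_integral[OF l g, symmetric] fourier_coeff_def
    unfolding sum_distrib_left by (intro sum.cong refl) (simp add: power_mult_distrib power_divide)
  also have "\<dots> \<le> (2 / l)\<^sup>2 * (l / 2 * integral {0..l} (\<lambda>x. (wderiv l 4 g x)\<^sup>2))"
    by (intro mult_left_mono Bessel_inequality l v) auto
  also have "\<dots> = 2 / l * (L2_norm l (wderiv l 4 g))\<^sup>2"
    unfolding sq using l by (simp add: power2_eq_square)
  finally show ?thesis .
qed

lemma wderiv_4_le_W2_norm: "(L2_norm l (wderiv l 4 g))\<^sup>2 \<le> (W2_norm 4 l g)\<^sup>2"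
proof -
  have "(L2_norm l (wderiv l 4 g))\<^sup>2 \<le> (\<Sum>j\<le>4. (L2_norm l (wderiv l j g))\<^sup>2)"
    by (rule member_le_sum[of 4 "{..4::nat}" "\<lambda>j. (L2_norm l (wderiv l j g))\<^sup>2"]) auto
  also have "\<dots> = (W2_norm 4 l g)\<^sup>2"
    unfolding W2_norm_def by (rule real_sqrt_pow2[symmetric]) (auto intro!: sum_nonneg)
  finally show ?thesis .
qed

text \<open>\<open>xderiv\<close> can be subtracted only where the derivatives exist;
  \<open>navier_regularity\<close> provides them, so that the boundary values of the second
  derivative subtract.\<close>

lemma navier_diff:
  assumes l: "0 < l" and g: "navier l g" and h: "navier l h"
  shows "navier l (\<lambda>x. g x - h x)"
proof -
  obtain g1 g2 g3 Cg where g': "\<And>x. x \<in> {0..l} \<Longrightarrow> (g has_real_derivative g1 x) (at x within {0..l})"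
    "\<And>x. x \<in> {0..l} \<Longrightarrow> (g1 has_real_derivative g2 x) (at x within {0..l})"
    and "\<And>x. x \<in> {0..l} \<Longrightarrow> (g2 has_real_derivative g3 x) (at x within {0..l})"
    "\<And>x. x \<in> {0..l} \<Longrightarrow> g3 x = Cg + integral {0..x} (wderiv l 4 g)"
    "\<And>x. x \<in> {0..l} \<Longrightarrow> xderiv l 1 g x = g1 x" "\<And>x. x \<in> {0..l} \<Longrightarrow> xderiv l 2 g x = g2 x"
    and g'': "g 0 = 0" "g l = 0" "g2 0 = 0" "g2 l = 0"
    using navier_regularity[OF l g] by blast
  obtain h1 h2 h3 Ch where h': "\<And>x. x \<in> {0..l} \<Longrightarrow> (h has_real_derivative h1 x) (at x within {0..l})"
    "\<And>x. x \<in> {0..l} \<Longrightarrow> (h1 has_real_derivative h2 x) (at x within {0..l})"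
    and "\<And>x. x \<in> {0..l} \<Longrightarrow> (h2 has_real_derivative h3 x) (at x within {0..l})"
    "\<And>x. x \<in> {0..l} \<Longrightarrow> h3 x = Ch + integral {0..x} (wderiv l 4 h)"
    "\<And>x. x \<in> {0..l} \<Longrightarrow> xderiv l 1 h x = h1 x" "\<And>x. x \<in> {0..l} \<Longrightarrow> xderiv l 2 h x = h2 x"
    and h'': "h 0 = 0" "h l = 0" "h2 0 = 0" "h2 l = 0"
    using navier_regularity[OF l h] by blast
  let ?d = "\<lambda>x. g x - h x"
  have x1: "xderiv l 1 ?d x = g1 x - h1 x" if "x \<in> {0..l}" for x
    using xderiv_Suc_eq[OF l _ DERIV_diff[OF g'(1) h'(1)] that, of 0 ?d] by simp
  have x2: "xderiv l 2 ?d x = g2 x - h2 x" if "x \<in> {0..l}" for x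
    using xderiv_Suc_eq[OF l x1 DERIV_diff[OF g'(2) h'(2)] that] by (simp add: numeral_2_eq_2)
  have G: "L2 l g" "continuous_on {0..l} g" "\<And>j. j \<in> {1..4} \<Longrightarrow> \<exists>v. L2 l v \<and> weak_derivative l j g v"
    and H: "L2 l h" "continuous_on {0..l} h" "\<And>j. j \<in> {1..4} \<Longrightarrow> \<exists>v. L2 l v \<and> weak_derivative l j h v"
    using g h by (auto simp: navier_def W2_rep_def W2_def)
  have "W2 4 l ?d"
    unfolding W2_def
  proof (intro conjI ballI L2_diff G H)
    fix j :: nat assume j: "j \<in> {1..4}"
    obtain v w where "L2 l v" "weak_derivative l j g v" "L2 l w" "weak_derivative l j h w"
      using G(3)[OF j] H(3)[OF j] by blast
    thus "\<exists>v. L2 l v \<and> weak_derivative l j ?d v"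
      using L2_diff weak_derivative_diff[OF G(1) _ H(1)] by blast
  qed
  thus ?thesis
    using x2[of 0] x2[of l] l g'' h'' by (auto simp: navier_def W2_rep_def intro!: continuous_intros G H)
qed

lemma fourier_coeff_diff:
  assumes "continuous_on {0..l} g" "continuous_on {0..l} h"
  shows "fourier_coeff l k (\<lambda>x. g x - h x) = fourier_coeff l k g - fourier_coeff l k h"
  unfolding fourier_coeff_def left_diff_distrib right_diff_distrib[symmetric]
  by (subst Henstock_Kurzweil_Integration.integral_diff)
     (auto intro!: integrable_continuous_interval continuous_intros assms)

lemma navier_family_coeff_diff:
  assumes l: "0 < l" and g: "navier l g" and h: "navier l h"
  shows "(\<Sum>k<n. (freq l k ^ 4 * (fourier_coeff l k g - fourier_coeff l k h))\<^sup>2) \<le>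
    2 / l * (W2_norm 4 l (\<lambda>x. g x - h x))\<^sup>2"
proof -
  have "continuous_on {0..l} g" "continuous_on {0..l} h" using g h by (auto simp: navier_def W2_rep_def)
  hence "(\<Sum>k<n. (freq l k ^ 4 * (fourier_coeff l k g - fourier_coeff l k h))\<^sup>2) =
      (\<Sum>k<n. (freq l k ^ 4 * fourier_coeff l k (\<lambda>x. g x - h x))\<^sup>2)"
    by (simp add: fourier_coeff_diff)
  also have "\<dots> \<le> 2 / l * (L2_norm l (wderiv l 4 (\<lambda>x. g x - h x)))\<^sup>2"
    by (intro navier_coeff_squares navier_diff assms)
  also have "\<dots> \<le> 2 / l * (W2_norm 4 l (\<lambda>x. g x - h x))\<^sup>2"
    using l by (intro mult_left_mono wderiv_4_le_W2_norm) auto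
  finally show ?thesis .
qed

text \<open>The square of a single weighted coefficient difference is one summand of the Bessel sum
  of \<open>f x s - f x t\<close>, which the Sobolev norm controls.\<close>

lemma C_W2_coeff_continuous:
  assumes l: "0 < l" and f: "C_W2 4 l T f" "\<And>t. t \<in> {0..T} \<Longrightarrow> navier l (\<lambda>x. f x t)"
  shows "continuous_on {0..T} (\<lambda>t. fourier_coeff l k (\<lambda>x. f x t))"
  unfolding continuous_on_def
proof
  fix t assume t: "t \<in> {0..T}"
  let ?W = "\<lambda>s. W2_norm 4 l (\<lambda>x. f x s - f x t)" and ?c = "\<lambda>s. fourier_coeff l k (\<lambda>x. f x s)"
  have W: "(?W \<longlongrightarrow> 0) (at t within {0..T})" using f(1) t by (simp add: C_W2_def)
  have "((\<lambda>s. sqrt (2 / l * (?W s)\<^sup>2) / freq l k ^ 4) \<longlongrightarrow> sqrt (2 / l * 0\<^sup>2) / freq l k ^ 4) (at t within {0..T})"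
    using freq_pos[OF l, of k] by (intro tendsto_intros W) auto
  hence lim: "((\<lambda>s. sqrt (2 / l * (?W s)\<^sup>2) / freq l k ^ 4) \<longlongrightarrow> 0) (at t within {0..T})" by simp
  have "\<forall>\<^sub>F s in at t within {0..T}. norm (?c s - ?c t) \<le> sqrt (2 / l * (?W s)\<^sup>2) / freq l k ^ 4"
  proof -
    have "\<bar>?c s - ?c t\<bar> \<le> sqrt (2 / l * (?W s)\<^sup>2) / freq l k ^ 4" if s: "s \<in> {0..T}" for s
    proof -
      have "(freq l k ^ 4 * (?c s - ?c t))\<^sup>2 \<le> (\<Sum>j<Suc k. (freq l j ^ 4 * (fourier_coeff l j (\<lambda>x. f x s) - fourier_coeff l j (\<lambda>x. f x t)))\<^sup>2)"
        by (rule member_le_sum[of k "{..<Suc k}" "\<lambda>j. (freq l j ^ 4 * (fourier_coeff l j (\<lambda>x. f x s) - fourier_coeff l j (\<lambda>x. f x t)))\<^sup>2"]) auto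
      also have "\<dots> \<le> 2 / l * (?W s)\<^sup>2"
        by (rule navier_family_coeff_diff[OF l f(2)[OF s] f(2)[OF t]])
      finally have "\<bar>freq l k ^ 4 * (?c s - ?c t)\<bar> \<le> sqrt (2 / l * (?W s)\<^sup>2)"
        by (rule real_le_rsqrt[of "\<bar>_\<bar>", simplified])
      hence "freq l k ^ 4 * \<bar>?c s - ?c t\<bar> \<le> sqrt (2 / l * (?W s)\<^sup>2)"
        using freq_pos[OF l, of k] by (simp only: abs_mult power_abs abs_of_pos)
      thus ?thesis using freq_pos[OF l, of k] by (simp only: pos_le_divide_eq zero_less_power mult.commute)
    qed
    thus ?thesis by (simp add: eventually_at_filter)
  qed
  from tendsto_norm_zero_cancel[OF Lim_null_comparison[OF this lim, THEN tendsto_norm_zero]]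
  show "(?c \<longlongrightarrow> ?c t) (at t within {0..T})" by (simp add: LIM_zero_iff)
qed

text \<open>Continuity in the Sobolev norm bounds the Bessel sums near each time by the sum at that
  time; bisection of \<open>{0..T}\<close> makes the bound uniform. The comparison is made on the
  coefficients, which are linear in f, whereas \<open>wderiv\<close> is a choice.\<close>

lemma C_W2_coeff_squares_bounded:
  assumes l: "0 < l" and T: "0 < T" and f: "C_W2 4 l T f" "\<And>t. t \<in> {0..T} \<Longrightarrow> navier l (\<lambda>x. f x t)"
  obtains M where "0 < M" "\<And>t n. t \<in> {0..T} \<Longrightarrow> (\<Sum>k<n. (freq l k ^ 4 * fourier_coeff l k (\<lambda>x. f x t))\<^sup>2) \<le> M"
proof -
  let ?c = "\<lambda>k s. fourier_coeff l k (\<lambda>x. f x s)"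
  define P where "P = (\<lambda>a b. \<exists>M. \<forall>s\<in>{a..b} \<inter> {0..T}. \<forall>n. (\<Sum>k<n. (freq l k ^ 4 * ?c k s)\<^sup>2) \<le> M)"
  have "P 0 T"
  proof (rule Bolzano[of 0 T P])
    show "0 \<le> T" using T by simp
    show "P a c" if ab: "P a b" and bc: "P b c" for a b c
    proof -
      obtain M1 M2 where M: "\<forall>s\<in>{a..b} \<inter> {0..T}. \<forall>n. (\<Sum>k<n. (freq l k ^ 4 * ?c k s)\<^sup>2) \<le> M1"
        "\<forall>s\<in>{b..c} \<inter> {0..T}. \<forall>n. (\<Sum>k<n. (freq l k ^ 4 * ?c k s)\<^sup>2) \<le> M2"
        using ab bc unfolding P_def by blast
      have "(\<Sum>k<n. (freq l k ^ 4 * ?c k s)\<^sup>2) \<le> max M1 M2" if "s \<in> {a..c} \<inter> {0..T}" for s n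
      proof (cases "s \<le> b")
        case True
        with M(1) that have "(\<Sum>k<n. (freq l k ^ 4 * ?c k s)\<^sup>2) \<le> M1" by auto
        thus ?thesis by simp
      next
        case False
        with M(2) that have "(\<Sum>k<n. (freq l k ^ 4 * ?c k s)\<^sup>2) \<le> M2" by auto
        thus ?thesis by simp
      qed
      thus ?thesis unfolding P_def by blast
    qed
    fix t assume "0 \<le> t" "t \<le> T"
    hence t: "t \<in> {0..T}" by simp
    let ?W = "\<lambda>s. W2_norm 4 l (\<lambda>x. f x s - f x t)"
    have "(?W \<longlongrightarrow> 0) (at t within {0..T})" using f(1) t by (simp add: C_W2_def)
    hence "\<forall>\<^sub>F s in at t within {0..T}. dist (?W s) 0 < 1" by (rule tendstoD) simp
    then obtain d where d: "d > 0" "\<And>s. s \<in> {0..T} \<Longrightarrow> s \<noteq> t \<Longrightarrow> \<bar>s - t\<bar> < d \<Longrightarrow> \<bar>?W s\<bar> < 1"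
      unfolding eventually_at by (auto simp: dist_real_def)
    \<comment> \<open>Both factors 2 come from \<open>(a + b)^2 \<le> 2 * a^2 + 2 * b^2\<close>; the
      second summand uses that the Sobolev distance is below 1.\<close>
    define M where "M = 2 * (2 / l * (L2_norm l (wderiv l 4 (\<lambda>x. f x t)))\<^sup>2) + 2 * (2 / l)"
    have bound: "(\<Sum>k<n. (freq l k ^ 4 * ?c k s)\<^sup>2) \<le> M" if s: "s \<in> {0..T}" "\<bar>s - t\<bar> < d" for s n
    proof -
      have sq: "(freq l k ^ 4 * ?c k s)\<^sup>2 \<le>
          2 * (freq l k ^ 4 * ?c k t)\<^sup>2 + 2 * (freq l k ^ 4 * (?c k s - ?c k t))\<^sup>2" for k
      proof -
        have "(a + b)\<^sup>2 \<le> 2 * a\<^sup>2 + 2 * b\<^sup>2" for a b :: real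
          using zero_le_power2[of "a - b"] by (simp add: power2_sum power2_diff)
        from this[of "freq l k ^ 4 * ?c k t" "freq l k ^ 4 * (?c k s - ?c k t)"] show ?thesis
          by (simp add: right_diff_distrib)
      qed
      have "(\<Sum>k<n. (freq l k ^ 4 * ?c k s)\<^sup>2) \<le>
          2 * (\<Sum>k<n. (freq l k ^ 4 * ?c k t)\<^sup>2) + 2 * (\<Sum>k<n. (freq l k ^ 4 * (?c k s - ?c k t))\<^sup>2)"
        unfolding sum_distrib_left sum.distrib[symmetric] by (intro sum_mono sq)
      also have "\<dots> \<le> M"
        unfolding M_def
      proof (intro add_mono mult_left_mono)
        show "(\<Sum>k<n. (freq l k ^ 4 * ?c k t)\<^sup>2) \<le> 2 / l * (L2_norm l (wderiv l 4 (\<lambda>x. f x t)))\<^sup>2"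
          by (rule navier_coeff_squares[OF l f(2)[OF t]])
        show "(\<Sum>k<n. (freq l k ^ 4 * (?c k s - ?c k t))\<^sup>2) \<le> 2 / l"
        proof (cases "s = t")
          case False
          have "(\<Sum>k<n. (freq l k ^ 4 * (?c k s - ?c k t))\<^sup>2) \<le> 2 / l * (?W s)\<^sup>2"
            by (rule navier_family_coeff_diff[OF l f(2)[OF s(1)] f(2)[OF t]])
          also have "\<dots> \<le> 2 / l * 1"
            using d(2)[OF s(1) False s(2)] l by (intro mult_left_mono) (auto simp: abs_square_le_1)
          finally show ?thesis by simp
        qed (use l in simp)
      qed auto
      finally show ?thesis .
    qed
    have "P a b" if "a \<le> t" "t \<le> b" "b - a < d" for a b
      unfolding P_def
    proof (intro exI[of _ M] ballI allI)
      fix s n assume "s \<in> {a..b} \<inter> {0..T}"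
      with that show "(\<Sum>k<n. (freq l k ^ 4 * ?c k s)\<^sup>2) \<le> M" by (intro bound) auto
    qed
    thus "\<exists>d>0. \<forall>a b. a \<le> t \<and> t \<le> b \<and> b - a < d \<longrightarrow> P a b" using d(1) by blast
  qed
  then obtain M where "\<forall>s\<in>{0..T} \<inter> {0..T}. \<forall>n. (\<Sum>k<n. (freq l k ^ 4 * ?c k s)\<^sup>2) \<le> M"
    unfolding P_def by blast
  hence M: "(\<Sum>k<n. (freq l k ^ 4 * ?c k s)\<^sup>2) \<le> M" if "s \<in> {0..T}" for s n using that by auto
  show ?thesis
  proof (rule that[of "max M 1"])
    fix t n assume "t \<in> {0..T}"
    thus "(\<Sum>k<n. (freq l k ^ 4 * ?c k t)\<^sup>2) \<le> max M 1" using M[of t n] by simp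
  qed simp
qed

text \<open>Cauchy-Schwarz with \<open>freq^3 = (1 / freq) * freq^4\<close>: the first factor has a
  summable square that is independent of t, so the tails are uniformly small.\<close>

lemma uniformly_convergent_cubes:
  assumes l: "0 < l" and M: "0 < M" "\<And>t n. t \<in> S \<Longrightarrow> (\<Sum>k<n. (freq l k ^ 4 * c k t)\<^sup>2) \<le> M"
  shows "uniformly_convergent_on S (\<lambda>n t. \<Sum>k<n. freq l k ^ 3 * c k t)"
  unfolding uniformly_convergent_series_iff
proof safe
  fix e :: real assume e: "e > 0"
  have "e\<^sup>2 / M > 0" using e M by simp
  then obtain N where N: "\<And>m n. m \<ge> N \<Longrightarrow> n \<ge> m \<Longrightarrow> \<bar>\<Sum>k=m..<n. 1 / (freq l k)\<^sup>2\<bar> < e\<^sup>2 / M"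
    using uniformly_convergent_series_const[OF summable_inverse_freq_squares[OF l], of "UNIV :: real set"]
    unfolding uniformly_convergent_series_iff by blast
  have "\<bar>\<Sum>k=m..<n. freq l k ^ 3 * c k t\<bar> < e" if mn: "m \<ge> N" "n \<ge> m" and t: "t \<in> S" for m n t
  proof -
    have "(\<Sum>k=m..<n. freq l k ^ 3 * c k t) = (\<Sum>k=m..<n. (1 / freq l k) * (freq l k ^ 4 * c k t))"
    proof (intro sum.cong refl)
      fix k
      show "freq l k ^ 3 * c k t = (1 / freq l k) * (freq l k ^ 4 * c k t)"
        using freq_pos[OF l, of k] by (simp add: eval_nat_numeral)
    qed
    hence "(\<Sum>k=m..<n. freq l k ^ 3 * c k t)\<^sup>2 \<le>
        (\<Sum>k=m..<n. (1 / freq l k)\<^sup>2) * (\<Sum>k=m..<n. (freq l k ^ 4 * c k t)\<^sup>2)"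
      by (simp only: Cauchy_Schwarz_ineq_sum)
    also have "\<dots> \<le> (\<Sum>k=m..<n. (1 / freq l k)\<^sup>2) * M"
    proof (intro mult_left_mono)
      have "(\<Sum>k=m..<n. (freq l k ^ 4 * c k t)\<^sup>2) \<le> (\<Sum>k<n. (freq l k ^ 4 * c k t)\<^sup>2)"
        by (intro sum_mono2) auto
      thus "(\<Sum>k=m..<n. (freq l k ^ 4 * c k t)\<^sup>2) \<le> M" using M(2)[OF t, of n] by simp
    qed (auto intro!: sum_nonneg)
    also have "\<dots> < e\<^sup>2"
      using N[OF mn] M by (simp add: power_divide pos_less_divide_eq abs_less_iff)
    finally have "\<bar>\<Sum>k=m..<n. freq l k ^ 3 * c k t\<bar>\<^sup>2 < e\<^sup>2" by simp
    thus ?thesis by (rule power2_less_imp_less) (use e in simp)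
  qed
  thus "\<exists>N. \<forall>m\<ge>N. \<forall>n\<ge>m. \<forall>t\<in>S. \<bar>\<Sum>k=m..<n. freq l k ^ 3 * c k t\<bar> < e" by blast
qed

section \<open>Solutions of the inverse problem\<close>

lemma caputo_primitive_frac_int:
  fixes \<rho> :: real
  assumes rho: "0 < \<rho>" "\<rho> < 1" and t: "0 \<le> t" and h: "continuous_on {0..t} h"
  shows "caputo_primitive \<rho> h t = frac_int (1 - \<rho>) (\<lambda>\<eta>. h \<eta> - h 0) t"
proof -
  have "((\<lambda>\<eta>. (t - \<eta>) powr (1 - \<rho> - 1) * (h \<eta> - h 0)) has_integral
      Gamma (1 - \<rho>) * frac_int (1 - \<rho>) (\<lambda>\<eta>. h \<eta> - h 0) t) {0..t}"
    using rho by (intro frac_int_has_integral t continuous_intros h) auto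
  moreover have "(t - \<eta>) powr (1 - \<rho> - 1) * (h \<eta> - h 0) = (h \<eta> - h 0) / (t - \<eta>) powr \<rho>" for \<eta>
    by (simp add: powr_minus divide_inverse mult.commute)
  moreover have "Gamma (1 - \<rho>) \<noteq> 0" using Gamma_real_pos[of "1 - \<rho>", THEN less_imp_neq] rho by simp
  ultimately show ?thesis
    unfolding caputo_primitive_def by (simp add: integral_unique)
qed

text \<open>The Caputo primitive is the fractional integral of order \<open>1 - \<rho>\<close> of
  \<open>frac_int \<rho> G\<close>, that is, the ordinary integral of G, and this is differentiable
  although h may not be.\<close>

lemma has_caputo_frac_int:
  fixes \<rho> :: real
  assumes rho: "0 < \<rho>" "\<rho> < 1" and h: "continuous_on {0..T} h" and G: "continuous_on {0..T} G"
    and eq: "\<And>t. t \<in> {0..T} \<Longrightarrow> h t = h 0 + frac_int \<rho> G t" and t: "t \<in> {0..T}"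
  shows "has_caputo \<rho> T h (G t) t"
  unfolding has_caputo_def
proof (intro conjI ballI)
  have h_sub: "continuous_on {0..s} h" and G_sub: "continuous_on {0..s} G" if "s \<in> {0..T}" for s
    using that by (auto intro: continuous_on_subset[OF h] continuous_on_subset[OF G])
  fix s assume s: "s \<in> {0..T}"
  have "(\<lambda>\<eta>. (s - \<eta>) powr (1 - \<rho> - 1) * (h \<eta> - h 0)) absolutely_integrable_on {0..s}"
    using rho s by (intro frac_int_kernel_absolutely_integrable continuous_intros h_sub) auto
  moreover have "(s - \<eta>) powr (1 - \<rho> - 1) * (h \<eta> - h 0) = (h \<eta> - h 0) / (s - \<eta>) powr \<rho>" for \<eta>
    by (simp add: powr_minus divide_inverse mult.commute)
  ultimately show "(\<lambda>\<eta>. (h \<eta> - h 0) / (s - \<eta>) powr \<rho>) absolutely_integrable_on {0..s}" by simp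
next
  have prim: "integral {0..s} G = caputo_primitive \<rho> h s" if s: "s \<in> {0..T}" for s
  proof -
    have "caputo_primitive \<rho> h s = frac_int (1 - \<rho>) (\<lambda>\<eta>. h \<eta> - h 0) s"
      using s by (intro caputo_primitive_frac_int rho continuous_on_subset[OF h]) auto
    also have "\<dots> = frac_int (1 - \<rho>) (frac_int \<rho> G) s"
    proof (rule frac_int_cong[OF _ s])
      fix \<eta> assume "\<eta> \<in> {0..s}"
      hence "\<eta> \<in> {0..T}" using s by auto
      from eq[OF this] show "h \<eta> - h 0 = frac_int \<rho> G \<eta>" by linarith
    qed (use rho in simp)
    also have "\<dots> = integral {0..s} G"
      using s by (intro frac_int_frac_int rho continuous_on_subset[OF G]) auto
    finally show ?thesis by simp
  qed
  show "(caputo_primitive \<rho> h has_real_derivative G t) (at t within {0..T})"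
    by (rule has_field_derivative_transform_within[OF integral_has_real_derivative[OF G t] zero_less_one t])
       (simp add: prim)
qed

text \<open>The converse direction. The derivative is known only for positive times; continuity of
  the primitive at 0 still identifies it with the integral of G, and injectivity of the fractional
  integral of order \<open>1 - \<rho>\<close> recovers h.\<close>

lemma frac_int_of_primitive:
  fixes \<rho> :: real
  assumes rho: "0 < \<rho>" "\<rho> < 1" and T: "0 < T" and h: "continuous_on {0..T} h" and G: "continuous_on {0..T} G"
    and deriv: "\<And>t. t \<in> {0<..T} \<Longrightarrow>
      (frac_int (1 - \<rho>) (\<lambda>\<eta>. h \<eta> - h 0) has_real_derivative G t) (at t within {0..T})"
    and t: "t \<in> {0..T}"
  shows "h t = h 0 + frac_int \<rho> G t"
proof -
  let ?P = "frac_int (1 - \<rho>) (\<lambda>\<eta>. h \<eta> - h 0)"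
  have h0: "continuous_on {0..T} (\<lambda>\<eta>. h \<eta> - h 0)" by (intro continuous_intros h)
  have J: "continuous_on {0..T} (frac_int \<rho> G)" by (rule continuous_on_frac_int[OF rho(1) G])
  have P_cont: "continuous_on {0..T} ?P" using rho by (intro continuous_on_frac_int h0) auto
  have P: "?P s = integral {0..s} G" if s: "s \<in> {0..T}" for s
  proof -
    have "(G has_integral ?P s - ?P 0) {0..s}"
    proof (rule fundamental_theorem_of_calculus_interior)
      show "continuous_on {0..s} ?P" by (rule continuous_on_subset[OF P_cont]) (use s in auto)
      fix x assume x: "x \<in> {0<..<s}"
      have "(?P has_real_derivative G x) (at x within {0..T})" by (rule deriv) (use x s in auto)
      moreover have "at x within {0..T} = at x" by (rule at_within_Icc_at) (use x s in auto)
      ultimately show "(?P has_vector_derivative G x) (at x)"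
        by (simp add: has_real_derivative_iff_has_vector_derivative)
    qed (use s in auto)
    thus ?thesis by (simp add: integral_unique)
  qed
  have "(h t - h 0) - frac_int \<rho> G t = 0"
  proof (rule frac_int_eq_0_imp[of "1 - \<rho>" T "\<lambda>t. (h t - h 0) - frac_int \<rho> G t"])
    fix s assume s: "s \<in> {0..T}"
    have "frac_int (1 - \<rho>) (\<lambda>t. (h t - h 0) - frac_int \<rho> G t) s = ?P s - frac_int (1 - \<rho>) (frac_int \<rho> G) s"
      using rho by (intro frac_int_diff[OF _ h0 J s]) auto
    also have "frac_int (1 - \<rho>) (frac_int \<rho> G) s = integral {0..s} G"
      using s by (intro frac_int_frac_int rho continuous_on_subset[OF G]) auto
    finally show "frac_int (1 - \<rho>) (\<lambda>t. (h t - h 0) - frac_int \<rho> G t) s = 0" using P[OF s] by simp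
  qed (use rho T t in \<open>auto intro!: continuous_intros h J\<close>)
  thus ?thesis by simp
qed

text \<open>For a continuously differentiable function the Caputo derivative is the fractional
  integral of order \<open>1 - \<rho>\<close> of the derivative, so composition with order
  \<open>\<rho>\<close> returns the increment.\<close>

lemma caputo_C1:
  fixes \<rho> :: real
  assumes rho: "0 < \<rho>" "\<rho> < 1" and psi: "C1_on T \<psi>"
  shows "continuous_on {0..T} (caputo \<rho> \<psi>)"
    and "t \<in> {0..T} \<Longrightarrow> \<psi> t = \<psi> 0 + frac_int \<rho> (caputo \<rho> \<psi>) t"
proof -
  obtain d where d: "continuous_on {0..T} d"
    "\<And>t. t \<in> {0..T} \<Longrightarrow> (\<psi> has_real_derivative d t) (at t within {0..T})"
    using psi by (auto simp: C1_on_def)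
  have eq: "caputo \<rho> \<psi> t = frac_int (1 - \<rho>) d t" if t: "t \<in> {0..T}" for t
  proof -
    have G0: "Gamma (1 - \<rho>) \<noteq> 0" using Gamma_real_pos[of "1 - \<rho>", THEN less_imp_neq] rho by simp
    have "((\<lambda>\<eta>. (t - \<eta>) powr (1 - \<rho> - 1) * d \<eta>) has_integral Gamma (1 - \<rho>) * frac_int (1 - \<rho>) d t) {0..t}"
      using rho t by (intro frac_int_has_integral continuous_on_subset[OF d(1)]) auto
    hence "((\<lambda>\<eta>. deriv \<psi> \<eta> / (t - \<eta>) powr \<rho>) has_integral Gamma (1 - \<rho>) * frac_int (1 - \<rho>) d t) {0..t}"
    proof (rule has_integral_spike[rotated 2])
      \<comment> \<open>\<open>deriv\<close> is the two-sided derivative and is compared with d only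
        at interior points.\<close>
      show "negligible {0, t}" by simp
      fix \<eta> assume \<eta>: "\<eta> \<in> {0..t} - {0, t}"
      have "at \<eta> within {0..T} = at \<eta>" by (rule at_within_Icc_at) (use \<eta> t in auto)
      hence "deriv \<psi> \<eta> = d \<eta>" using d(2)[of \<eta>] \<eta> t by (intro DERIV_imp_deriv) auto
      thus "deriv \<psi> \<eta> / (t - \<eta>) powr \<rho> = (t - \<eta>) powr (1 - \<rho> - 1) * d \<eta>"
        by (simp add: powr_minus divide_inverse mult.commute)
    qed
    thus ?thesis using G0 by (simp add: caputo_def integral_unique)
  qed
  show "continuous_on {0..T} (caputo \<rho> \<psi>)"
    by (subst continuous_on_cong[OF refl eq]) (use rho in \<open>auto intro!: continuous_on_frac_int d\<close>)
  assume t: "t \<in> {0..T}"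
  have "frac_int \<rho> (caputo \<rho> \<psi>) t = frac_int \<rho> (frac_int (1 - \<rho>) d) t"
    by (rule frac_int_cong[OF rho(1) t]) (use t eq in auto)
  also have "\<dots> = integral {0..t} d"
    using frac_int_frac_int[of "1 - \<rho>" t d] rho t continuous_on_subset[OF d(1), of "{0..t}"] by auto
  also have "\<dots> = \<psi> t - \<psi> 0"
  proof (rule integral_unique, rule fundamental_theorem_of_calculus)
    fix x assume x: "x \<in> {0..t}"
    have "(\<psi> has_real_derivative d x) (at x within {0..t})"
      by (rule has_field_derivative_subset[OF d(2)]) (use x t in auto)
    thus "(\<psi> has_vector_derivative d x) (at x within {0..t})"
      by (simp add: has_real_derivative_iff_has_vector_derivative)
  qed (use t in auto)
  finally show "\<psi> t = \<psi> 0 + frac_int \<rho> (caputo \<rho> \<psi>) t" by simp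
qed

section \<open>Continuity and differentiation of sine series\<close>

lemma continuous_on_trig_series:
  fixes a :: "nat \<Rightarrow> real \<Rightarrow> real" and w :: "nat \<Rightarrow> real \<Rightarrow> real"
  assumes a: "\<And>k. continuous_on J (a k)" "uniformly_convergent_on J (\<lambda>n t. \<Sum>k<n. \<bar>a k t\<bar>)"
    and w: "\<And>k. continuous_on X (w k)" "\<And>k x. \<bar>w k x\<bar> \<le> 1"
  shows "continuous_on (X \<times> J) (\<lambda>(x, t). \<Sum>k. a k t * w k x)"
proof -
  have "uniformly_convergent_on (X \<times> J) (\<lambda>n z. \<Sum>k<n. \<bar>a k (snd z)\<bar>)"
    using a(2) unfolding uniformly_convergent_series_iff by fastforce
  hence "uniformly_convergent_on (X \<times> J) (\<lambda>n z. \<Sum>k<n. a k (snd z) * w k (fst z))"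
    by (rule uniformly_convergent_series_comparison) (use w(2) in \<open>auto simp: abs_mult intro!: mult_left_le\<close>)
  hence "continuous_on (X \<times> J) (\<lambda>z. \<Sum>k. a k (snd z) * w k (fst z))"
    by (rule continuous_on_series)
       (auto intro!: continuous_intros continuous_on_compose2[OF a(1)] continuous_on_compose2[OF w(1)])
  thus ?thesis by (simp add: case_prod_beta)
qed

lemma trig_series_derivative:
  fixes a :: "nat \<Rightarrow> real"
  assumes a: "summable a'" "\<And>k. \<bar>a k * freq l k\<bar> \<le> a' k" and l: "0 < l" and x: "x \<in> {0..l}"
  shows "((\<lambda>x. \<Sum>k. a k * sin (freq l k * x)) has_real_derivative (\<Sum>k. (a k * freq l k) * cos (freq l k * x)))
      (at x within {0..l})"
    and "summable a \<Longrightarrow> ((\<lambda>x. \<Sum>k. a k * cos (freq l k * x)) has_real_derivative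
      (\<Sum>k. - (a k * freq l k) * sin (freq l k * x))) (at x within {0..l})"
proof -
  have conv: "uniform_limit {0..l} (\<lambda>n x. \<Sum>k<n. b k * w k x) (\<lambda>x. \<Sum>k. b k * w k x) sequentially"
    if "\<And>k. \<bar>b k\<bar> = \<bar>a k * freq l k\<bar>" "\<And>k x. \<bar>w k x\<bar> \<le> 1" for b :: "nat \<Rightarrow> real" and w :: "nat \<Rightarrow> real \<Rightarrow> real"
  proof (rule uniformly_convergent_series_limit(1)[OF uniformly_convergent_series_comparison[OF
        uniformly_convergent_series_const[OF a(1)]]])
    fix k x
    have "\<bar>b k * w k x\<bar> \<le> \<bar>b k\<bar>" unfolding abs_mult by (intro mult_left_le that) auto
    thus "\<bar>b k * w k x\<bar> \<le> a' k" using that(1)[of k] a(2)[of k] by simp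
  qed
  have "\<exists>g. \<forall>x\<in>{0..l}. (\<lambda>k. a k * sin (freq l k * x)) sums g x \<and>
      (g has_field_derivative (\<Sum>k. (a k * freq l k) * cos (freq l k * x))) (at x within {0..l})"
    by (rule has_field_derivative_series[where f' = "\<lambda>k x. (a k * freq l k) * cos (freq l k * x)" and ?x0.0 = 0])
       (use l in \<open>auto intro!: derivative_eq_intros conv\<close>)
  then obtain g where g: "\<And>x. x \<in> {0..l} \<Longrightarrow> (\<lambda>k. a k * sin (freq l k * x)) sums g x"
    "\<And>x. x \<in> {0..l} \<Longrightarrow> (g has_real_derivative (\<Sum>k. (a k * freq l k) * cos (freq l k * x))) (at x within {0..l})" by blast
  show "((\<lambda>x. \<Sum>k. a k * sin (freq l k * x)) has_real_derivative (\<Sum>k. (a k * freq l k) * cos (freq l k * x)))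
      (at x within {0..l})"
    by (rule has_field_derivative_transform_within[OF g(2)[OF x] zero_less_one x]) (use g(1) in \<open>auto simp: sums_iff\<close>)
  assume "summable a"
  have "\<exists>g. \<forall>x\<in>{0..l}. (\<lambda>k. a k * cos (freq l k * x)) sums g x \<and>
      (g has_field_derivative (\<Sum>k. - (a k * freq l k) * sin (freq l k * x))) (at x within {0..l})"
    by (rule has_field_derivative_series[where f' = "\<lambda>k x. - (a k * freq l k) * sin (freq l k * x)" and ?x0.0 = 0])
       (use l \<open>summable a\<close> conv[of "\<lambda>k. - (a k * freq l k)" "\<lambda>k x. sin (freq l k * x)"] in \<open>auto intro!: derivative_eq_intros\<close>)
  then obtain g where g: "\<And>x. x \<in> {0..l} \<Longrightarrow> (\<lambda>k. a k * cos (freq l k * x)) sums g x"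
    "\<And>x. x \<in> {0..l} \<Longrightarrow> (g has_real_derivative (\<Sum>k. - (a k * freq l k) * sin (freq l k * x))) (at x within {0..l})" by blast
  show "((\<lambda>x. \<Sum>k. a k * cos (freq l k * x)) has_real_derivative (\<Sum>k. - (a k * freq l k) * sin (freq l k * x)))
      (at x within {0..l})"
    by (rule has_field_derivative_transform_within[OF g(2)[OF x] zero_less_one x]) (use g(1) in \<open>auto simp: sums_iff\<close>)
qed

lemma C1x_sine_series:
  assumes l: "0 < l" and a: "\<And>k. continuous_on J (a k)"
    and conv: "uniformly_convergent_on J (\<lambda>n t. \<Sum>k<n. \<bar>a k t * freq l k\<bar>)"
  shows "C1x J l (\<lambda>x t. \<Sum>k. a k t * sin (freq l k * x))"
proof -
  have conv0: "uniformly_convergent_on J (\<lambda>n t. \<Sum>k<n. \<bar>a k t\<bar>)"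
  proof (rule uniformly_convergent_series_comparison[OF uniformly_convergent_series_cmult[OF conv, of "1 / freq l 0"]])
    fix k t
    have "\<bar>a k t\<bar> * freq l 0 \<le> \<bar>a k t\<bar> * freq l k" by (intro mult_left_mono freq_mono l) auto
    thus "\<bar>\<bar>a k t\<bar>\<bar> \<le> 1 / freq l 0 * \<bar>a k t * freq l k\<bar>"
      using freq_pos[OF l, of 0] freq_pos[OF l, of k] by (simp add: abs_mult field_simps)
  qed
  show ?thesis
    unfolding C1x_def
  proof (intro conjI exI[of _ "\<lambda>x t. \<Sum>k. (a k t * freq l k) * cos (freq l k * x)"] ballI)
    show "continuous_on ({0..l} \<times> J) (\<lambda>(x, t). \<Sum>k. a k t * sin (freq l k * x))"
      by (rule continuous_on_trig_series[OF a conv0]) (auto intro!: continuous_intros)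
    show "continuous_on ({0..l} \<times> J) (\<lambda>(x, t). \<Sum>k. (a k t * freq l k) * cos (freq l k * x))"
      by (rule continuous_on_trig_series[OF _ conv]) (auto intro!: continuous_intros a)
    show "((\<lambda>y. \<Sum>k. a k t * sin (freq l k * y)) has_real_derivative
        (\<Sum>k. (a k t * freq l k) * cos (freq l k * x))) (at x within {0..l})"
      if "x \<in> {0..l}" "t \<in> J" for x t
      by (rule trig_series_derivative(1)[OF uniformly_convergent_series_limit(2)[OF conv that(2)] _ l that(1)]) simp
  qed
qed

lemma derivative_within_Icc_unique:
  fixes g :: "real \<Rightarrow> real"
  assumes "0 < l" "x \<in> {0..l}"
    and "(g has_real_derivative a) (at x within {0..l})" "(g has_real_derivative b) (at x within {0..l})"
  shows "a = b"
  using vector_derivative_within_closed_interval[of 0 l x g a] vector_derivative_within_closed_interval[of 0 l x g b] assms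
  by (simp add: has_real_derivative_iff_has_vector_derivative)

lemma navier_expansion:
  assumes l: "0 < l" and g: "navier l g"
  shows "summable (\<lambda>k. freq l k ^ 3 * \<bar>fourier_coeff l k g\<bar>)"
    and "x \<in> {0..l} \<Longrightarrow> g x = (\<Sum>k. fourier_coeff l k g * sin (freq l k * x))"
    and "xderiv l 1 g 0 = (\<Sum>k. freq l k * fourier_coeff l k g)"
proof -
  define b where "b k = fourier_coeff l k g" for k
  define M where "M = 2 / l * (L2_norm l (wderiv l 4 g))\<^sup>2 + 1"
  have "0 \<le> 2 / l * (L2_norm l (wderiv l 4 g))\<^sup>2" using l by simp
  hence M: "M > 0" by (simp add: M_def)
  have sq: "(\<Sum>k<n. (freq l k ^ 4 * \<bar>b k\<bar>)\<^sup>2) \<le> M" for n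
    using navier_coeff_squares[OF l g, of n] by (simp add: M_def b_def power_mult_distrib)
  have "uniformly_convergent_on (UNIV :: real set) (\<lambda>n t. \<Sum>k<n. freq l k ^ 3 * \<bar>b k\<bar>)"
    by (rule uniformly_convergent_cubes[OF l M]) (rule sq)
  thus cubes: "summable (\<lambda>k. freq l k ^ 3 * \<bar>fourier_coeff l k g\<bar>)"
    using uniformly_convergent_series_limit(2)[of "UNIV :: real set" "\<lambda>k t. freq l k ^ 3 * \<bar>b k\<bar>" 0]
    by (simp add: b_def)
  have pw: "\<bar>b k * freq l k ^ j\<bar> \<le> 1 / freq l 0 ^ (3 - j) * (freq l k ^ 3 * \<bar>b k\<bar>)" if j: "j \<le> 3" for k j
  proof -
    have "freq l k ^ j * freq l 0 ^ (3 - j) \<le> freq l k ^ j * freq l k ^ (3 - j)"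
      using freq_mono[OF l, of k] freq_pos[OF l] by (intro mult_left_mono power_mono) (auto intro: less_imp_le)
    also have "\<dots> = freq l k ^ 3" using j by (simp flip: power_add)
    finally have "freq l k ^ j * freq l 0 ^ (3 - j) * \<bar>b k\<bar> \<le> freq l k ^ 3 * \<bar>b k\<bar>" by (intro mult_right_mono) auto
    moreover have "\<bar>freq l k\<bar> = freq l k" using freq_pos[OF l, of k] by simp
    ultimately show ?thesis
      using freq_pos[OF l, of 0] by (simp add: abs_mult power_abs field_simps)
  qed
  note maj = summable_mult[OF cubes, folded b_def]
  have s0: "summable (\<lambda>k. \<bar>b k\<bar>)"
    by (rule summable_comparison_test'[OF maj[of "1 / freq l 0 ^ 3"], of 0]) (use pw[of 0] in simp)
  have gc: "continuous_on {0..l} g" using g by (simp add: navier_def W2_rep_def)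
  show exp: "g x = (\<Sum>k. fourier_coeff l k g * sin (freq l k * x))" if "x \<in> {0..l}" for x
    by (rule sine_series_expansion[OF l gc s0[unfolded b_def] that])
  have "((\<lambda>x. \<Sum>k. b k * sin (freq l k * x)) has_real_derivative (\<Sum>k. (b k * freq l k) * cos (freq l k * 0)))
      (at 0 within {0..l})"
    using pw[of 1] l by (intro trig_series_derivative(1)[OF maj[of "1 / freq l 0 ^ 2"]]) auto
  hence d: "(g has_real_derivative (\<Sum>k. freq l k * b k)) (at 0 within {0..l})"
    using has_field_derivative_transform_within[OF _ zero_less_one, of _ _ 0 "{0..l}" g] exp l
    by (simp add: b_def mult.commute)
  have "(g has_vector_derivative (\<Sum>k. freq l k * b k)) (at 0 within {0..l})"
    using d by (simp add: has_real_derivative_iff_has_vector_derivative)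
  thus "xderiv l 1 g 0 = (\<Sum>k. freq l k * fourier_coeff l k g)"
    using vector_derivative_within_closed_interval[of 0 l 0 g] l by (simp add: b_def)
qed

lemma continuous_on_compose_Pair:
  assumes v: "continuous_on (X \<times> J) (\<lambda>(x, t). v x t)" and a: "continuous_on S a" and b: "continuous_on S b"
    and mem: "\<And>z. z \<in> S \<Longrightarrow> a z \<in> X" "\<And>z. z \<in> S \<Longrightarrow> b z \<in> J"
  shows "continuous_on S (\<lambda>z. v (a z) (b z))"
  using continuous_on_compose2[OF v continuous_on_Pair[OF a b]] mem by auto

locale inverse_problem =
  fixes \<rho> l T :: real and \<sigma> \<phi> \<psi> :: "real \<Rightarrow> real" and f :: "real \<Rightarrow> real \<Rightarrow> real"
  assumes \<rho>: "0 < \<rho>" "\<rho> < 1" and l: "0 < l" and T_pos: "0 < T"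
    and \<sigma>: "continuous_on {0..T} \<sigma>" "\<And>t. t \<in> {0..T} \<Longrightarrow> 0 \<le> \<sigma> t"
    and f: "C_W2 4 l T f" "\<And>t. t \<in> {0..T} \<Longrightarrow> navier l (\<lambda>x. f x t)"
      "\<And>k t. t \<in> {0..T} \<Longrightarrow> 0 \<le> fourier_coeff l k (\<lambda>x. f x t)"
    and \<phi>: "navier l \<phi>" "\<And>k. 0 \<le> fourier_coeff l k \<phi>"
    and \<psi>: "C1_on T \<psi>" "\<And>t. t \<in> {0..T} \<Longrightarrow> 0 < \<psi> t"
    and compat: "xderiv l 1 \<phi> 0 = \<psi> 0"
    and caputo_le: "\<And>t. t \<in> {0..T} \<Longrightarrow> caputo \<rho> \<psi> t \<le> xderiv l 1 (\<lambda>x. f x t) 0"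
begin

lemma f_coeff_conv:
  "uniformly_convergent_on {0..T} (\<lambda>n t. \<Sum>k<n. freq l k ^ 3 * fourier_coeff l k (\<lambda>x. f x t))"
proof -
  obtain M where M: "0 < M" "\<And>t n. t \<in> {0..T} \<Longrightarrow>
      (\<Sum>k<n. (freq l k ^ 4 * fourier_coeff l k (\<lambda>x. f x t))\<^sup>2) \<le> M"
    using C_W2_coeff_squares_bounded[OF l T_pos f(1,2)] by blast
  show ?thesis by (rule uniformly_convergent_cubes[OF l M])
qed

text \<open>The x-derivative at 0 of a sine expansion is the frequency-weighted sum of its
  coefficients; this translates \<open>compat\<close> and \<open>caputo_le\<close> into the
  conditions on \<open>\<psi>\<close> in the abstract setting.\<close>

sublocale fractional_inverse_modes \<rho> T "freq l" \<sigma> "\<lambda>k t. fourier_coeff l k (\<lambda>x. f x t)"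
  "\<lambda>k. fourier_coeff l k \<phi>" \<psi> "caputo \<rho> \<psi>"
proof
  show "continuous_on {0..T} \<psi>"
    using \<psi>(1) unfolding C1_on_def by (meson DERIV_continuous_on)
  show "summable (\<lambda>k. freq l k ^ 3 * fourier_coeff l k \<phi>)"
    using navier_expansion(1)[OF l \<phi>(1)] \<phi>(2) by simp
  show "\<psi> 0 = (\<Sum>k. freq l k * fourier_coeff l k \<phi>)"
    using navier_expansion(3)[OF l \<phi>(1)] compat by simp
  show "caputo \<rho> \<psi> t \<le> (\<Sum>k. freq l k * fourier_coeff l k (\<lambda>x. f x t))" if "t \<in> {0..T}" for t
    using navier_expansion(3)[OF l f(2)[OF that]] caputo_le[OF that] by simp
qed (use \<rho> T_pos \<sigma> l f \<phi>(2) \<psi>(2) freq_pos[OF l] freq_mono[OF l] f_coeff_conv caputo_C1[OF \<rho> \<psi>(1)]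
      C_W2_coeff_continuous[OF l f(1,2)] in \<open>blast+\<close>)

section \<open>Synthesis: a fixed point of the feedback gives a solution\<close>

lemma mode_abs_conv:
  assumes q: "continuous_on {0..T} q" and j: "j \<le> 3"
  shows "uniformly_convergent_on {0..T} (\<lambda>n t. \<Sum>k<n. \<bar>mode q k t * freq l k ^ j\<bar>)"
proof (rule uniformly_convergent_series_comparison[OF uniformly_convergent_series_cmult[OF mode_conv[OF q],
      of "1 / freq l 0 ^ (3 - j)"]])
  fix k t assume t: "t \<in> {0..T}"
  have "freq l k ^ j * mode q k t \<le> freq l k ^ 3 / freq l 0 ^ (3 - j) * mode q k t"
    by (intro mult_right_mono kappa_power_le j mode_nonneg q t)
  thus "\<bar>\<bar>mode q k t * freq l k ^ j\<bar>\<bar> \<le> 1 / freq l 0 ^ (3 - j) * (freq l k ^ 3 * mode q k t)"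
    using mode_nonneg[OF q t, of k] kappa_pos[of k] by (simp add: abs_mult mult_ac)
qed

lemma mode_abs_summable:
  assumes "continuous_on {0..T} q" "j \<le> 3" "t \<in> {0..T}"
  shows "summable (\<lambda>k. \<bar>mode q k t * freq l k ^ j\<bar>)" "summable (\<lambda>k. mode q k t * freq l k ^ j)"
proof -
  show "summable (\<lambda>k. \<bar>mode q k t * freq l k ^ j\<bar>)"
    by (rule uniformly_convergent_series_limit(2)[OF mode_abs_conv[OF assms(1,2)] assms(3)])
  thus "summable (\<lambda>k. mode q k t * freq l k ^ j)" by (rule summable_rabs_cancel)
qed

text \<open>The sine coefficients of the Caputo derivative of the series solution.\<close>

definition rhs :: "(real \<Rightarrow> real) \<Rightarrow> nat \<Rightarrow> real \<Rightarrow> real" where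
  "rhs q k t = fourier_coeff l k (\<lambda>x. f x t) - (\<sigma> t * (freq l k)\<^sup>2 + q t) * mode q k t"

lemma rhs_cont: "continuous_on {0..T} q \<Longrightarrow> continuous_on {0..T} (rhs q k)"
  unfolding rhs_def by (rule mode_rhs_cont)

lemma rhs_abs_conv:
  assumes q: "continuous_on {0..T} q"
  shows "uniformly_convergent_on {0..T} (\<lambda>n t. \<Sum>k<n. \<bar>rhs q k t * freq l k\<bar>)"
    and "uniformly_convergent_on {0..T} (\<lambda>n t. \<Sum>k<n. \<bar>rhs q k t\<bar>)"
proof -
  show *: "uniformly_convergent_on {0..T} (\<lambda>n t. \<Sum>k<n. \<bar>rhs q k t * freq l k\<bar>)"
    using mode_rhs_conv[OF q] by (simp add: rhs_def mult.commute)
  show "uniformly_convergent_on {0..T} (\<lambda>n t. \<Sum>k<n. \<bar>rhs q k t\<bar>)"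
  proof (rule uniformly_convergent_series_comparison[OF uniformly_convergent_series_cmult[OF *, of "1 / freq l 0"]])
    fix k t
    have "\<bar>rhs q k t\<bar> * freq l 0 \<le> \<bar>rhs q k t\<bar> * freq l k" by (intro mult_left_mono freq_mono l) auto
    thus "\<bar>\<bar>rhs q k t\<bar>\<bar> \<le> 1 / freq l 0 * \<bar>rhs q k t * freq l k\<bar>"
      using freq_pos[OF l, of 0] freq_pos[OF l, of k] by (simp add: abs_mult field_simps)
  qed
qed

definition series_solution :: "(real \<Rightarrow> real) \<Rightarrow> real \<Rightarrow> real \<Rightarrow> real" where
  "series_solution q x t = (\<Sum>k. mode q k t * sin (freq l k * x))"

lemma series_solution_derivative:
  assumes q: "continuous_on {0..T} q" and x: "x \<in> {0..l}" and t: "t \<in> {0..T}"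
  shows "((\<lambda>y. series_solution q y t) has_real_derivative (\<Sum>k. (mode q k t * freq l k) * cos (freq l k * x)))
    (at x within {0..l})"
  unfolding series_solution_def
  by (rule trig_series_derivative(1)[OF _ _ l x, of "\<lambda>k. \<bar>mode q k t * freq l k ^ 1\<bar>"])
     (use mode_abs_summable(1)[OF q _ t, of 1] in auto)

lemma series_solution_continuous_t:
  assumes q: "continuous_on {0..T} q"
  shows "continuous_on {0..T} (series_solution q x)"
  unfolding series_solution_def
proof (rule continuous_on_series)
  show "uniformly_convergent_on {0..T} (\<lambda>n t. \<Sum>k<n. mode q k t * sin (freq l k * x))"
    by (rule uniformly_convergent_series_comparison[OF mode_abs_conv[OF q, of 0]])
       (auto simp: abs_mult intro!: mult_left_le)
qed (auto intro!: continuous_intros mode_cont q)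

lemma series_solution_initial:
  assumes q: "continuous_on {0..T} q" and x: "x \<in> {0..l}"
  shows "series_solution q x 0 = \<phi> x"
  using navier_expansion(2)[OF l \<phi>(1) x] mode_eq[OF q, of 0] T_pos by (simp add: series_solution_def)

text \<open>The integrated mode equations are summed, and only then is the Caputo derivative taken,
  so no fractional derivative has to be exchanged with a series.\<close>

lemma series_solution_has_caputo:
  assumes q: "continuous_on {0..T} q" and t: "t \<in> {0..T}"
  shows "has_caputo \<rho> T (series_solution q x) (\<Sum>k. rhs q k t * sin (freq l k * x)) t"
proof (rule has_caputo_frac_int[OF \<rho> series_solution_continuous_t[OF q] _ _ t])
  have conv: "uniformly_convergent_on {0..T} (\<lambda>n t. \<Sum>k<n. rhs q k t * sin (freq l k * x))"
    by (rule uniformly_convergent_series_comparison[OF rhs_abs_conv(2)[OF q]])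
       (auto simp: abs_mult intro!: mult_left_le)
  show "continuous_on {0..T} (\<lambda>t. \<Sum>k. rhs q k t * sin (freq l k * x))"
    by (rule continuous_on_series[OF conv]) (auto intro!: continuous_intros rhs_cont q)
  fix s assume s: "s \<in> {0..T}"
  have zero: "0 \<in> {0..T}" using T_pos by simp
  have "(\<lambda>k. mode q k 0 * sin (freq l k * x)) sums series_solution q x 0"
    unfolding series_solution_def
    by (intro summable_sums summable_rabs_cancel[OF summable_comparison_test'[OF mode_abs_summable(1)[OF q _ zero, of 0], of 0]])
       (auto simp: abs_mult intro!: mult_left_le)
  moreover have "(\<lambda>k. frac_int \<rho> (\<lambda>t. rhs q k t * sin (freq l k * x)) s) sums
      frac_int \<rho> (\<lambda>t. \<Sum>k. rhs q k t * sin (freq l k * x)) s"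
    by (rule frac_int_series[OF \<rho>(1) _ conv s]) (auto intro!: continuous_intros rhs_cont q)
  ultimately have "(\<lambda>k. mode q k 0 * sin (freq l k * x) + frac_int \<rho> (\<lambda>t. rhs q k t * sin (freq l k * x)) s) sums
      (series_solution q x 0 + frac_int \<rho> (\<lambda>t. \<Sum>k. rhs q k t * sin (freq l k * x)) s)"
    by (rule sums_add)
  moreover have "mode q k 0 * sin (freq l k * x) + frac_int \<rho> (\<lambda>t. rhs q k t * sin (freq l k * x)) s =
      mode q k s * sin (freq l k * x)" for k
  proof -
    have "frac_int \<rho> (\<lambda>t. rhs q k t * sin (freq l k * x)) s = sin (freq l k * x) * frac_int \<rho> (rhs q k) s"
      using frac_int_cmult[of \<rho> "sin (freq l k * x)" "rhs q k" s] by (simp add: mult.commute)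
    moreover have "mode q k s = mode q k 0 + frac_int \<rho> (rhs q k) s"
      using mode_eq[OF q s, of k] mode_eq[OF q zero, of k] by (simp add: rhs_def[abs_def])
    ultimately show ?thesis by (simp add: algebra_simps)
  qed
  ultimately show "series_solution q x s = series_solution q x 0 + frac_int \<rho> (\<lambda>t. \<Sum>k. rhs q k t * sin (freq l k * x)) s"
    by (simp add: series_solution_def sums_iff)
qed

lemma C1x_subset: "C1x J l v \<Longrightarrow> J' \<subseteq> J \<Longrightarrow> C1x J' l v"
  unfolding C1x_def by (meson Sigma_mono continuous_on_subset order_refl subset_iff)

lemma series_solution_equation:
  assumes q: "continuous_on {0..T} q" and x: "x \<in> {0..l}" and t: "t \<in> {0..T}"
  shows "(\<Sum>k. rhs q k t * sin (freq l k * x)) - \<sigma> t * (\<Sum>k. - (mode q k t * freq l k ^ 2) * sin (freq l k * x)) +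
    q t * series_solution q x t = f x t"
proof -
  have sin_sum: "(\<lambda>k. a k * sin (freq l k * x)) sums (\<Sum>k. a k * sin (freq l k * x))" if "summable (\<lambda>k. \<bar>a k\<bar>)" for a
    by (intro summable_sums summable_rabs_cancel[OF summable_comparison_test'[OF that, of 0]])
       (auto simp: abs_mult intro!: mult_left_le)
  have 1: "summable (\<lambda>k. \<bar>rhs q k t\<bar>)" by (rule uniformly_convergent_series_limit(2)[OF rhs_abs_conv(2)[OF q] t])
  have 2: "summable (\<lambda>k. \<bar>- (mode q k t * freq l k ^ 2)\<bar>)" using mode_abs_summable(1)[OF q _ t, of 2] by simp
  have 3: "summable (\<lambda>k. \<bar>mode q k t\<bar>)" using mode_abs_summable(1)[OF q _ t, of 0] by simp
  have "(\<lambda>k. rhs q k t * sin (freq l k * x) - \<sigma> t * (- (mode q k t * freq l k ^ 2) * sin (freq l k * x)) +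
      q t * (mode q k t * sin (freq l k * x))) sums
      ((\<Sum>k. rhs q k t * sin (freq l k * x)) - \<sigma> t * (\<Sum>k. - (mode q k t * freq l k ^ 2) * sin (freq l k * x)) +
      q t * series_solution q x t)"
    unfolding series_solution_def by (intro sums_add sums_diff sums_mult sin_sum 1 2 3)
  moreover have "rhs q k t * sin (freq l k * x) - \<sigma> t * (- (mode q k t * freq l k ^ 2) * sin (freq l k * x)) +
      q t * (mode q k t * sin (freq l k * x)) = fourier_coeff l k (\<lambda>x. f x t) * sin (freq l k * x)" for k
    by (simp add: rhs_def algebra_simps)
  ultimately show ?thesis
    using navier_expansion(2)[OF l f(2)[OF t] x] by (simp add: sums_iff)
qed

theorem series_solution_solves:
  assumes q: "continuous_on {0..T} q" and fix_q: "\<And>t. t \<in> {0..T} \<Longrightarrow> q t = feedback q t"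
  shows "inverse_solution \<rho> l T \<sigma> f \<phi> \<psi> (series_solution q) q"
proof -
  have "C1x {0..T} l (series_solution q)"
    unfolding series_solution_def using mode_abs_conv[OF q, of 1]
    by (intro C1x_sine_series[OF l mode_cont[OF q]]) simp
  moreover have "\<exists>Du ux uxx. C1x {0<..T} l Du \<and> C1x {0<..T} l uxx \<and>
        (\<forall>x\<in>{0..l}. \<forall>t\<in>{0<..T}.
           has_caputo \<rho> T (series_solution q x) (Du x t) t \<and>
           ((\<lambda>y. series_solution q y t) has_real_derivative ux x t) (at x within {0..l}) \<and>
           ((\<lambda>y. ux y t) has_real_derivative uxx x t) (at x within {0..l})) \<and>
        (\<forall>x\<in>{0<..<l}. \<forall>t\<in>{0<..T}. Du x t - \<sigma> t * uxx x t + q t * series_solution q x t = f x t)"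
  proof (intro exI conjI ballI)
    show "C1x {0<..T} l (\<lambda>x t. \<Sum>k. rhs q k t * sin (freq l k * x))"
      using C1x_sine_series[OF l rhs_cont[OF q] rhs_abs_conv(1)[OF q]] by (rule C1x_subset) auto
    \<comment> \<open>The x-derivative of \<open>uxx\<close> carries the weight
      \<open>freq^3\<close>, the weight controlled by \<open>mode_conv\<close>.\<close>
    have "uniformly_convergent_on {0..T} (\<lambda>n t. \<Sum>k<n. \<bar>- (mode q k t * freq l k ^ 2) * freq l k\<bar>)"
      using mode_abs_conv[OF q, of 3] by (simp add: abs_mult power3_eq_cube power2_eq_square mult.assoc)
    hence "C1x {0..T} l (\<lambda>x t. \<Sum>k. - (mode q k t * freq l k ^ 2) * sin (freq l k * x))"
      by (intro C1x_sine_series[OF l] continuous_intros mode_cont q)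
    thus "C1x {0<..T} l (\<lambda>x t. \<Sum>k. - (mode q k t * freq l k ^ 2) * sin (freq l k * x))"
      by (rule C1x_subset) auto
    fix x t assume x: "x \<in> {0..l}" and "t \<in> {0<..T}"
    hence t: "t \<in> {0..T}" by auto
    show "has_caputo \<rho> T (series_solution q x) (\<Sum>k. rhs q k t * sin (freq l k * x)) t"
      by (rule series_solution_has_caputo[OF q t])
    show "((\<lambda>y. series_solution q y t) has_real_derivative (\<Sum>k. (mode q k t * freq l k) * cos (freq l k * x)))
        (at x within {0..l})"
      by (rule series_solution_derivative[OF q x t])
    show "((\<lambda>y. \<Sum>k. (mode q k t * freq l k) * cos (freq l k * y)) has_real_derivative
        (\<Sum>k. - (mode q k t * freq l k ^ 2) * sin (freq l k * x))) (at x within {0..l})"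
      using trig_series_derivative(2)[of "\<lambda>k. \<bar>mode q k t * freq l k ^ 2\<bar>" "\<lambda>k. mode q k t * freq l k" l x]
        mode_abs_summable[OF q _ t, of 1] mode_abs_summable[OF q _ t, of 2] l x
      by (simp add: power2_eq_square mult.assoc)
  next
    fix x t assume "x \<in> {0<..<l}" "t \<in> {0<..T}"
    thus "(\<Sum>k. rhs q k t * sin (freq l k * x)) - \<sigma> t * (\<Sum>k. - (mode q k t * freq l k ^ 2) * sin (freq l k * x)) +
        q t * series_solution q x t = f x t"
      by (intro series_solution_equation q) auto
  qed
  moreover have "((\<lambda>x. series_solution q x t) has_real_derivative \<psi> t) (at 0 within {0..l})" if t: "t \<in> {0..T}" for t
    using series_solution_derivative[OF q _ t, of 0] flux_eq_psi[OF q fix_q t] l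
    by (simp add: mode_flux_def mult.commute)
  ultimately show ?thesis
    unfolding inverse_solution_def
    using q series_solution_initial[OF q] freq_boundary[OF l] by (simp add: series_solution_def)
qed

section \<open>Analysis: every solution is the series of a fixed point\<close>

lemma fourier_coeff_linear:
  assumes "continuous_on {0..l} g" "continuous_on {0..l} h"
  shows "fourier_coeff l k (\<lambda>x. g x + c * h x) = fourier_coeff l k g + c * fourier_coeff l k h"
proof -
  have "integral {0..l} (\<lambda>x. g x * sin (freq l k * x) + c * (h x * sin (freq l k * x))) =
      integral {0..l} (\<lambda>x. g x * sin (freq l k * x)) + c * integral {0..l} (\<lambda>x. h x * sin (freq l k * x))"
    by (intro integral_add_cmult continuous_intros assms)
  moreover have "(g x + c * h x) * sin (freq l k * x) = g x * sin (freq l k * x) + c * (h x * sin (freq l k * x))" for x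
    by (simp add: algebra_simps)
  ultimately show ?thesis unfolding fourier_coeff_def by (simp add: distrib_left)
qed

lemma fourier_coeff_continuous:
  fixes J :: "real set"
  assumes "continuous_on ({0..l} \<times> J) (\<lambda>(x, t). v x t)"
  shows "continuous_on J (\<lambda>t. fourier_coeff l k (\<lambda>x. v x t))"
proof -
  have "continuous_on (J \<times> cbox 0 l) (\<lambda>(t, x). v x t * sin (freq l k * x))"
    unfolding case_prod_beta
    by (intro continuous_on_mult continuous_on_compose_Pair[OF assms] continuous_intros) (auto simp: cbox_interval)
  from integral_continuous_on_param[OF this] show ?thesis
    unfolding fourier_coeff_def by (intro continuous_intros) (simp add: cbox_interval)
qed

text \<open>In the substituted form of \<open>frac_int\<close> the integrand is continuous on a
  rectangle, so the two integrals can be exchanged.\<close>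

lemma fourier_coeff_frac_int:
  assumes v: "continuous_on ({0..l} \<times> {0..T}) (\<lambda>(x, t). v x t)" and t: "t \<in> {0..T}" and r: "0 < r"
  shows "fourier_coeff l k (\<lambda>x. frac_int r (v x) t) = frac_int r (\<lambda>s. fourier_coeff l k (\<lambda>x. v x s)) t"
proof -
  let ?p = "\<lambda>s. t * (1 - s powr (1 / r))"
  define A where "A = t powr r / Gamma (r + 1)"
  have p: "continuous_on {0..1} ?p"
    using r by (intro continuous_intros continuous_on_powr_pos_exponent) auto
  have c: "continuous_on (cbox (0, 0) (l, 1)) (\<lambda>(x, s). v x (?p s) * sin (freq l k * x))"
    unfolding case_prod_beta cbox_Pair_eq
  proof (rule continuous_on_mult)
    show "continuous_on (cbox 0 l \<times> cbox 0 1) (\<lambda>z. v (fst z) (?p (snd z)))"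
      unfolding cbox_interval
      by (rule continuous_on_compose_Pair[OF v continuous_on_fst[OF continuous_on_id]
            continuous_on_compose2[OF p continuous_on_snd[OF continuous_on_id]]])
         (use frac_int_point_mem(2)[OF r _ t] in auto)
  qed (intro continuous_intros)
  have "integral {0..l} (\<lambda>x. frac_int r (v x) t * sin (freq l k * x)) =
      A * integral {0..l} (\<lambda>x. integral {0..1} (\<lambda>s. v x (?p s) * sin (freq l k * x)))"
    by (simp add: frac_int_def A_def mult_ac)
  also have "integral {0..l} (\<lambda>x. integral {0..1} (\<lambda>s. v x (?p s) * sin (freq l k * x))) =
      integral {0..1} (\<lambda>s. integral {0..l} (\<lambda>x. v x (?p s) * sin (freq l k * x)))"
    using integral_swap_continuous[OF c] by (simp add: cbox_interval)
  finally show ?thesis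
    unfolding fourier_coeff_def frac_int_def[of r "\<lambda>s. 2 / l * _ s"] A_def by (simp add: mult_ac)
qed

text \<open>u may have no time derivative, so the Caputo primitive is projected onto the sines: it
  is differentiated under the integral sign, the equation is inserted, and
  \<open>frac_int_of_primitive\<close> leads back to the integrated mode equation.\<close>

lemma solution_mode:
  assumes sol: "inverse_solution \<rho> l T \<sigma> f \<phi> \<psi> u q"
  shows "mode_solution q k (\<lambda>t. fourier_coeff l k (\<lambda>x. u x t))"
proof -
  define c where "c = (\<lambda>t. fourier_coeff l k (\<lambda>x. u x t))"
  obtain Du ux uxx where u: "C1x {0..T} l u" and q: "continuous_on {0..T} q"
    and C1: "C1x {0<..T} l Du" "C1x {0<..T} l uxx"
    and cap: "\<And>x t. x \<in> {0..l} \<Longrightarrow> t \<in> {0<..T} \<Longrightarrow> has_caputo \<rho> T (u x) (Du x t) t"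
    and dx: "\<And>x t. x \<in> {0..l} \<Longrightarrow> t \<in> {0<..T} \<Longrightarrow> ((\<lambda>y. u y t) has_real_derivative ux x t) (at x within {0..l})"
    and dxx: "\<And>x t. x \<in> {0..l} \<Longrightarrow> t \<in> {0<..T} \<Longrightarrow> ((\<lambda>y. ux y t) has_real_derivative uxx x t) (at x within {0..l})"
    and eq: "\<And>x t. x \<in> {0<..<l} \<Longrightarrow> t \<in> {0<..T} \<Longrightarrow> Du x t - \<sigma> t * uxx x t + q t * u x t = f x t"
    and init: "\<And>x. x \<in> {0..l} \<Longrightarrow> u x 0 = \<phi> x"
    and bc: "\<And>t. t \<in> {0..T} \<Longrightarrow> u 0 t = 0" "\<And>t. t \<in> {0..T} \<Longrightarrow> u l t = 0"
    using sol unfolding inverse_solution_def by blast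
  have u_cont: "continuous_on ({0..l} \<times> {0..T}) (\<lambda>(x, t). u x t)"
    and Du_cont: "continuous_on ({0..l} \<times> {0<..T}) (\<lambda>(x, t). Du x t)"
    and uxx_cont: "continuous_on ({0..l} \<times> {0<..T}) (\<lambda>(x, t). uxx x t)"
    using u C1 by (auto simp: C1x_def)
  have slice: "continuous_on {0..l} (\<lambda>x. v x t)" if "continuous_on ({0..l} \<times> J) (\<lambda>(x, t). v x t)" "t \<in> J" for v J t
    by (rule continuous_on_compose_Pair[OF that(1)]) (use that(2) in \<open>auto intro: continuous_intros\<close>)
  have slice_t: "continuous_on {0..T} (u x)" if "x \<in> {0..l}" for x
    by (rule continuous_on_compose_Pair[OF u_cont]) (use that in \<open>auto intro: continuous_intros\<close>)
  have zero: "0 \<in> {0..T}" using T_pos by simp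
  have c_cont: "continuous_on {0..T} c" unfolding c_def by (rule fourier_coeff_continuous[OF u_cont])
  define G where "G = (\<lambda>t. fourier_coeff l k (\<lambda>x. f x t) - (\<sigma> t * (freq l k)\<^sup>2 + q t) * c t)"
  have G_cont: "continuous_on {0..T} G"
    unfolding G_def by (intro continuous_intros F(1) \<sigma>(1) q c_cont)
  let ?v = "\<lambda>x s. u x s - u x 0"
  have v_cont: "continuous_on ({0..l} \<times> {0..T}) (\<lambda>(x, t). ?v x t)"
    unfolding case_prod_beta
    by (intro continuous_on_diff continuous_on_compose_Pair[OF u_cont] continuous_intros) (use zero in auto)
  have prim: "frac_int (1 - \<rho>) (\<lambda>\<eta>. c \<eta> - c 0) t = fourier_coeff l k (\<lambda>x. caputo_primitive \<rho> (u x) t)"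
    if t: "t \<in> {0..T}" for t
  proof -
    have "frac_int (1 - \<rho>) (\<lambda>\<eta>. c \<eta> - c 0) t = frac_int (1 - \<rho>) (\<lambda>s. fourier_coeff l k (\<lambda>x. ?v x s)) t"
      by (rule frac_int_cong[OF _ t]) (use \<rho> t zero in \<open>auto simp: c_def intro!: fourier_coeff_diff[symmetric] slice[OF u_cont]\<close>)
    also have "\<dots> = fourier_coeff l k (\<lambda>x. frac_int (1 - \<rho>) (?v x) t)"
      using \<rho> by (intro fourier_coeff_frac_int[OF v_cont t, symmetric]) auto
    also have "\<dots> = fourier_coeff l k (\<lambda>x. caputo_primitive \<rho> (u x) t)"
      unfolding fourier_coeff_def
      by (intro arg_cong[where f = "\<lambda>y. 2 / l * y"] integral_cong)
         (use t in \<open>auto intro!: caputo_primitive_frac_int[OF \<rho>, symmetric] continuous_on_subset[OF slice_t]\<close>)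
    finally show ?thesis .
  qed
  have "c t = c 0 + frac_int \<rho> G t" if t: "t \<in> {0..T}" for t
  proof (rule frac_int_of_primitive[OF \<rho> T_pos c_cont G_cont _ t])
    fix t assume t: "t \<in> {0<..T}"
    hence t': "t \<in> {0..T}" by auto
    have nhd: "at t within {0<..T} = at t within {0..T}"
      by (rule at_within_nhd[of t "{0<..}"]) (use t in auto)
    \<comment> \<open>The parameter set excludes 0, because \<open>Du\<close> is jointly continuous
      only for positive times.\<close>
    have "((\<lambda>t. integral (cbox 0 l) (\<lambda>x. caputo_primitive \<rho> (u x) t * sin (freq l k * x))) has_field_derivative
        integral (cbox 0 l) (\<lambda>x. Du x t * sin (freq l k * x))) (at t within {0<..T})"
    proof (rule leibniz_rule_field_derivative)
      fix s x assume s: "s \<in> {0<..T}" and x: "x \<in> cbox 0 l"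
      have "(caputo_primitive \<rho> (u x) has_real_derivative Du x s) (at s within {0<..T})"
        using cap[of x s] s x unfolding has_caputo_def
        by (auto intro: has_field_derivative_subset simp: cbox_interval)
      thus "((\<lambda>s. caputo_primitive \<rho> (u x) s * sin (freq l k * x)) has_field_derivative Du x s * sin (freq l k * x))
          (at s within {0<..T})"
        by (rule DERIV_cmult_right)
    next
      fix s assume s: "s \<in> {0<..T}"
      hence s': "s \<in> {0..T}" by auto
      have "continuous_on {0..l} (\<lambda>x. frac_int (1 - \<rho>) (?v x) s)"
      proof -
        let ?p = "\<lambda>r. s * (1 - r powr (1 / (1 - \<rho>)))"
        have p: "continuous_on {0..1} ?p"
          using \<rho> by (intro continuous_intros continuous_on_powr_pos_exponent) auto
        have "continuous_on ({0..l} \<times> cbox 0 1) (\<lambda>(x, r). ?v x (?p r))"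
          unfolding case_prod_beta
          by (rule continuous_on_compose_Pair[OF v_cont continuous_on_fst[OF continuous_on_id]
                continuous_on_compose2[OF p continuous_on_snd[OF continuous_on_id]]])
             (use frac_int_point_mem(2)[OF _ _ s', of "1 - \<rho>"] \<rho> in \<open>auto simp: cbox_interval\<close>)
        from integral_continuous_on_param[OF this] show ?thesis
          unfolding frac_int_def by (intro continuous_on_mult continuous_on_const) (simp add: cbox_interval)
      qed
      moreover have "frac_int (1 - \<rho>) (?v x) s = caputo_primitive \<rho> (u x) s" if "x \<in> {0..l}" for x
        using s by (intro caputo_primitive_frac_int[OF \<rho>, symmetric] continuous_on_subset[OF slice_t[OF that]]) auto
      ultimately have "continuous_on {0..l} (\<lambda>x. caputo_primitive \<rho> (u x) s)"
        by (simp cong: continuous_on_cong_simp)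
      thus "(\<lambda>x. caputo_primitive \<rho> (u x) s * sin (freq l k * x)) integrable_on cbox 0 l"
        unfolding cbox_interval by (intro integrable_continuous_interval continuous_intros)
    next
      show "continuous_on ({0<..T} \<times> cbox 0 l) (\<lambda>(t, x). Du x t * sin (freq l k * x))"
        unfolding case_prod_beta
        by (intro continuous_on_mult continuous_on_compose_Pair[OF Du_cont] continuous_intros) (auto simp: cbox_interval)
    qed (use t in auto)
    hence "((\<lambda>t. fourier_coeff l k (\<lambda>x. caputo_primitive \<rho> (u x) t)) has_real_derivative fourier_coeff l k (\<lambda>x. Du x t))
        (at t within {0..T})"
      unfolding fourier_coeff_def nhd cbox_interval by (rule DERIV_cmult)
    moreover have "fourier_coeff l k (\<lambda>x. Du x t) = G t"
    proof -
      have "fourier_coeff l k (\<lambda>x. Du x t) = fourier_coeff l k (\<lambda>x. (f x t + \<sigma> t * uxx x t) + (- q t) * u x t)"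
        unfolding fourier_coeff_def
      \<comment> \<open>The equation is given only at interior points of the space interval; the two
        end points form a null set.\<close>
      proof (intro arg_cong[where f = "\<lambda>y. 2 / l * y"] integral_spike[of "{0, l}"])
        fix x assume "x \<in> {0..l} - {0, l}"
        hence "x \<in> {0<..<l}" by auto
        from eq[OF this t] have "Du x t = (f x t + \<sigma> t * uxx x t) + (- q t) * u x t" by simp
        thus "((f x t + \<sigma> t * uxx x t) + (- q t) * u x t) * sin (freq l k * x) = Du x t * sin (freq l k * x)" by simp
      qed auto
      also have "\<dots> = fourier_coeff l k (\<lambda>x. f x t) + \<sigma> t * fourier_coeff l k (\<lambda>x. uxx x t) + (- q t) * c t"
      proof -
        have fc: "continuous_on {0..l} (\<lambda>x. f x t)" using f(2)[OF t'] by (simp add: navier_def W2_rep_def)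
        note cs = slice[OF uxx_cont t] slice[OF u_cont t'] fc
        show ?thesis
          unfolding c_def
          by (subst fourier_coeff_linear; (subst fourier_coeff_linear)?) (auto intro!: continuous_intros cs)
      qed
      also have "fourier_coeff l k (\<lambda>x. uxx x t) = - (freq l k)\<^sup>2 * c t"
        using integral_sine_second_derivative[OF l dx dxx slice[OF uxx_cont t] bc(1)[OF t'] bc(2)[OF t'], of k] t
        by (simp add: fourier_coeff_def c_def)
      finally show ?thesis by (simp add: G_def algebra_simps)
    qed
    ultimately have *: "((\<lambda>t. fourier_coeff l k (\<lambda>x. caputo_primitive \<rho> (u x) t)) has_real_derivative G t) (at t within {0..T})"
      by simp
    show "(frac_int (1 - \<rho>) (\<lambda>\<eta>. c \<eta> - c 0) has_real_derivative G t) (at t within {0..T})"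
      by (rule has_field_derivative_transform_within[OF * zero_less_one t']) (simp add: prim)
  qed
  moreover have "c 0 = fourier_coeff l k \<phi>"
    unfolding c_def fourier_coeff_def by (intro arg_cong[where f = "\<lambda>y. 2 / l * y"] integral_cong) (simp add: init)
  ultimately show ?thesis
    unfolding mode_solution_def using c_cont by (simp add: c_def G_def)
qed

lemma solution_is_series:
  assumes sol: "inverse_solution \<rho> l T \<sigma> f \<phi> \<psi> u q" and x: "x \<in> {0..l}" and t: "t \<in> {0..T}"
  shows "u x t = series_solution q x t"
proof -
  have u: "C1x {0..T} l u" and q: "continuous_on {0..T} q" using sol by (auto simp: inverse_solution_def)
  have c: "fourier_coeff l k (\<lambda>x. u x t) = mode q k t" for k
    by (rule mode_solution_unique[OF q solution_mode[OF sol] t])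
  have "continuous_on ({0..l} \<times> {0..T}) (\<lambda>(x, t). u x t)" using u by (simp add: C1x_def)
  hence u_cont: "continuous_on {0..l} (\<lambda>x. u x t)"
    by (rule continuous_on_compose_Pair) (use t in \<open>auto intro: continuous_intros\<close>)
  have "summable (\<lambda>k. \<bar>fourier_coeff l k (\<lambda>x. u x t)\<bar>)"
    unfolding c using mode_abs_summable(1)[OF q _ t, of 0] by simp
  from sine_series_expansion[OF l u_cont this x] show ?thesis
    unfolding c series_solution_def .
qed

text \<open>The additional condition makes the flux equal to \<open>\<psi>\<close>. Both satisfy
  integral equations with the same initial value, so by injectivity of \<open>frac_int\<close> the
  sources agree, and dividing by \<open>\<psi>\<close> gives the feedback law.\<close>

lemma solution_fixpoint:
  assumes sol: "inverse_solution \<rho> l T \<sigma> f \<phi> \<psi> u q" and t: "t \<in> {0..T}"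
  shows "q t = feedback q t"
proof -
  have q: "continuous_on {0..T} q" and du: "\<And>t. t \<in> {0..T} \<Longrightarrow> ((\<lambda>x. u x t) has_real_derivative \<psi> t) (at 0 within {0..l})"
    using sol by (auto simp: inverse_solution_def)
  have zero: "0 \<in> {0..l}" using l by simp
  have flux: "mode_flux q s = \<psi> s" if s: "s \<in> {0..T}" for s
  proof (rule derivative_within_Icc_unique[OF l zero _ du[OF s]])
    have "((\<lambda>y. series_solution q y s) has_real_derivative mode_flux q s) (at 0 within {0..l})"
      using series_solution_derivative[OF q zero s] by (simp add: mode_flux_def mult.commute)
    thus "((\<lambda>x. u x s) has_real_derivative mode_flux q s) (at 0 within {0..l})"
      by (rule has_field_derivative_transform_within[OF _ zero_less_one zero])
         (use solution_is_series[OF sol _ s] in auto)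
  qed
  let ?h = "\<lambda>s. (\<Sum>k. freq l k * fourier_coeff l k (\<lambda>x. f x s)) - \<sigma> s * mode_sum q s - q s * mode_flux q s"
  have h: "continuous_on {0..T} ?h"
    by (intro continuous_intros source_flux_cont \<sigma>(1) mode_sum_cont mode_flux_cont q)
  have "caputo \<rho> \<psi> t - ?h t = 0"
  proof (rule frac_int_eq_0_imp[OF \<rho> T_pos _ _ t])
    show "continuous_on {0..T} (\<lambda>t. caputo \<rho> \<psi> t - ?h t)" by (intro continuous_on_diff Dpsi(1) h)
    fix s assume s: "s \<in> {0..T}"
    have "frac_int \<rho> (\<lambda>t. caputo \<rho> \<psi> t - ?h t) s = frac_int \<rho> (caputo \<rho> \<psi>) s - frac_int \<rho> ?h s"
      by (rule frac_int_diff[OF \<rho>(1) Dpsi(1) h s])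
    also have "\<dots> = (\<psi> s - \<psi> 0) - (mode_flux q s - \<psi> 0)"
      using Dpsi(2)[OF s] mode_flux_eq[OF q s] by linarith
    finally show "frac_int \<rho> (\<lambda>t. caputo \<rho> \<psi> t - ?h t) s = 0" using flux[OF s] by simp
  qed
  hence "q t * \<psi> t = feedback q t * \<psi> t"
    using Dpsi_eq[OF t, of q] flux[OF t] by simp
  thus ?thesis using \<psi>(2)[OF t] by simp
qed

theorem unique_solution:
  "\<exists>u q. inverse_solution \<rho> l T \<sigma> f \<phi> \<psi> u q \<and>
     (\<forall>u' q'. inverse_solution \<rho> l T \<sigma> f \<phi> \<psi> u' q' \<longrightarrow>
        (\<forall>x\<in>{0..l}. \<forall>t\<in>{0..T}. u' x t = u x t) \<and> (\<forall>t\<in>{0..T}. q' t = q t))"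
proof -
  obtain q where q: "continuous_on {0..T} q" "\<And>t. t \<in> {0..T} \<Longrightarrow> q t = feedback q t"
    using feedback_fixpoint_exists by blast
  have "(\<forall>x\<in>{0..l}. \<forall>t\<in>{0..T}. u' x t = series_solution q x t) \<and> (\<forall>t\<in>{0..T}. q' t = q t)"
    if sol: "inverse_solution \<rho> l T \<sigma> f \<phi> \<psi> u' q'" for u' q'
  proof -
    have q'_cont: "continuous_on {0..T} q'" using sol by (simp add: inverse_solution_def)
    have q': "q' t = q t" if "t \<in> {0..T}" for t
      by (rule fixpoint_unique[OF q'_cont solution_fixpoint[OF sol] q that])
    have "u' x t = series_solution q x t" if "x \<in> {0..l}" "t \<in> {0..T}" for x t
      using solution_is_series[OF sol that] mode_cong[OF q(1) q' that(2)] by (simp add: series_solution_def)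
    thus ?thesis using q' by blast
  qed
  thus ?thesis using series_solution_solves[OF q] by blast
qed

end

theorem theorem4p3:
  fixes \<rho> l T m\<^sub>\<sigma> M\<^sub>\<sigma> \<psi>\<^sub>0 :: real
    and \<sigma> \<phi> \<psi> :: "real \<Rightarrow> real"
    and f :: "real \<Rightarrow> real \<Rightarrow> real"
  assumes rho: "0 < \<rho>" "\<rho> < 1" and l: "l > 0" and T: "T > 0"
    and sigma: "continuous_on {0..T} \<sigma>" "0 < m\<^sub>\<sigma>"
      "\<And>t. t \<in> {0..T} \<Longrightarrow> m\<^sub>\<sigma> \<le> \<sigma> t \<and> \<sigma> t \<le> M\<^sub>\<sigma>"
    and A1: "C_W2 4 l T f"
      "\<And>k t. k \<ge> 1 \<Longrightarrow> t \<in> {0..T} \<Longrightarrow> sine_coeff l k (\<lambda>x. f x t) \<ge> 0"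
      "\<And>t. t \<in> {0..T} \<Longrightarrow> f 0 t = 0 \<and> f l t = 0 \<and>
         xderiv l 2 (\<lambda>x. f x t) 0 = 0 \<and> xderiv l 2 (\<lambda>x. f x t) l = 0"
    and A2: "W2_rep 4 l \<phi>"
      "\<And>k. k \<ge> 1 \<Longrightarrow> sine_coeff l k \<phi> \<ge> 0"
      "\<phi> 0 = 0" "\<phi> l = 0" "xderiv l 2 \<phi> 0 = 0" "xderiv l 2 \<phi> l = 0"
    and psi: "C1_on T \<psi>" "\<psi>\<^sub>0 > 0" "\<And>t. t \<in> {0..T} \<Longrightarrow> \<psi> t \<ge> \<psi>\<^sub>0"
    and compat: "xderiv l 1 \<phi> 0 = \<psi> 0"
    and cond3: "\<And>t. t \<in> {0..T} \<Longrightarrow>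
        0 \<le> T powr \<rho> / \<psi> t * (xderiv l 1 (\<lambda>x. f x t) 0 - caputo \<rho> \<psi> t) \<and>
        T powr \<rho> / \<psi> t * (xderiv l 1 (\<lambda>x. f x t) 0 - caputo \<rho> \<psi> t)
          < T powr \<rho> * pi\<^sup>2 / l\<^sup>2 * (M\<^sub>\<sigma> - m\<^sub>\<sigma>) - Gamma (\<rho> + 1)"
    and cond4: "T powr (2 * \<rho>) / Gamma (\<rho> + 1) *
          C_L2_norm l T (\<lambda>x t. wderiv l 4 (\<lambda>y. f y t) x) +
        T powr \<rho> * L2_norm l (wderiv l 4 \<phi>)
          < sqrt 6 * \<psi>\<^sub>0 * Gamma (\<rho> + 1) / (l * M\<^sub>\<sigma>)"
  shows "\<exists>u q. inverse_solution \<rho> l T \<sigma> f \<phi> \<psi> u q \<and>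
           (\<forall>u' q'. inverse_solution \<rho> l T \<sigma> f \<phi> \<psi> u' q' \<longrightarrow>
              (\<forall>x\<in>{0..l}. \<forall>t\<in>{0..T}. u' x t = u x t) \<and> (\<forall>t\<in>{0..T}. q' t = q t))"
proof -
  interpret inverse_problem \<rho> l T \<sigma> \<phi> \<psi> f
  proof
    fix t assume t: "t \<in> {0..T}"
    show "0 \<le> \<sigma> t" using sigma(2) sigma(3)[OF t] by simp
    show psi_pos: "0 < \<psi> t" using psi(2) psi(3)[OF t] by simp
    show "navier l (\<lambda>x. f x t)" using A1(1) A1(3)[OF t] t by (simp add: navier_def C_W2_def)
    show "0 \<le> fourier_coeff l k (\<lambda>x. f x t)" for k
      using A1(2)[of "Suc k" t] t l by (simp add: fourier_coeff_sine_coeff)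
    \<comment> \<open>Dividing the lower bound in \<open>cond3\<close> by this positive factor gives
      the sign that makes \<open>q\<^sub>0\<close> nonnegative.\<close>
    have "0 < T powr \<rho> / \<psi> t" using T psi_pos by simp
    hence "0 \<le> xderiv l 1 (\<lambda>x. f x t) 0 - caputo \<rho> \<psi> t"
      using cond3[OF t] zero_le_mult_iff by (meson linorder_not_less)
    thus "caputo \<rho> \<psi> t \<le> xderiv l 1 (\<lambda>x. f x t) 0" by simp
  next
    show "0 \<le> fourier_coeff l k \<phi>" for k
      using A2(2)[of "Suc k"] l by (simp add: fourier_coeff_sine_coeff)
    show "navier l \<phi>" using A2 by (simp add: navier_def)
  qed (use rho l T sigma(1) A1(1) psi(1) compat in auto)
  show ?thesis by (rule unique_solution)
qed

end
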